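(* Let $p\in[1,\infty)$. For each $n\in\mathbb N$ let $\mathbf X_n=(X_1^{(n)},\dots,X_n^{(n)})$ be a random vector that is either uniformly distributed over $\mathbb B_p^n$, or distributed according to the cone probability measure $\mu_p$ on $\mathbb S_p^{n-1}$, or distributed according to the surface probability measure $\sigma_p$ on $\mathbb S_p^{n-1}$. Let $$m_p:=\frac{\psi(\frac1p)+\log p}{p}.$$ Then $m_p<0$, and for every $a\in\mathbb R$, $$\lim_{n\to\infty}\mathbb P\bigg[\Big(\prod_{i=1}^n|X_i^{(n)}|\Big)^{1/n}\ge e^{m_p}\Big(1+\frac{a}{\sqrt n}\Big)\cdot\Big(\frac1n\sum_{i=1}^n|X_i^{(n)}|^p\Big)^{1/p}\bigg]=1-\Phi\left(\frac{pa}{\sqrt{\psi'(\frac1p)-p}}\right).$$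
   Context: For $p\in[1,\infty)$ and $x=(x_1,\dots,x_n)\in\mathbb R^n$ let $\|x\|_p=(\sum_{i=1}^n|x_i|^p)^{1/p}$, $\mathbb B_p^n=\{x\in\mathbb R^n:\|x\|_p\le1\}$ and $\mathbb S_p^{n-1}=\{x\in\mathbb R^n:\|x\|_p=1\}$. The uniform distribution on $\mathbb B_p^n$ is normalized Lebesgue measure. The cone probability measure $\mu_p$ on $\mathbb S_p^{n-1}$ is defined for Borel $A\subseteq\mathbb S_p^{n-1}$ by $\mu_p(A)=|\{rx:x\in A,\ r\in[0,1]\}|/|\mathbb B_p^n|$, where $|\cdot|$ is $n$-dimensional Lebesgue measure. The surface probability measure $\sigma_p$ on $\mathbb S_p^{n-1}$ is the $(n-1)$-dimensional Hausdorff measure on $\mathbb S_p^{n-1}$, normalized to be a probability measure. $\psi(x)=\Gamma'(x)/\Gamma(x)$, $x>0$, is the digamma function, $\psi'$ its derivative, and $\Phi$ is the distribution function of a standard normal random variable. *)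

theory Defs
  imports "HOL-Probability.Probability"
begin

text \<open>
  Since the dimension \<open>n\<close> tends to infinity, \<open>\<real>\<^sup>n\<close> cannot be a type here. It is the space of
  extensional functions \<open>{1..n} \<rightarrow>\<^sub>E UNIV\<close>, carrying the product of \<open>n\<close> copies of \<^const>\<open>lborel\<close>.
  The sets of this product are the Borel sets of \<open>\<real>\<^sup>n\<close>.
\<close>

definition lborel_Rn :: "nat \<Rightarrow> (nat \<Rightarrow> real) measure" where
  "lborel_Rn n = (\<Pi>\<^sub>M i\<in>{1..n}. lborel)"

definition p_norm :: "real \<Rightarrow> nat \<Rightarrow> (nat \<Rightarrow> real) \<Rightarrow> real" where
  "p_norm p n x = (\<Sum>i=1..n. \<bar>x i\<bar> powr p) powr (1 / p)"

definition p_ball :: "real \<Rightarrow> nat \<Rightarrow> (nat \<Rightarrow> real) set" where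
  "p_ball p n = {x \<in> space (lborel_Rn n). p_norm p n x \<le> 1}"

definition p_sphere :: "real \<Rightarrow> nat \<Rightarrow> (nat \<Rightarrow> real) set" where
  "p_sphere p n = {x \<in> space (lborel_Rn n). p_norm p n x = 1}"

definition uniform_p_ball :: "real \<Rightarrow> nat \<Rightarrow> (nat \<Rightarrow> real) measure" where
  "uniform_p_ball p n = uniform_measure (lborel_Rn n) (p_ball p n)"

definition cone_over :: "nat \<Rightarrow> (nat \<Rightarrow> real) set \<Rightarrow> (nat \<Rightarrow> real) set" where
  "cone_over n A = {(\<lambda>i\<in>{1..n}. r * x i) | r x. x \<in> A \<and> r \<in> {0..1}}"

text \<open>
  The two measures on the sphere are regarded as Borel measures on all of \<open>\<real>\<^sup>n\<close> that are
  concentrated on the sphere, so that all three distributions live on the same measurable space.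
  For \<open>n \<ge> 1\<close> both set functions are countably additive on the Borel sets (cones over disjoint
  subsets of the sphere meet at most in the origin; Hausdorff measure is a metric outer measure),
  so \<^const>\<open>measure_of\<close> takes on exactly the given values.
\<close>

definition cone_measure :: "real \<Rightarrow> nat \<Rightarrow> (nat \<Rightarrow> real) measure" where
  "cone_measure p n = measure_of (space (lborel_Rn n)) (sets (lborel_Rn n))
     (\<lambda>A. emeasure (lborel_Rn n) (cone_over n (A \<inter> p_sphere p n))
            / emeasure (lborel_Rn n) (p_ball p n))"

definition diam_Rn :: "nat \<Rightarrow> (nat \<Rightarrow> real) set \<Rightarrow> ennreal" where
  "diam_Rn n U = (SUP x\<in>U. SUP y\<in>U. ennreal (L2_set (\<lambda>i. x i - y i) {1..n}))"

text \<open>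
  The \<open>d\<close>-dimensional Hausdorff (outer) measure on \<open>\<real>\<^sup>n\<close> for the Euclidean distance. Some authors
  include a constant factor depending only on \<open>d\<close>; it cancels in the normalised surface measure.
  The case distinction matters for \<open>d = 0\<close> only, where \<open>0 ^ 0 = 1\<close> must not count empty sets in the
  cover: the 0-dimensional Hausdorff measure is counting measure.
\<close>

definition hausdorff_delta :: "nat \<Rightarrow> nat \<Rightarrow> real \<Rightarrow> (nat \<Rightarrow> real) set \<Rightarrow> ennreal" where
  "hausdorff_delta n d \<delta> A =
     (INF U \<in> {U :: nat \<Rightarrow> (nat \<Rightarrow> real) set. A \<subseteq> (\<Union>k. U k) \<and>
                 (\<forall>k. U k \<subseteq> space (lborel_Rn n) \<and> diam_Rn n (U k) \<le> ennreal \<delta>)}.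
        \<Sum>k. if U k = {} then 0 else diam_Rn n (U k) ^ d)"

definition hausdorff_measure :: "nat \<Rightarrow> nat \<Rightarrow> (nat \<Rightarrow> real) set \<Rightarrow> ennreal" where
  "hausdorff_measure n d A = (SUP \<delta>\<in>{0<..}. hausdorff_delta n d \<delta> A)"

definition surface_measure :: "real \<Rightarrow> nat \<Rightarrow> (nat \<Rightarrow> real) measure" where
  "surface_measure p n = measure_of (space (lborel_Rn n)) (sets (lborel_Rn n))
     (\<lambda>A. hausdorff_measure n (n - 1) (A \<inter> p_sphere p n)
            / hausdorff_measure n (n - 1) (p_sphere p n))"

definition m_exponent :: "real \<Rightarrow> real" where
  "m_exponent p = (Digamma (1 / p) + ln p) / p"

end

theory Submission
  imports Defs
begin

text \<open>
  The event in question is invariant under positive scaling. Let \<open>Y\<close> have independent coordinates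
  with density proportional to \<open>exp (- \<bar>y\<bar>\<^sup>p)\<close>. As the joint density depends on the \<open>p\<close>-norm only, the
  uniform distribution and the cone measure give a scaling invariant event \<open>E\<close> the mass
  \<open>P (Y \<in> E)\<close>.

  For surface measure, Hausdorff measure is a constant multiple of Lebesgue measure on every
  hyperplane, with the same constant for all hyperplanes, since reflections carry them into each other.
  Near a smooth point the sphere is almost isometric to its tangent hyperplane under radial projection.
  Comparing with the volume of cones, the surface mass of \<open>E\<close> is
  \<open>\<integral>\<^bsub>Y \<in> E\<^esub> g(Y) dP / \<integral> g(Y) dP\<close>, where \<open>g(y)\<^sup>2\<close> is the sum of the \<open>\<bar>y\<^sub>i\<bar>\<^bsup>2p-2\<^esup>\<close>. As \<open>g(Y) / \<surd>n\<close> converges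
  to a constant in \<open>L\<^sup>1\<close>, surface measure gives the same limit.

  Taking logarithms and linearising \<open>ln\<close> at the mean reduces \<open>P (Y \<in> E)\<close> to the central limit theorem
  for \<open>ln \<bar>Y\<^sub>i\<bar> - \<bar>Y\<^sub>i\<bar>\<^sup>p\<close>. Its moments are derivatives of the Gamma function because
  \<open>\<integral> \<bar>y\<bar>\<^bsup>x-1\<^esup> exp (- \<bar>y\<bar>\<^sup>p) dy = 2/p \<Gamma>(x/p)\<close>.
\<close>

section \<open>Hausdorff measure as a Borel measure\<close>

text \<open>Why the weight is \<open>g\<close>: the cone over a surface element has volume
  proportional to the element times the distance of its tangent hyperplane from the origin, and on
  the sphere this distance is 1 / g. Multiplying by \<open>g\<close> turns cone volume back into
  surface area. Off the sphere \<open>g\<close> is homogeneous of degree p - 1, which adds a radial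
  factor common to all directions; it cancels on normalisation.

  No constant of proportionality is evaluated: the Hausdorff measure of the unit cube and the radial
  integrals are the same at every point of the sphere and drop out of quotients. That the area of
  the sphere is positive and finite is read off the hypothesis that the distribution of a random
  vector equals the surface measure.

  Obstacle: where a coordinate vanishes the sphere may have corners (p = 1). These points must be
  shown to be null separately, and what remains is not compact, so local comparisons are patched
  over countably many pieces.\<close>

definition edist :: "nat \<Rightarrow> (nat \<Rightarrow> real) \<Rightarrow> (nat \<Rightarrow> real) \<Rightarrow> real" where
  "edist n x y = L2_set (\<lambda>i. x i - y i) {1..n}"

abbreviation Rn :: "nat \<Rightarrow> (nat \<Rightarrow> real) set" where
  "Rn n \<equiv> space (lborel_Rn n)"

lemma edist_nonneg [simp]: "0 \<le> edist n x y"
  by (simp add: edist_def)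

lemma edist_self [simp]: "edist n x x = 0"
  by (simp add: edist_def L2_set_def)

lemma space_lborel_Rn: "Rn n = {1..n} \<rightarrow>\<^sub>E UNIV"
  by (simp add: lborel_Rn_def space_PiM)

lemma abs_coord_le_edist: "i \<in> {1..n} \<Longrightarrow> \<bar>x i - y i\<bar> \<le> edist n x y"
  using member_le_L2_set[of "{1..n}" i "\<lambda>i. \<bar>x i - y i\<bar>"] by (simp add: edist_def L2_set_def)

lemma diam_Rn_le_iff:
  "diam_Rn n U \<le> c \<longleftrightarrow> (\<forall>x\<in>U. \<forall>y\<in>U. ennreal (edist n x y) \<le> c)"
  by (simp add: diam_Rn_def edist_def SUP_le_iff)

lemma edist_le_diam_Rn: "x \<in> U \<Longrightarrow> y \<in> U \<Longrightarrow> ennreal (edist n x y) \<le> diam_Rn n U"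
  using diam_Rn_le_iff by blast

lemma diam_Rn_mono: "U \<subseteq> V \<Longrightarrow> diam_Rn n U \<le> diam_Rn n V"
  unfolding diam_Rn_le_iff by (blast intro: edist_le_diam_Rn)

definition delta_cover :: "nat \<Rightarrow> real \<Rightarrow> (nat \<Rightarrow> real) set \<Rightarrow> (nat \<Rightarrow> (nat \<Rightarrow> real) set) \<Rightarrow> bool" where
  "delta_cover n \<delta> A U \<longleftrightarrow> A \<subseteq> (\<Union>k. U k) \<and> (\<forall>k. U k \<subseteq> Rn n \<and> diam_Rn n (U k) \<le> ennreal \<delta>)"

definition diam_pow :: "nat \<Rightarrow> nat \<Rightarrow> (nat \<Rightarrow> real) set \<Rightarrow> ennreal" where
  "diam_pow n d U = (if U = {} then 0 else diam_Rn n U ^ d)"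

lemma hausdorff_delta_eq:
  "hausdorff_delta n d \<delta> A = (INF U \<in> Collect (delta_cover n \<delta> A). \<Sum>k. diam_pow n d (U k))"
  unfolding hausdorff_delta_def delta_cover_def diam_pow_def ..

lemma hausdorff_delta_le:
  "delta_cover n \<delta> A U \<Longrightarrow> hausdorff_delta n d \<delta> A \<le> (\<Sum>k. diam_pow n d (U k))"
  unfolding hausdorff_delta_eq by (rule INF_lower) simp

lemma hausdorff_delta_greatest:
  "(\<And>U. delta_cover n \<delta> A U \<Longrightarrow> c \<le> (\<Sum>k. diam_pow n d (U k))) \<Longrightarrow> c \<le> hausdorff_delta n d \<delta> A"
  unfolding hausdorff_delta_eq by (rule INF_greatest) simp

lemma diam_pow_mono: "U \<subseteq> V \<Longrightarrow> diam_pow n d U \<le> diam_pow n d V"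
  by (auto simp: diam_pow_def intro!: power_mono diam_Rn_mono)

lemma hausdorff_delta_mono:
  assumes "A \<subseteq> B" "\<delta>' \<le> \<delta>"
  shows "hausdorff_delta n d \<delta> A \<le> hausdorff_delta n d \<delta>' B"
proof (rule hausdorff_delta_greatest)
  fix U assume "delta_cover n \<delta>' B U"
  moreover have "ennreal \<delta>' \<le> ennreal \<delta>" using assms by (simp add: ennreal_leI)
  ultimately have "delta_cover n \<delta> A U"
    using assms(1) unfolding delta_cover_def by (blast intro: order_trans)
  then show "hausdorff_delta n d \<delta> A \<le> (\<Sum>k. diam_pow n d (U k))"
    by (rule hausdorff_delta_le)
qed

lemma hausdorff_delta_empty: "hausdorff_delta n d \<delta> {} = 0"
proof -
  have "delta_cover n \<delta> {} (\<lambda>_. {})" by (simp add: delta_cover_def diam_Rn_def)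
  from hausdorff_delta_le[OF this, of d] show ?thesis by (simp add: diam_pow_def)
qed

text \<open>Near-optimal covers of the sets \<open>A i\<close>, with excess
  \<open>e * (1/2)^Suc i\<close>, are merged into a single sequence by pairing indices, so the total
  excess is \<open>e\<close>.\<close>

lemma hausdorff_delta_subadditive:
  "hausdorff_delta n d \<delta> (\<Union>i. A i) \<le> (\<Sum>i. hausdorff_delta n d \<delta> (A i))"
proof (cases "(\<Sum>i. hausdorff_delta n d \<delta> (A i)) = \<infinity>")
  case False
  show ?thesis
  proof (rule ennreal_le_epsilon)
    fix e :: real assume e: "e > 0"
    have fin: "hausdorff_delta n d \<delta> (A i) < \<infinity>" for i
      using False by (metis ennreal_suminf_lessD infinity_ennreal_def less_top)
    have "\<exists>U. delta_cover n \<delta> (A i) U \<and>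
            (\<Sum>k. diam_pow n d (U k)) < hausdorff_delta n d \<delta> (A i) + ennreal (e * (1/2)^Suc i)" for i
    proof (rule ccontr)
      assume "\<nexists>U. delta_cover n \<delta> (A i) U \<and>
            (\<Sum>k. diam_pow n d (U k)) < hausdorff_delta n d \<delta> (A i) + ennreal (e * (1/2)^Suc i)"
      then have "hausdorff_delta n d \<delta> (A i) + ennreal (e * (1/2)^Suc i) \<le> hausdorff_delta n d \<delta> (A i)"
        by (intro hausdorff_delta_greatest) (auto simp: not_less)
      moreover have "ennreal (e * (1/2)^Suc i) > 0" using e by simp
      ultimately show False using fin[of i]
        by (metis add.right_neutral ennreal_add_left_cancel_le infinity_ennreal_def leD not_le top.not_eq_extremum)
    qed
    then obtain U where U: "\<And>i. delta_cover n \<delta> (A i) (U i)"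
      and le: "\<And>i. (\<Sum>k. diam_pow n d (U i k)) < hausdorff_delta n d \<delta> (A i) + ennreal (e * (1/2)^Suc i)"
      by metis
    define W where "W k = (case prod_decode k of (i, j) \<Rightarrow> U i j)" for k
    have W: "W (prod_encode (i, j)) = U i j" for i j by (simp add: W_def)
    have "delta_cover n \<delta> (\<Union>i. A i) W"
      unfolding delta_cover_def
    proof safe
      fix x i assume "x \<in> A i"
      then obtain j where "x \<in> U i j" using U[of i] unfolding delta_cover_def by blast
      then show "x \<in> (\<Union>k. W k)" using W by (metis UNIV_I UN_iff)
    next
      fix k x assume "x \<in> W k" then show "x \<in> Rn n"
        using U unfolding delta_cover_def W_def by (auto split: prod.splits)
    next
      fix k show "diam_Rn n (W k) \<le> ennreal \<delta>"
        using U unfolding delta_cover_def W_def by (auto split: prod.splits)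
    qed
    from hausdorff_delta_le[OF this, of d]
    have "hausdorff_delta n d \<delta> (\<Union>i. A i) \<le> (\<Sum>k. diam_pow n d (W k))" .
    also have "\<dots> = (\<Sum>k. (\<lambda>(i, j). diam_pow n d (U i j)) (prod_decode k))"
      by (auto simp: W_def intro!: suminf_cong split: prod.splits)
    also have "\<dots> = (\<Sum>i. \<Sum>j. diam_pow n d (U i j))"
      using suminf_ennreal_2dimen[of "\<lambda>i. \<Sum>j. diam_pow n d (U i j)" "\<lambda>(i, j). diam_pow n d (U i j)"]
      by (simp add: comp_def)
    also have "\<dots> \<le> (\<Sum>i. hausdorff_delta n d \<delta> (A i) + ennreal (e * (1/2)^Suc i))"
      by (intro suminf_le less_imp_le[OF le]) auto
    also have "\<dots> = (\<Sum>i. hausdorff_delta n d \<delta> (A i)) + (\<Sum>i. ennreal (e * (1/2)^Suc i))"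
      by (rule suminf_add[symmetric]) auto
    also have "(\<Sum>i. ennreal (e * (1/2)^Suc i)) = ennreal e"
    proof -
      have "(\<lambda>i. e * (1/2)^Suc i) sums (e * 1)" by (intro sums_mult power_half_series)
      then show ?thesis using e by (subst suminf_ennreal2) (auto simp: sums_iff)
    qed
    finally show "hausdorff_delta n d \<delta> (\<Union>i. A i) \<le> (\<Sum>i. hausdorff_delta n d \<delta> (A i)) + ennreal e" .
  qed
qed simp

lemma hausdorff_measure_ge: "\<delta> > 0 \<Longrightarrow> hausdorff_delta n d \<delta> A \<le> hausdorff_measure n d A"
  unfolding hausdorff_measure_def by (rule SUP_upper) simp

lemma hausdorff_measure_least:
  "(\<And>\<delta>. \<delta> > 0 \<Longrightarrow> hausdorff_delta n d \<delta> A \<le> c) \<Longrightarrow> hausdorff_measure n d A \<le> c"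
  unfolding hausdorff_measure_def by (rule SUP_least) simp

lemma hausdorff_measure_mono: "A \<subseteq> B \<Longrightarrow> hausdorff_measure n d A \<le> hausdorff_measure n d B"
  by (intro hausdorff_measure_least) (meson hausdorff_delta_mono hausdorff_measure_ge order_refl order_trans)

lemma hausdorff_measure_empty: "hausdorff_measure n d {} = 0"
  unfolding hausdorff_measure_def hausdorff_delta_empty by (simp add: SUP_constant greaterThan_non_empty)

lemma hausdorff_measure_subadditive:
  "hausdorff_measure n d (\<Union>i. A i) \<le> (\<Sum>i. hausdorff_measure n d (A i))"
proof (rule hausdorff_measure_least)
  fix \<delta> :: real assume "\<delta> > 0"
  have "hausdorff_delta n d \<delta> (\<Union>i. A i) \<le> (\<Sum>i. hausdorff_delta n d \<delta> (A i))"
    by (rule hausdorff_delta_subadditive)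
  also have "\<dots> \<le> (\<Sum>i. hausdorff_measure n d (A i))"
    by (intro suminf_le hausdorff_measure_ge \<open>\<delta> > 0\<close>) auto
  finally show "hausdorff_delta n d \<delta> (\<Union>i. A i) \<le> \<dots>" .
qed

lemma hausdorff_measure_Un_le:
  "hausdorff_measure n d (A \<union> B) \<le> hausdorff_measure n d A + hausdorff_measure n d B"
proof -
  have "hausdorff_measure n d (\<Union>i. binaryset A B i) \<le> (\<Sum>i. hausdorff_measure n d (binaryset A B i))"
    by (rule hausdorff_measure_subadditive)
  also have "\<dots> = hausdorff_measure n d A + hausdorff_measure n d B"
    by (rule suminf_binaryset_eq) (simp add: hausdorff_measure_empty)
  finally show ?thesis by (simp add: UN_binaryset_eq)
qed

text \<open>A cover of \<open>A\<close> of mesh \<delta> / L is carried by \<open>f\<close> to a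
  cover of the image of mesh \<delta>. The ambient dimensions may differ, which lets flat sets be
  compared with sets in a lower-dimensional space.\<close>

lemma hausdorff_measure_lipschitz_image:
  assumes L: "L > 0"
    and f: "\<And>x. x \<in> A \<Longrightarrow> f x \<in> Rn n'"
    and lip: "\<And>x y. x \<in> A \<Longrightarrow> y \<in> A \<Longrightarrow> edist n' (f x) (f y) \<le> L * edist n x y"
  shows "hausdorff_measure n' d (f ` A) \<le> ennreal L ^ d * hausdorff_measure n d A"
proof (rule hausdorff_measure_least)
  fix \<delta> :: real assume \<delta>: "\<delta> > 0"
  \<comment> \<open>Dividing by L^d first leaves the infimum alone on the right, so the bound can be
    checked for one cover at a time.\<close>
  have "ennreal (1 / L) ^ d * hausdorff_delta n' d \<delta> (f ` A) \<le> hausdorff_delta n d (\<delta> / L) A"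
  proof (rule hausdorff_delta_greatest)
    fix U assume U: "delta_cover n (\<delta> / L) A U"
    \<comment> \<open>Cutting with \<open>A\<close> matters: \<open>f\<close> is controlled only
      there, while a covering set may stick out.\<close>
    define W where "W k = f ` (U k \<inter> A)" for k
    have dW: "diam_Rn n' (W k) \<le> ennreal L * diam_Rn n (U k)" for k
      unfolding diam_Rn_le_iff W_def
    proof safe
      fix x y assume *: "x \<in> U k" "x \<in> A" "y \<in> U k" "y \<in> A"
      have "ennreal (edist n' (f x) (f y)) \<le> ennreal L * ennreal (edist n x y)"
        using lip[OF *(2,4)] L by (subst ennreal_mult[symmetric]) (auto intro!: ennreal_leI)
      also have "\<dots> \<le> ennreal L * diam_Rn n (U k)"
        using * by (intro mult_left_mono edist_le_diam_Rn) auto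
      finally show "ennreal (edist n' (f x) (f y)) \<le> ennreal L * diam_Rn n (U k)" .
    qed
    have "delta_cover n' \<delta> (f ` A) W"
      unfolding delta_cover_def
    proof safe
      fix x assume "x \<in> A" then show "f x \<in> (\<Union>k. W k)"
        using U unfolding delta_cover_def W_def by blast
    next
      fix k x assume "x \<in> W k" then show "x \<in> Rn n'" using f by (auto simp: W_def)
    next
      fix k
      have "diam_Rn n' (W k) \<le> ennreal L * ennreal (\<delta> / L)"
        using dW[of k] U by (meson delta_cover_def mult_left_mono order_trans zero_le)
      also have "\<dots> = ennreal \<delta>" using L \<delta> by (subst ennreal_mult[symmetric]) auto
      finally show "diam_Rn n' (W k) \<le> ennreal \<delta>" .
    qed
    then have "ennreal (1 / L) ^ d * hausdorff_delta n' d \<delta> (f ` A) \<le> ennreal (1 / L) ^ d * (\<Sum>k. diam_pow n' d (W k))"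
      by (intro mult_left_mono hausdorff_delta_le) auto
    also have "\<dots> = (\<Sum>k. ennreal (1 / L) ^ d * diam_pow n' d (W k))"
      by simp
    also have "\<dots> \<le> (\<Sum>k. diam_pow n d (U k))"
    proof (intro suminf_le allI)
      fix k
      show "ennreal (1 / L) ^ d * diam_pow n' d (W k) \<le> diam_pow n d (U k)"
      proof (cases "W k = {}")
        case False
        then have ne: "U k \<noteq> {}" by (auto simp: W_def)
        have "ennreal (1 / L) ^ d * diam_Rn n' (W k) ^ d \<le> ennreal (1 / L) ^ d * (ennreal L * diam_Rn n (U k)) ^ d"
          by (intro mult_left_mono power_mono dW) auto
        also have "\<dots> = (ennreal (1 / L) * ennreal L) ^ d * diam_Rn n (U k) ^ d"
          by (simp add: power_mult_distrib mult.assoc)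
        also have "ennreal (1 / L) * ennreal L = 1" using L by (subst ennreal_mult[symmetric]) auto
        finally show ?thesis using False ne by (simp add: diam_pow_def)
      qed (simp add: diam_pow_def)
    qed auto
    finally show "ennreal (1 / L) ^ d * hausdorff_delta n' d \<delta> (f ` A) \<le> (\<Sum>k. diam_pow n d (U k))" .
  qed
  also have "\<dots> \<le> hausdorff_measure n d A" using L \<delta> by (intro hausdorff_measure_ge) auto
  finally have "ennreal L ^ d * (ennreal (1 / L) ^ d * hausdorff_delta n' d \<delta> (f ` A)) \<le> ennreal L ^ d * hausdorff_measure n d A"
    by (intro mult_left_mono) auto
  moreover have "ennreal L ^ d * ennreal (1 / L) ^ d = 1"
    using L by (simp add: power_mult_distrib[symmetric] ennreal_mult[symmetric])
  ultimately show "hausdorff_delta n' d \<delta> (f ` A) \<le> ennreal L ^ d * hausdorff_measure n d A"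
    by (metis mult.assoc mult_1)
qed

text \<open>The Lipschitz bound with constant 1 applies to \<open>f\<close> and to its inverse.
  Injectivity uses that \<open>A\<close> lies in \<open>Rn n\<close>, since \<open>edist\<close>
  does not see coordinates outside \<open>{1..n}\<close>.\<close>

lemma hausdorff_measure_isometric_image:
  assumes f: "\<And>x. x \<in> A \<Longrightarrow> f x \<in> Rn n'" and A: "A \<subseteq> Rn n"
    and iso: "\<And>x y. x \<in> A \<Longrightarrow> y \<in> A \<Longrightarrow> edist n' (f x) (f y) = edist n x y"
  shows "hausdorff_measure n' d (f ` A) = hausdorff_measure n d A"
proof (rule antisym)
  show "hausdorff_measure n' d (f ` A) \<le> hausdorff_measure n d A"
    using hausdorff_measure_lipschitz_image[of 1 A f n' n d] f iso by simp
  have inj: "inj_on f A"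
  proof (rule inj_onI)
    fix x y assume *: "x \<in> A" "y \<in> A" "f x = f y"
    then have "edist n x y = 0" using iso[of x y] by simp
    then have "x i = y i" if "i \<in> {1..n}" for i using abs_coord_le_edist[OF that, of x y] by simp
    then show "x = y" using * A unfolding space_lborel_Rn by (intro PiE_ext[of x "{1..n}" "\<lambda>_. UNIV" y]) auto
  qed
  have "hausdorff_measure n d (the_inv_into A f ` f ` A) \<le> ennreal 1 ^ d * hausdorff_measure n' d (f ` A)"
    using A iso inj by (intro hausdorff_measure_lipschitz_image) (auto simp: the_inv_into_f_f)
  moreover have "the_inv_into A f ` f ` A = A" using inj by (auto simp: image_image the_inv_into_f_f)
  ultimately show "hausdorff_measure n d A \<le> hausdorff_measure n' d (f ` A)" by simp
qed

text \<open>A set of diameter below \<open>r\<close> cannot meet both \<open>A\<close> and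
  \<open>B\<close>, so each member of a fine cover of the union is charged to at most one of the two
  sets.\<close>

lemma hausdorff_measure_separated:
  assumes r: "r > 0" and sep: "\<And>x y. x \<in> A \<Longrightarrow> y \<in> B \<Longrightarrow> r \<le> edist n x y"
  shows "hausdorff_measure n d A + hausdorff_measure n d B \<le> hausdorff_measure n d (A \<union> B)"
proof -
  have *: "hausdorff_delta n d \<delta> A + hausdorff_delta n d \<delta> B \<le> hausdorff_measure n d (A \<union> B)"
    if \<delta>: "\<delta> > 0" "\<delta> < r" for \<delta>
  proof (rule order_trans[OF hausdorff_delta_greatest hausdorff_measure_ge[OF \<delta>(1)]])
    fix U assume U: "delta_cover n \<delta> (A \<union> B) U"
    have sub: "delta_cover n \<delta> C (\<lambda>k. U k \<inter> C)" if "C \<subseteq> A \<union> B" for C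
      unfolding delta_cover_def
    proof (intro conjI allI)
      show "C \<subseteq> (\<Union>k. U k \<inter> C)" using U that unfolding delta_cover_def by blast
      fix k show "U k \<inter> C \<subseteq> Rn n" using U unfolding delta_cover_def by blast
      have "diam_Rn n (U k \<inter> C) \<le> diam_Rn n (U k)" by (rule diam_Rn_mono) auto
      also have "\<dots> \<le> ennreal \<delta>" using U unfolding delta_cover_def by blast
      finally show "diam_Rn n (U k \<inter> C) \<le> ennreal \<delta>" .
    qed
    have "hausdorff_delta n d \<delta> A + hausdorff_delta n d \<delta> B \<le>
        (\<Sum>k. diam_pow n d (U k \<inter> A)) + (\<Sum>k. diam_pow n d (U k \<inter> B))"
      by (intro add_mono hausdorff_delta_le sub) auto
    also have "\<dots> = (\<Sum>k. diam_pow n d (U k \<inter> A) + diam_pow n d (U k \<inter> B))"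
      by (rule suminf_add) auto
    also have "\<dots> \<le> (\<Sum>k. diam_pow n d (U k))"
    proof (intro suminf_le allI)
      fix k
      have "U k \<inter> A = {} \<or> U k \<inter> B = {}"
      proof (rule ccontr)
        assume "\<not> ?thesis"
        then obtain x y where xy: "x \<in> U k" "x \<in> A" "y \<in> U k" "y \<in> B" by blast
        then have "ennreal r \<le> diam_Rn n (U k)"
          using sep edist_le_diam_Rn[of x "U k" y n] by (meson ennreal_leI order_trans)
        also have "\<dots> \<le> ennreal \<delta>" using U unfolding delta_cover_def by blast
        finally show False using \<delta> by (simp add: ennreal_le_iff)
      qed
      then show "diam_pow n d (U k \<inter> A) + diam_pow n d (U k \<inter> B) \<le> diam_pow n d (U k)"
        using diam_pow_mono[of "U k \<inter> A" "U k" n d] diam_pow_mono[of "U k \<inter> B" "U k" n d]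
        by (auto simp: diam_pow_def[of n d "{}"])
    qed auto
    finally show "hausdorff_delta n d \<delta> A + hausdorff_delta n d \<delta> B \<le> (\<Sum>k. diam_pow n d (U k))" .
  qed
  have "hausdorff_measure n d A + hausdorff_measure n d B
      = (SUP \<delta>\<in>{0<..}. SUP \<delta>'\<in>{0<..}. hausdorff_delta n d \<delta> A + hausdorff_delta n d \<delta>' B)"
    unfolding hausdorff_measure_def
    by (simp add: ennreal_SUP_add_left ennreal_SUP_add_right[symmetric])
  also have "\<dots> \<le> hausdorff_measure n d (A \<union> B)"
  proof (intro SUP_least)
    fix \<delta> \<delta>' :: real assume "\<delta> \<in> {0<..}" "\<delta>' \<in> {0<..}"
    \<comment> \<open>Replacing both meshes by a smaller one only increases the two values; the half
      of \<open>r\<close> brings the mesh strictly below the separation.\<close>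
    define e where "e = min (min \<delta> \<delta>') (r / 2)"
    have "e > 0" "e < r" "e \<le> \<delta>" "e \<le> \<delta>'" using \<open>\<delta> \<in> _\<close> \<open>\<delta>' \<in> _\<close> r by (auto simp: e_def)
    then have "hausdorff_delta n d \<delta> A + hausdorff_delta n d \<delta>' B \<le> hausdorff_delta n d e A + hausdorff_delta n d e B"
      by (intro add_mono hausdorff_delta_mono) auto
    also have "\<dots> \<le> hausdorff_measure n d (A \<union> B)" using * \<open>e > 0\<close> \<open>e < r\<close> by blast
    finally show "hausdorff_delta n d \<delta> A + hausdorff_delta n d \<delta>' B \<le> hausdorff_measure n d (A \<union> B)" .
  qed
  finally show ?thesis .
qed

text \<open>
  The half space \<open>c < x i\<close> is cut into layers \<open>D j\<close> approaching its boundary. Layers whose indices have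
  the same parity are separated, so the measures of all layers sum to at most twice that of \<open>T\<close>,
  and the layers close to the boundary are negligible.
\<close>

lemma hausdorff_measure_halfspace:
  assumes i: "i \<in> {1..n}"
  shows "hausdorff_measure n d {x\<in>T. x i \<le> c} + hausdorff_measure n d {x\<in>T. c < x i} \<le> hausdorff_measure n d T"
proof (cases "hausdorff_measure n d T = \<infinity>")
  case False
  let ?H = "hausdorff_measure n d"
  have sep: "?H A + ?H B \<le> ?H (A \<union> B)"
    if "s < t" "\<And>x. x \<in> A \<Longrightarrow> x i \<le> s" "\<And>x. x \<in> B \<Longrightarrow> t < x i" for A B and s t :: real
  proof (rule hausdorff_measure_separated[of "t - s"])
    fix x y assume "x \<in> A" "y \<in> B"
    then have "x i \<le> s" "t < y i" using that by auto
    then show "t - s \<le> edist n x y" using abs_coord_le_edist[OF i, of x y] by linarith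
  qed (use that in simp)
  define q where "q j = c + 1 / real (Suc j)" for j
  have q: "q j < q k" if "k < j" for j k
    using that unfolding q_def by (intro add_strict_left_mono divide_strict_left_mono) auto
  define D where "D j = {x\<in>T. q (Suc j) < x i \<and> x i \<le> q j}" for j
  have fin_sum: "(\<Sum>j<m. ?H (D (2 * j + e))) \<le> ?H T" for m e
  proof -
    have "(\<Sum>j<m. ?H (D (2 * j + e))) \<le> ?H (\<Union>j<m. D (2 * j + e))"
    proof (induction m)
      case (Suc m)
      have "(\<Sum>j<Suc m. ?H (D (2 * j + e))) \<le> ?H (D (2 * m + e)) + ?H (\<Union>j<m. D (2 * j + e))"
        using Suc by (simp add: add.commute add_left_mono)
      also have "\<dots> \<le> ?H (D (2 * m + e) \<union> (\<Union>j<m. D (2 * j + e)))"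
      proof (cases "m = 0")
        case False
        show ?thesis
        proof (rule sep)
          \<comment> \<open>The separating gap is the layer of the other parity: on
            \<open>D (2 * m + e)\<close> the coordinate is at most \<open>q (2 * m + e)\<close>, on
            the earlier layers of that parity it exceeds \<open>q (2 * m + e - 1)\<close>.\<close>
          show "q (2 * m + e) < q (2 * m + e - 1)" using False by (intro q) auto
          fix x assume "x \<in> (\<Union>j<m. D (2 * j + e))"
          then obtain j where j: "j < m" "q (Suc (2 * j + e)) < x i" by (auto simp: D_def)
          have "Suc (2 * j + e) \<le> 2 * m + e - 1" using j(1) by auto
          then have "q (2 * m + e - 1) \<le> q (Suc (2 * j + e))"
            using q by (metis le_less order_le_less)
          with j show "q (2 * m + e - 1) < x i" by linarith
        qed (auto simp: D_def)
      qed (simp add: hausdorff_measure_empty)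
      also have "D (2 * m + e) \<union> (\<Union>j<m. D (2 * j + e)) = (\<Union>j<Suc m. D (2 * j + e))"
        by (auto simp: lessThan_Suc)
      finally show ?case .
    qed simp
    also have "\<dots> \<le> ?H T" by (intro hausdorff_measure_mono) (auto simp: D_def)
    finally show ?thesis .
  qed
  have split: "(\<Sum>j<2 * m. ?H (D j)) = (\<Sum>j<m. ?H (D (2 * j + 0))) + (\<Sum>j<m. ?H (D (2 * j + 1)))" for m
    by (induction m) (auto simp: ac_simps)
  have bd2: "(\<Sum>j<2 * m. ?H (D j)) \<le> ?H T + ?H T" for m
    unfolding split by (intro add_mono fin_sum)
  have "(\<Sum>j. ?H (D j)) \<le> ?H T + ?H T"
    unfolding suminf_eq_SUP
  proof (rule SUP_least)
    fix m show "(\<Sum>j<m. ?H (D j)) \<le> ?H T + ?H T"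
      by (rule order_trans[OF sum_mono2[of "{..<2 * m}"] bd2[of m]]) auto
  qed
  also have "\<dots> < \<infinity>" using False by (auto simp: less_top)
  finally have fin: "(\<Sum>j. ?H (D j)) < \<infinity>" .
  have tail: "(\<lambda>k. \<Sum>j. ?H (D (j + k))) \<longlonglongrightarrow> 0"
  proof -
    have f: "?H (D j) = ennreal (enn2real (?H (D j)))" for j
      using fin by (metis ennreal_enn2real ennreal_suminf_lessD infinity_ennreal_def)
    have nn: "0 \<le> enn2real (?H (D j))" for j by simp
    have s: "summable (\<lambda>j. enn2real (?H (D j)))"
      using fin f by (intro summable_suminf_not_top) (auto simp: less_top)
    have "(\<lambda>k. ennreal (\<Sum>j. enn2real (?H (D (j + k))))) \<longlonglongrightarrow> ennreal 0"
      by (intro tendsto_ennrealI suminf_exist_split2 s)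
    moreover have "ennreal (\<Sum>j. enn2real (?H (D (j + k)))) = (\<Sum>j. ?H (D (j + k)))" for k
    proof -
      have "summable (\<lambda>j. enn2real (?H (D (j + k))))" using s by (rule summable_ignore_initial_segment)
      then have "(\<Sum>j. ennreal (enn2real (?H (D (j + k))))) = ennreal (\<Sum>j. enn2real (?H (D (j + k))))"
        by (intro suminf_ennreal2) auto
      then show ?thesis using f by simp
    qed
    ultimately show ?thesis by simp
  qed
  have main: "?H {x\<in>T. x i \<le> c} + ?H {x\<in>T. c < x i} \<le> ?H T + (\<Sum>j. ?H (D (j + k)))" for k
  proof -
    have eq: "{x\<in>T. c < x i} = {x\<in>T. q k < x i} \<union> (\<Union>j. D (j + k))"
    proof safe
      fix x assume x: "x \<in> T" "c < x i" "x \<notin> (\<Union>j. D (j + k))"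
      show "q k < x i"
      proof (rule ccontr)
        assume "\<not> q k < x i"
        have "x i \<le> q (j + k)" for j
        proof (induction j)
          case (Suc j)
          then show ?case using x by (force simp: D_def)
        qed (use \<open>\<not> q k < x i\<close> in simp)
        moreover have "(\<lambda>j. q (j + k)) \<longlonglongrightarrow> c + 0"
          unfolding q_def using LIMSEQ_ignore_initial_segment[OF LIMSEQ_inverse_real_of_nat, of k]
          by (intro tendsto_add tendsto_const) (simp add: inverse_eq_divide)
        ultimately have "x i \<le> c" by (intro LIMSEQ_le_const[of _ c "x i"]) auto
        with x show False by simp
      qed
    next
      fix x assume "q k < x i" moreover have "c < q k" by (simp add: q_def)
      ultimately show "c < x i" by linarith
    next
      fix x j assume "x \<in> D (j + k)"
      moreover have "c < q (Suc (j + k))" by (simp add: q_def add_pos_pos)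
      ultimately show "c < x i" "x \<in> T" by (auto simp: D_def)
    qed
    have "?H {x\<in>T. x i \<le> c} + ?H {x\<in>T. c < x i} \<le> ?H {x\<in>T. x i \<le> c} + (?H {x\<in>T. q k < x i} + (\<Sum>j. ?H (D (j + k))))"
      unfolding eq by (intro add_left_mono order_trans[OF hausdorff_measure_Un_le] hausdorff_measure_subadditive)
    also have "\<dots> = (?H {x\<in>T. x i \<le> c} + ?H {x\<in>T. q k < x i}) + (\<Sum>j. ?H (D (j + k)))"
      by (simp add: add.assoc)
    also have "?H {x\<in>T. x i \<le> c} + ?H {x\<in>T. q k < x i} \<le> ?H ({x\<in>T. x i \<le> c} \<union> {x\<in>T. q k < x i})"
      by (rule sep[of c "q k"]) (auto simp: q_def)
    also have "\<dots> \<le> ?H T" by (intro hausdorff_measure_mono) auto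
    finally show ?thesis by (simp add: add_right_mono)
  qed
  have "?H {x\<in>T. x i \<le> c} + ?H {x\<in>T. c < x i} \<le> ?H T + 0"
    using main by (intro LIMSEQ_le_const[OF tendsto_add[OF tendsto_const tail]]) auto
  then show ?thesis by simp
qed simp

text \<open>Caratheodory's construction gives a measure on the sets that split every test set
  additively. The half-space lemma puts all coordinate half spaces among them, and these generate
  the Borel sets.\<close>

theorem measure_space_hausdorff:
  "measure_space (Rn n) (sets (lborel_Rn n)) (hausdorff_measure n d)"
proof -
  interpret P: sigma_algebra "Rn n" "Pow (Rn n)" by (rule sigma_algebra_Pow)
  let ?H = "hausdorff_measure n d"
  let ?L = "lambda_system (Rn n) (Pow (Rn n)) ?H"
  have "outer_measure_space (Pow (Rn n)) ?H"
    unfolding outer_measure_space_def positive_def increasing_def countably_subadditive_def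
    using hausdorff_measure_mono hausdorff_measure_subadditive by (auto simp: hausdorff_measure_empty)
  then have ms: "measure_space (Rn n) ?L ?H" by (rule P.caratheodory_lemma)
  then have sa: "sigma_algebra (Rn n) ?L" by (simp add: measure_space_def)
  have half: "{x \<in> Rn n. x i \<le> c} \<in> ?L" if "i \<in> {1..n}" for i c
    unfolding lambda_system_def
  proof (safe)
    fix T assume "T \<subseteq> Rn n"
    then have 1: "{x \<in> Rn n. x i \<le> c} \<inter> T = {x\<in>T. x i \<le> c}"
      and 2: "(Rn n - {x \<in> Rn n. x i \<le> c}) \<inter> T = {x\<in>T. c < x i}" by auto
    have "?H T \<le> ?H {x\<in>T. x i \<le> c} + ?H {x\<in>T. c < x i}"
      by (rule order_trans[OF hausdorff_measure_mono hausdorff_measure_Un_le]) auto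
    with hausdorff_measure_halfspace[OF that, of d T c]
    show "?H ({x \<in> Rn n. x i \<le> c} \<inter> T) + ?H ((Rn n - {x \<in> Rn n. x i \<le> c}) \<inter> T) = ?H T"
      unfolding 1 2 by (intro antisym)
  qed
  let ?N = "measure_of (Rn n) ?L (\<lambda>_. 0)"
  have N: "sets ?N = ?L" "space ?N = Rn n" using sa
    by (auto simp: sigma_algebra.sets_measure_of_eq sigma_algebra.space_measure_of_eq)
  \<comment> \<open>Measurability of the identity from the Caratheodory sets into the product Borel
    space amounts to the inclusion of sigma-algebras, and it can be checked one coordinate at a
    time.\<close>
  have "(\<lambda>x. x) \<in> measurable ?N (Pi\<^sub>M {1..n} (\<lambda>_. borel))"
  proof (rule measurable_PiM_single')
    fix i assume "i \<in> {1..n}"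
    then show "(\<lambda>x. x i) \<in> borel_measurable ?N"
      unfolding borel_measurable_iff_le using half by (simp add: N)
  qed (unfold N, simp add: space_lborel_Rn)
  then have "sets (Pi\<^sub>M {1..n} (\<lambda>_. borel)) \<subseteq> ?L"
  proof (intro subsetI)
    fix A assume "A \<in> sets (Pi\<^sub>M {1..n} (\<lambda>_. borel :: real measure))"
    from measurable_sets[OF \<open>(\<lambda>x. x) \<in> _\<close> this] sets.sets_into_space[OF this]
    show "A \<in> ?L" unfolding N by (simp add: space_PiM space_lborel_Rn Int_absorb2)
  qed
  also have "sets (Pi\<^sub>M {1..n} (\<lambda>_. borel :: real measure)) = sets (lborel_Rn n)"
    unfolding lborel_Rn_def by (intro sets_PiM_cong) auto
  finally show ?thesis by (intro measure_down[OF ms] sets.sigma_algebra_axioms)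
qed

section \<open>Lebesgue measure and reflections\<close>

interpretation lborel_product: product_sigma_finite "\<lambda>_::nat. lborel :: real measure"
  by standard

lemma sigma_finite_lborel_Rn: "sigma_finite_measure (lborel_Rn n)"
  unfolding lborel_Rn_def by (rule lborel_product.sigma_finite) simp

lemma sets_lborel_Rn: "sets (lborel_Rn n) = sets (Pi\<^sub>M {1..n} (\<lambda>_. borel))"
  unfolding lborel_Rn_def by (intro sets_PiM_cong) auto

lemma measurable_lborel_Rn_iff: "measurable (lborel_Rn n) N = measurable (Pi\<^sub>M {1..n} (\<lambda>_. borel)) N"
  by (rule measurable_cong_sets) (auto simp: sets_lborel_Rn)

lemma coord_measurable [measurable (raw)]:
  "i \<in> {1..n} \<Longrightarrow> (\<lambda>x. x i) \<in> borel_measurable (lborel_Rn n)"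
  unfolding measurable_lborel_Rn_iff by (rule measurable_component_singleton)

lemma measurable_into_lborel_Rn:
  assumes "\<And>i. i \<in> {1..n} \<Longrightarrow> (\<lambda>x. f x i) \<in> borel_measurable M"
    and "\<And>x. x \<in> space M \<Longrightarrow> f x \<in> Rn n"
  shows "f \<in> measurable M (lborel_Rn n)"
proof -
  have "f \<in> measurable M (Pi\<^sub>M {1..n} (\<lambda>_. borel))"
    using assms by (intro measurable_PiM_single') (auto simp: space_lborel_Rn)
  then show ?thesis by (subst measurable_cong_sets[OF refl sets_lborel_Rn])
qed

lemma restrict_in_Rn [simp]: "restrict f {1..n} \<in> Rn n"
  by (simp add: space_lborel_Rn)

lemma Rn_eqI:
  assumes "x \<in> Rn n" "y \<in> Rn n" "\<And>i. i \<in> {1..n} \<Longrightarrow> x i = y i"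
  shows "x = y"
  using assms unfolding space_lborel_Rn by (intro PiE_ext)

lemma measurable_restrict_Rn:
  assumes "\<And>i. i \<in> {1..n} \<Longrightarrow> (\<lambda>x. f x i) \<in> borel_measurable M"
  shows "(\<lambda>x. \<lambda>i\<in>{1..n}. f x i) \<in> measurable M (lborel_Rn n)"
proof (rule measurable_into_lborel_Rn)
  fix i assume "i \<in> {1..n}"
  then show "(\<lambda>x. (\<lambda>i\<in>{1..n}. f x i) i) \<in> borel_measurable M" using assms[of i] by simp
qed (rule restrict_in_Rn)

definition scale_Rn :: "nat \<Rightarrow> real \<Rightarrow> (nat \<Rightarrow> real) \<Rightarrow> nat \<Rightarrow> real" where
  "scale_Rn n r x = (\<lambda>i\<in>{1..n}. r * x i)"

lemma scale_Rn_in [simp]: "scale_Rn n r x \<in> Rn n"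
  by (simp add: scale_Rn_def del: One_nat_def)

lemma scale_Rn_apply [simp]: "i \<in> {1..n} \<Longrightarrow> scale_Rn n r x i = r * x i"
  by (simp add: scale_Rn_def)

lemma scale_Rn_scale_Rn: "scale_Rn n r (scale_Rn n s x) = scale_Rn n (r * s) x"
  by (auto simp: scale_Rn_def)

lemma scale_Rn_one: "x \<in> Rn n \<Longrightarrow> scale_Rn n 1 x = x"
  by (rule Rn_eqI[of _ n]) auto

lemma measurable_scale_Rn:
  assumes "f \<in> borel_measurable M" "g \<in> measurable M (lborel_Rn n)"
  shows "(\<lambda>x. scale_Rn n (f x) (g x)) \<in> measurable M (lborel_Rn n)"
  unfolding scale_Rn_def using assms
  by (intro measurable_restrict_Rn borel_measurable_times measurable_compose[OF assms(2) coord_measurable])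

text \<open>A product measure is determined by its values on boxes, where the change of variables
  splits into one-dimensional ones. Dilations, translations and point reflections are all
  instances.\<close>

lemma nn_integral_affine_Rn:
  assumes f: "f \<in> borel_measurable (lborel_Rn n)" and c: "c \<noteq> 0"
  shows "(\<integral>\<^sup>+x. f x \<partial>lborel_Rn n) = ennreal (\<bar>c\<bar> ^ n) * (\<integral>\<^sup>+x. f (\<lambda>i\<in>{1..n}. v i + c * x i) \<partial>lborel_Rn n)"
proof -
  let ?V = "lborel_Rn n" and ?T = "\<lambda>x. \<lambda>i\<in>{1..n}. v i + c * x i"
  have T: "?T \<in> measurable ?V ?V" by (intro measurable_restrict_Rn) measurable
  have eq: "density (distr ?V ?V ?T) (\<lambda>_. ennreal (\<bar>c\<bar> ^ n)) = Pi\<^sub>M {1..n} (\<lambda>_. lborel)"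
  proof (rule lborel_product.PiM_eqI)
    fix A :: "nat \<Rightarrow> real set" assume A: "\<And>i. i \<in> {1..n} \<Longrightarrow> A i \<in> sets lborel"
    have box: "Pi\<^sub>E {1..n} A \<in> sets ?V" using A unfolding lborel_Rn_def by (intro sets_PiM_I_finite) auto
    have "?T -` Pi\<^sub>E {1..n} A \<inter> space ?V = Pi\<^sub>E {1..n} (\<lambda>i. (\<lambda>t. v i + c * t) -` A i)"
      unfolding space_lborel_Rn by (auto simp: PiE_iff extensional_def)
    then have "emeasure (density (distr ?V ?V ?T) (\<lambda>_. ennreal (\<bar>c\<bar> ^ n))) (Pi\<^sub>E {1..n} A)
       = ennreal (\<bar>c\<bar> ^ n) * emeasure ?V (Pi\<^sub>E {1..n} (\<lambda>i. (\<lambda>t. v i + c * t) -` A i))"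
      using T box by (simp add: emeasure_density_const emeasure_distr)
    also have "emeasure ?V (Pi\<^sub>E {1..n} (\<lambda>i. (\<lambda>t. v i + c * t) -` A i)) = (\<Prod>i\<in>{1..n}. emeasure lborel ((\<lambda>t. v i + c * t) -` A i))"
    proof -
      have "(\<lambda>t. v i + c * t) -` A i \<in> sets lborel" if "i \<in> {1..n}" for i
        using measurable_sets[of "\<lambda>t. v i + c * t" borel borel "A i"] A[OF that] by simp
      then show ?thesis unfolding lborel_Rn_def by (intro lborel_product.emeasure_PiM) auto
    qed
    also have "ennreal (\<bar>c\<bar> ^ n) * \<dots> = (\<Prod>i\<in>{1..n}. ennreal \<bar>c\<bar> * emeasure lborel ((\<lambda>t. v i + c * t) -` A i))"
      by (simp add: prod.distrib ennreal_power)
    also have "\<dots> = (\<Prod>i\<in>{1..n}. emeasure lborel (A i))"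
    proof (rule prod.cong)
      fix i assume "i \<in> {1..n}"
      then have "A i \<in> sets borel" using A by auto
      then show "ennreal \<bar>c\<bar> * emeasure lborel ((\<lambda>t. v i + c * t) -` A i) = emeasure lborel (A i)"
        by (subst (2) lborel_real_affine[OF c, of "v i"]) (simp add: emeasure_density_const emeasure_distr)
    qed simp
    finally show "emeasure (density (distr ?V ?V ?T) (\<lambda>_. ennreal (\<bar>c\<bar> ^ n))) (Pi\<^sub>E {1..n} A) = (\<Prod>i\<in>{1..n}. emeasure lborel (A i))" .
  qed (auto simp: lborel_Rn_def)
  have "(\<integral>\<^sup>+x. f x \<partial>?V) = (\<integral>\<^sup>+x. f x \<partial>density (distr ?V ?V ?T) (\<lambda>_. ennreal (\<bar>c\<bar> ^ n)))"
    unfolding eq by (simp add: lborel_Rn_def)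
  also have "\<dots> = ennreal (\<bar>c\<bar> ^ n) * (\<integral>\<^sup>+x. f (?T x) \<partial>?V)"
    using f T by (simp add: nn_integral_density nn_integral_cmult nn_integral_distr)
  finally show ?thesis .
qed

lemma nn_integral_scale_Rn:
  assumes f: "f \<in> borel_measurable (lborel_Rn n)" and c: "c > 0"
  shows "(\<integral>\<^sup>+x. f x \<partial>lborel_Rn n) = ennreal (c ^ n) * (\<integral>\<^sup>+x. f (scale_Rn n c x) \<partial>lborel_Rn n)"
  using nn_integral_affine_Rn[OF f, of c "\<lambda>_. 0"] c by (simp add: scale_Rn_def)

lemma nn_integral_translate_Rn:
  assumes f: "f \<in> borel_measurable (lborel_Rn n)"
  shows "(\<integral>\<^sup>+x. f (\<lambda>i\<in>{1..n}. v i + x i) \<partial>lborel_Rn n) = (\<integral>\<^sup>+x. f x \<partial>lborel_Rn n)"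
  using nn_integral_affine_Rn[OF f, of 1 v] by simp

lemma fun_upd_in_Rn: "u \<in> Rn d \<Longrightarrow> u(Suc d := t) \<in> Rn (Suc d)"
  by (auto simp: space_lborel_Rn PiE_iff extensional_def)

lemma measurable_fun_upd_Rn:
  assumes "f \<in> measurable M (lborel_Rn d)" "g \<in> borel_measurable M"
  shows "(\<lambda>x. (f x)(Suc d := g x)) \<in> measurable M (lborel_Rn (Suc d))"
proof (rule measurable_into_lborel_Rn)
  fix i assume i: "i \<in> {1..Suc d}"
  show "(\<lambda>x. ((f x)(Suc d := g x)) i) \<in> borel_measurable M"
  proof (cases "i = Suc d")
    case False
    then have "i \<in> {1..d}" using i by auto
    then show ?thesis using False measurable_compose[OF assms(1) coord_measurable] by simp
  qed (use assms in simp)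
next
  fix x assume "x \<in> space M"
  then show "(f x)(Suc d := g x) \<in> Rn (Suc d)" using measurable_space[OF assms(1)] by (intro fun_upd_in_Rn) auto
qed

lemma atLeast1AtMost_Suc: "{1..Suc d} = insert (Suc d) {1..d}"
  by auto

lemma nn_integral_Rn_Suc:
  assumes f: "f \<in> borel_measurable (lborel_Rn (Suc d))"
  shows "(\<integral>\<^sup>+x. f x \<partial>lborel_Rn (Suc d)) = (\<integral>\<^sup>+u. (\<integral>\<^sup>+t. f (u(Suc d := t)) \<partial>lborel) \<partial>lborel_Rn d)"
  using f unfolding lborel_Rn_def atLeast1AtMost_Suc
  by (intro lborel_product.product_nn_integral_insert) auto

lemma nn_integral_Rn_Suc_rev:
  assumes f: "f \<in> borel_measurable (lborel_Rn (Suc d))"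
  shows "(\<integral>\<^sup>+x. f x \<partial>lborel_Rn (Suc d)) = (\<integral>\<^sup>+t. (\<integral>\<^sup>+u. f (u(Suc d := t)) \<partial>lborel_Rn d) \<partial>lborel)"
  using f unfolding lborel_Rn_def atLeast1AtMost_Suc
  by (intro lborel_product.product_nn_integral_insert_rev) auto

lemma nn_integral_Rn_lborel_swap:
  fixes f :: "(nat \<Rightarrow> real) \<Rightarrow> real \<Rightarrow> ennreal"
  assumes f: "(\<lambda>(u, t). f u t) \<in> borel_measurable (lborel_Rn d \<Otimes>\<^sub>M lborel)"
  shows "(\<integral>\<^sup>+u. (\<integral>\<^sup>+t. f u t \<partial>lborel) \<partial>lborel_Rn d) = (\<integral>\<^sup>+t. (\<integral>\<^sup>+u. f u t \<partial>lborel_Rn d) \<partial>lborel)"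
proof -
  interpret pair_sigma_finite "lborel_Rn d" "lborel :: real measure"
    by (intro pair_sigma_finite.intro sigma_finite_lborel_Rn) standard
  show ?thesis using Fubini'[OF f] by simp
qed

section \<open>Reflections preserve Lebesgue measure and Euclidean distance\<close>

definition householder :: "nat \<Rightarrow> (nat \<Rightarrow> real) \<Rightarrow> (nat \<Rightarrow> real) \<Rightarrow> nat \<Rightarrow> real" where
  "householder n w x = (\<lambda>i\<in>{1..n}. x i - 2 * w i * (\<Sum>j=1..n. w j * x j))"

lemma measurable_householder: "householder n w \<in> measurable (lborel_Rn n) (lborel_Rn n)"
  unfolding householder_def by (intro measurable_restrict_Rn) measurable

text \<open>
  In the coordinates \<open>(u, y)\<close>, where \<open>y\<close> is the inner product of \<open>w\<close> and \<open>x\<close> and replaces the last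
  coordinate, the reflection is a shear in \<open>u\<close> followed by \<open>y \<mapsto> - y\<close>.
\<close>

lemma nn_integral_householder:
  assumes f: "f \<in> borel_measurable (lborel_Rn (Suc d))"
    and w: "(\<Sum>i=1..Suc d. (w i)\<^sup>2) = 1" "w (Suc d) \<noteq> 0"
  shows "(\<integral>\<^sup>+x. f (householder (Suc d) w x) \<partial>lborel_Rn (Suc d)) = (\<integral>\<^sup>+x. f x \<partial>lborel_Rn (Suc d))"
proof -
  define c where "c = w (Suc d)"
  define S where "S u = (\<Sum>j=1..d. w j * u j)" for u :: "nat \<Rightarrow> real"
  define G where "G u y = f (u(Suc d := (y - S u) / c))" for u y
  have c: "c \<noteq> 0" using w by (simp add: c_def)
  have S_meas: "S \<in> borel_measurable (lborel_Rn d)" unfolding S_def by measurable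
  have G_meas: "(\<lambda>(u, y). G u y) \<in> borel_measurable (lborel_Rn d \<Otimes>\<^sub>M lborel)"
  proof -
    note [measurable] = S_meas
    have "(\<lambda>(u, y). u(Suc d := (y - S u) / c)) \<in> measurable (lborel_Rn d \<Otimes>\<^sub>M lborel) (lborel_Rn (Suc d))"
      unfolding case_prod_beta by (rule measurable_fun_upd_Rn) measurable
    from measurable_compose[OF this f] show ?thesis by (simp add: G_def case_prod_beta)
  qed
  have subst: "(\<integral>\<^sup>+t. F t \<partial>lborel) = ennreal (1 / \<bar>c\<bar>) * (\<integral>\<^sup>+y. F ((y - S u) / c) \<partial>lborel)"
    if "F \<in> borel_measurable borel" for F u
    using nn_integral_real_affine[OF that, of "1 / c" "- S u / c"] c
    by (simp add: diff_divide_distrib)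
  have G2_meas: "(\<lambda>(u, y). G (\<lambda>i\<in>{1..d}. - 2 * w i * y + u i) (- y)) \<in> borel_measurable (lborel_Rn d \<Otimes>\<^sub>M lborel)"
  proof -
    have "(\<lambda>(u, y). (\<lambda>i\<in>{1..d}. - 2 * w i * y + u i, - y)) \<in> measurable (lborel_Rn d \<Otimes>\<^sub>M lborel) (lborel_Rn d \<Otimes>\<^sub>M lborel)"
      unfolding case_prod_beta
      by (intro measurable_Pair measurable_restrict_Rn borel_measurable_add borel_measurable_times
           measurable_compose[OF measurable_fst coord_measurable]) measurable
    from measurable_compose[OF this G_meas] show ?thesis by (simp add: case_prod_beta)
  qed
  \<comment> \<open>The computation behind the shear: because \<open>w\<close> is a unit vector, the
    squares of its first \<open>d\<close> entries sum to 1 - c^2, and this is what sends the inner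
    product \<open>y\<close> to \<open>- y\<close>.\<close>
  have hh: "householder (Suc d) w (u(Suc d := (y - S u) / c))
     = (\<lambda>i\<in>{1..d}. - 2 * w i * y + u i)(Suc d := (- y - S (\<lambda>i\<in>{1..d}. - 2 * w i * y + u i)) / c)" 
     (is "?l = ?r") if u: "u \<in> Rn d" for u y
  proof (rule Rn_eqI[of _ "Suc d"])
    show "?l \<in> Rn (Suc d)" unfolding householder_def by (rule restrict_in_Rn)
    show "?r \<in> Rn (Suc d)" by (intro fun_upd_in_Rn restrict_in_Rn)
    have s: "(\<Sum>j=1..Suc d. w j * (u(Suc d := (y - S u) / c)) j) = y"
    proof -
      have "(\<Sum>j=1..Suc d. w j * (u(Suc d := (y - S u) / c)) j) = S u + c * ((y - S u) / c)"
        by (simp add: S_def c_def)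
      then show ?thesis using c by simp
    qed
    have w2: "(\<Sum>i=1..d. (w i)\<^sup>2) = 1 - c\<^sup>2" using w(1) by (simp add: c_def)
    have "S (\<lambda>i\<in>{1..d}. - 2 * w i * y + u i) = (\<Sum>j=1..d. w j * (- 2 * w j * y + u j))"
      unfolding S_def by (intro sum.cong) auto
    also have "\<dots> = - 2 * y * (\<Sum>i=1..d. (w i)\<^sup>2) + S u"
      unfolding S_def by (simp add: sum_distrib_left sum.distrib algebra_simps power2_eq_square sum_negf sum_subtractf)
    finally have S2: "S (\<lambda>i\<in>{1..d}. - 2 * w i * y + u i) = - 2 * y * (1 - c\<^sup>2) + S u" unfolding w2 .
    fix i assume i: "i \<in> {1..Suc d}"
    show "?l i = ?r i"
    proof (cases "i = Suc d")
      case True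
      have "?l i = (y - S u) / c - 2 * c * y" using s True by (simp add: householder_def c_def)
      also have "\<dots> = ?r i" unfolding S2 using True c by (simp add: field_simps power2_eq_square)
      finally show ?thesis .
    next
      case False
      then show ?thesis using s i by (simp add: householder_def)
    qed
  qed
  have hm: "(\<lambda>t. u(Suc d := t)) \<in> measurable borel (lborel_Rn (Suc d))" if "u \<in> Rn d" for u
    using that by (intro measurable_fun_upd_Rn) auto
  have fm: "(\<lambda>x. f (householder (Suc d) w x)) \<in> borel_measurable (lborel_Rn (Suc d))"
    by (rule measurable_compose[OF measurable_householder f])
  have "(\<integral>\<^sup>+x. f (householder (Suc d) w x) \<partial>lborel_Rn (Suc d))
     = (\<integral>\<^sup>+u. (\<integral>\<^sup>+t. f (householder (Suc d) w (u(Suc d := t))) \<partial>lborel) \<partial>lborel_Rn d)"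
    by (rule nn_integral_Rn_Suc[OF fm])
  also have "\<dots> = (\<integral>\<^sup>+u. ennreal (1 / \<bar>c\<bar>) * (\<integral>\<^sup>+y. G (\<lambda>i\<in>{1..d}. - 2 * w i * y + u i) (- y) \<partial>lborel) \<partial>lborel_Rn d)"
  proof (rule nn_integral_cong)
    fix u assume u: "u \<in> Rn d"
    show "(\<integral>\<^sup>+t. f (householder (Suc d) w (u(Suc d := t))) \<partial>lborel)
      = ennreal (1 / \<bar>c\<bar>) * (\<integral>\<^sup>+y. G (\<lambda>i\<in>{1..d}. - 2 * w i * y + u i) (- y) \<partial>lborel)"
      using subst[OF measurable_compose[OF hm[OF u] fm], of u] by (simp add: hh[OF u] G_def)
  qed
  also have "\<dots> = ennreal (1 / \<bar>c\<bar>) * (\<integral>\<^sup>+u. (\<integral>\<^sup>+y. G (\<lambda>i\<in>{1..d}. - 2 * w i * y + u i) (- y) \<partial>lborel) \<partial>lborel_Rn d)"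
    by (intro nn_integral_cmult lborel.borel_measurable_nn_integral) (use G2_meas in \<open>simp add: case_prod_beta\<close>)
  also have "(\<integral>\<^sup>+u. (\<integral>\<^sup>+y. G (\<lambda>i\<in>{1..d}. - 2 * w i * y + u i) (- y) \<partial>lborel) \<partial>lborel_Rn d)
      = (\<integral>\<^sup>+y. (\<integral>\<^sup>+u. G (\<lambda>i\<in>{1..d}. - 2 * w i * y + u i) (- y) \<partial>lborel_Rn d) \<partial>lborel)"
    by (rule nn_integral_Rn_lborel_swap[OF G2_meas])
  \<comment> \<open>For fixed \<open>y\<close> the shear is a translation of
    \<open>u\<close>.\<close>
  also have "\<dots> = (\<integral>\<^sup>+y. (\<integral>\<^sup>+u. G u (- y) \<partial>lborel_Rn d) \<partial>lborel)"
  proof (rule nn_integral_cong)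
    fix y :: real
    have "(\<lambda>u. G u (- y)) \<in> borel_measurable (lborel_Rn d)"
      using measurable_compose[OF measurable_Pair[OF measurable_ident measurable_const] G_meas, of "- y"] by simp
    from nn_integral_translate_Rn[OF this, of "\<lambda>i. - 2 * w i * y"]
    show "(\<integral>\<^sup>+u. G (\<lambda>i\<in>{1..d}. - 2 * w i * y + u i) (- y) \<partial>lborel_Rn d) = (\<integral>\<^sup>+u. G u (- y) \<partial>lborel_Rn d)" .
  qed
  also have "\<dots> = (\<integral>\<^sup>+y. (\<integral>\<^sup>+u. G u y \<partial>lborel_Rn d) \<partial>lborel)"
  proof -
    interpret sigma_finite_measure "lborel_Rn d" by (rule sigma_finite_lborel_Rn)
    have "(\<lambda>y. \<integral>\<^sup>+u. G u y \<partial>lborel_Rn d) \<in> borel_measurable borel"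
      using borel_measurable_nn_integral[of "\<lambda>y u. G u y" borel] measurable_compose[OF measurable_pair_swap' G_meas]
      by (simp add: case_prod_beta comp_def)
    from nn_integral_real_affine[OF this, of "-1" 0] show ?thesis by simp
  qed
  also have "\<dots> = (\<integral>\<^sup>+u. (\<integral>\<^sup>+y. G u y \<partial>lborel) \<partial>lborel_Rn d)"
    by (rule nn_integral_Rn_lborel_swap[OF G_meas, symmetric])
  also have "ennreal (1 / \<bar>c\<bar>) * \<dots> = (\<integral>\<^sup>+u. ennreal (1 / \<bar>c\<bar>) * (\<integral>\<^sup>+y. G u y \<partial>lborel) \<partial>lborel_Rn d)"
    by (intro nn_integral_cmult[symmetric] lborel.borel_measurable_nn_integral) (use G_meas in simp)
  also have "\<dots> = (\<integral>\<^sup>+u. (\<integral>\<^sup>+t. f (u(Suc d := t)) \<partial>lborel) \<partial>lborel_Rn d)"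
  proof (rule nn_integral_cong)
    fix u assume u: "u \<in> Rn d"
    show "ennreal (1 / \<bar>c\<bar>) * (\<integral>\<^sup>+y. G u y \<partial>lborel) = (\<integral>\<^sup>+t. f (u(Suc d := t)) \<partial>lborel)"
      using subst[OF measurable_compose[OF hm[OF u] f], of u] by (simp add: G_def)
  qed
  also have "\<dots> = (\<integral>\<^sup>+x. f x \<partial>lborel_Rn (Suc d))"
    by (rule nn_integral_Rn_Suc[OF f, symmetric])
  finally show ?thesis .
qed

lemma householder_in_Rn [simp]: "householder n w x \<in> Rn n"
  unfolding householder_def by (rule restrict_in_Rn)

lemma householder_apply:
  "i \<in> {1..n} \<Longrightarrow> householder n w x i = x i - 2 * w i * (\<Sum>j=1..n. w j * x j)"
  by (simp add: householder_def)

lemma householder_involution: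
  assumes w: "(\<Sum>i=1..n. (w i)\<^sup>2) = 1" and x: "x \<in> Rn n"
  shows "householder n w (householder n w x) = x"
proof (rule Rn_eqI[OF householder_in_Rn x])
  fix i assume i: "i \<in> {1..n}"
  define s where "s = (\<Sum>j=1..n. w j * x j)"
  have "(\<Sum>j=1..n. w j * householder n w x j) = (\<Sum>j=1..n. w j * (x j - 2 * w j * s))"
    by (intro sum.cong) (auto simp: householder_apply s_def)
  also have "\<dots> = s - 2 * s * (\<Sum>i=1..n. (w i)\<^sup>2)"
  proof -
    have "(\<Sum>j=1..n. w j * (x j - 2 * w j * s)) = (\<Sum>j=1..n. w j * x j - 2 * s * (w j)\<^sup>2)"
      by (intro sum.cong refl) (simp add: power2_eq_square algebra_simps)
    then show ?thesis by (simp only: sum_subtractf sum_distrib_left[symmetric] s_def)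
  qed
  finally have "(\<Sum>j=1..n. w j * householder n w x j) = - s" using w by simp
  then show "householder n w (householder n w x) i = x i"
    using i by (simp add: householder_apply s_def)
qed

lemma edist_householder:
  assumes w: "(\<Sum>i=1..n. (w i)\<^sup>2) = 1"
  shows "edist n (householder n w x) (householder n w y) = edist n x y"
proof -
  define z where "z i = x i - y i" for i
  define s where "s = (\<Sum>j=1..n. w j * z j)"
  have "(\<Sum>i=1..n. (householder n w x i - householder n w y i)\<^sup>2) = (\<Sum>i=1..n. (z i - 2 * w i * s)\<^sup>2)"
  proof (intro sum.cong refl)
    fix i assume i: "i \<in> {1..n}"
    have "s = (\<Sum>j=1..n. w j * x j) - (\<Sum>j=1..n. w j * y j)"
      by (simp add: s_def z_def sum_subtractf right_diff_distrib)
    then have "householder n w x i - householder n w y i = z i - 2 * w i * s"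
      using i by (simp only: householder_apply z_def) (simp add: algebra_simps)
    then show "(householder n w x i - householder n w y i)\<^sup>2 = (z i - 2 * w i * s)\<^sup>2" by simp
  qed
  also have "\<dots> = (\<Sum>i=1..n. (z i)\<^sup>2) - 4 * s * s + 4 * s\<^sup>2 * (\<Sum>i=1..n. (w i)\<^sup>2)"
  proof -
    have "(\<Sum>i=1..n. (z i - 2 * w i * s)\<^sup>2) = (\<Sum>i=1..n. (z i)\<^sup>2 - 4 * s * (w i * z i) + 4 * s\<^sup>2 * (w i)\<^sup>2)"
      by (intro sum.cong refl) (simp add: power2_eq_square algebra_simps)
    then show ?thesis unfolding sum.distrib sum_subtractf sum_distrib_left[symmetric] s_def[symmetric] .
  qed
  also have "\<dots> = (\<Sum>i=1..n. (z i)\<^sup>2)" using w by (simp add: power2_eq_square)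
  finally show ?thesis by (simp add: edist_def L2_set_def z_def)
qed

lemma householder_scale_Rn: "householder n w (scale_Rn n r x) = scale_Rn n r (householder n w x)"
proof (rule Rn_eqI[of _ n])
  fix i assume i: "i \<in> {1..n}"
  have "(\<Sum>j=1..n. w j * scale_Rn n r x j) = (\<Sum>j=1..n. r * (w j * x j))"
    by (intro sum.cong) (auto simp: scale_Rn_apply simp del: One_nat_def)
  then show "householder n w (scale_Rn n r x) i = scale_Rn n r (householder n w x) i"
    using i by (simp add: householder_apply scale_Rn_apply sum_distrib_left[symmetric] algebra_simps del: One_nat_def)
qed simp_all

text \<open>Serves to make the hyperplanes with unit normal \<nu> horizontal. The reflection
  exchanging \<nu> and the last unit vector e does this; its direction is \<nu> - e, so the case
  \<nu> = e is left to the identity. A reflection is its own inverse, hence one map serves both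
  ways.\<close>

lemma ex_rotation:
  assumes \<nu>: "(\<Sum>i=1..Suc d. (\<nu> i)\<^sup>2) = 1"
  obtains R where "R \<in> measurable (lborel_Rn (Suc d)) (lborel_Rn (Suc d))"
    and "\<And>x. x \<in> Rn (Suc d) \<Longrightarrow> R (R x) = x"
    and "\<And>x y. edist (Suc d) (R x) (R y) = edist (Suc d) x y"
    and "\<And>r x. x \<in> Rn (Suc d) \<Longrightarrow> R (scale_Rn (Suc d) r x) = scale_Rn (Suc d) r (R x)"
    and "\<And>x. R x (Suc d) = (\<Sum>i=1..Suc d. \<nu> i * x i)"
    and "\<And>f. f \<in> borel_measurable (lborel_Rn (Suc d)) \<Longrightarrow>
           (\<integral>\<^sup>+x. f (R x) \<partial>lborel_Rn (Suc d)) = (\<integral>\<^sup>+x. f x \<partial>lborel_Rn (Suc d))"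
proof (cases "\<nu> (Suc d) = 1")
  case True
  have "(\<Sum>i=1..d. (\<nu> i)\<^sup>2) = 0" using \<nu> True by simp
  then have z: "\<nu> i = 0" if "i \<in> {1..d}" for i using that by (subst (asm) sum_nonneg_eq_0_iff) auto
  have "x (Suc d) = (\<Sum>i=1..Suc d. \<nu> i * x i)" for x
  proof -
    have "(\<Sum>i=1..d. \<nu> i * x i) = 0" using z by (intro sum.neutral) auto
    then show ?thesis using True by simp
  qed
  then show ?thesis by (intro that[of "\<lambda>x. x"]) auto
next
  case False
  have "\<bar>\<nu> (Suc d)\<bar> \<le> 1"
  proof -
    have "(\<nu> (Suc d))\<^sup>2 \<le> 1" using \<nu> sum_nonneg[of "{1..d}" "\<lambda>i. (\<nu> i)\<^sup>2"] by simp
    then show ?thesis by (simp add: abs_square_le_1)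
  qed
  then have lt: "\<nu> (Suc d) < 1" using False by simp
  \<comment> \<open>The Euclidean length of \<nu> - e, computed from |\<nu>| = |e| = 1.\<close>
  define c where "c = sqrt (2 - 2 * \<nu> (Suc d))"
  have c: "c > 0" "c\<^sup>2 = 2 - 2 * \<nu> (Suc d)" using lt by (auto simp: c_def)
  define w where "w i = (\<nu> i - (if i = Suc d then 1 else 0)) / c" for i
  have wn: "w (Suc d) = (\<nu> (Suc d) - 1) / c" by (simp add: w_def)
  have wi: "w i = \<nu> i / c" if "i \<in> {1..d}" for i using that by (simp add: w_def)
  have w1: "(\<Sum>i=1..Suc d. (w i)\<^sup>2) = 1"
  proof -
    have "(\<Sum>i=1..d. (w i)\<^sup>2) = (\<Sum>i=1..d. (\<nu> i)\<^sup>2) / c\<^sup>2"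
      unfolding sum_divide_distrib using wi by (intro sum.cong) (auto simp: power_divide)
    also have "(\<Sum>i=1..d. (\<nu> i)\<^sup>2) = 1 - (\<nu> (Suc d))\<^sup>2" using \<nu> by simp
    finally have "(\<Sum>i=1..Suc d. (w i)\<^sup>2) = (1 - (\<nu> (Suc d))\<^sup>2 + (\<nu> (Suc d) - 1)\<^sup>2) / c\<^sup>2"
      by (simp add: wn power_divide add_divide_distrib)
    also have "1 - (\<nu> (Suc d))\<^sup>2 + (\<nu> (Suc d) - 1)\<^sup>2 = c\<^sup>2"
      unfolding c(2) by (simp add: power2_eq_square algebra_simps)
    finally show ?thesis using c(1) by simp
  qed
  have wne: "w (Suc d) \<noteq> 0" using wn c lt by simp
  have "householder (Suc d) w x (Suc d) = (\<Sum>i=1..Suc d. \<nu> i * x i)" for x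
  proof -
    have "(\<Sum>i=1..d. w i * x i) = (\<Sum>i=1..d. \<nu> i * x i) / c"
      unfolding sum_divide_distrib using wi by (intro sum.cong) auto
    then have "(\<Sum>j=1..Suc d. w j * x j) = ((\<Sum>i=1..Suc d. \<nu> i * x i) - x (Suc d)) / c"
      by (simp add: wn diff_divide_distrib add_divide_distrib algebra_simps)
    then have "householder (Suc d) w x (Suc d)
        = x (Suc d) - 2 * (\<nu> (Suc d) - 1) * ((\<Sum>i=1..Suc d. \<nu> i * x i) - x (Suc d)) / c\<^sup>2"
      by (subst householder_apply) (auto simp: wn power2_eq_square)
    also have "2 * (\<nu> (Suc d) - 1) = - c\<^sup>2" by (simp add: c(2))
    finally show ?thesis using c(1) by simp
  qed
  then show ?thesis
    by (intro that[of "householder (Suc d) w"] measurable_householder householder_involution edist_householder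
      householder_scale_Rn nn_integral_householder w1 wne)
qed

section \<open>Hausdorff measure on hyperplanes\<close>

definition hausdorff :: "nat \<Rightarrow> nat \<Rightarrow> (nat \<Rightarrow> real) measure" where
  "hausdorff n d = measure_of (Rn n) (sets (lborel_Rn n)) (hausdorff_measure n d)"

lemma space_hausdorff [simp]: "space (hausdorff n d) = Rn n"
  and sets_hausdorff [simp, measurable_cong]: "sets (hausdorff n d) = sets (lborel_Rn n)"
  by (simp_all add: hausdorff_def sets.sigma_sets_eq space_measure_of_conv)

lemma emeasure_hausdorff: "A \<in> sets (lborel_Rn n) \<Longrightarrow> emeasure (hausdorff n d) A = hausdorff_measure n d A"
  using measure_space_hausdorff[of n d] unfolding measure_space_def hausdorff_def
  by (intro emeasure_measure_of[OF refl]) (auto dest: sets.sets_into_space)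

section \<open>Translation invariance, and proportionality to Lebesgue measure in full
  dimension\<close>

definition translate_Rn :: "nat \<Rightarrow> (nat \<Rightarrow> real) \<Rightarrow> (nat \<Rightarrow> real) \<Rightarrow> nat \<Rightarrow> real" where
  "translate_Rn n v x = (\<lambda>i\<in>{1..n}. v i + x i)"

lemma translate_Rn_in [simp]: "translate_Rn n v x \<in> Rn n"
  unfolding translate_Rn_def by (rule restrict_in_Rn)

lemma translate_Rn_apply: "i \<in> {1..n} \<Longrightarrow> translate_Rn n v x i = v i + x i"
  by (simp add: translate_Rn_def)

lemma edist_translate_Rn: "edist n (translate_Rn n v x) (translate_Rn n v y) = edist n x y"
  unfolding edist_def by (intro L2_set_cong) (auto simp: translate_Rn_def)

lemma measurable_translate_Rn:
  assumes "f \<in> measurable M (lborel_Rn n)" "g \<in> measurable M (lborel_Rn n)"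
  shows "(\<lambda>x. translate_Rn n (f x) (g x)) \<in> measurable M (lborel_Rn n)"
  unfolding translate_Rn_def
  by (intro measurable_restrict_Rn borel_measurable_add measurable_compose[OF assms(1) coord_measurable]
      measurable_compose[OF assms(2) coord_measurable])

lemma measurable_translate_Rn': "translate_Rn n v \<in> measurable (lborel_Rn n) (lborel_Rn n)"
  unfolding translate_Rn_def by (intro measurable_restrict_Rn) measurable

lemma hausdorff_translate: "distr (hausdorff n d) (lborel_Rn n) (translate_Rn n v) = hausdorff n d"
proof (rule measure_eqI)
  note m = measurable_translate_Rn'[of n v]
  fix A assume "A \<in> sets (distr (hausdorff n d) (lborel_Rn n) (translate_Rn n v))"
  then have A: "A \<in> sets (lborel_Rn n)" by simp
  let ?B = "translate_Rn n v -` A \<inter> Rn n"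
  have B: "?B \<in> sets (lborel_Rn n)" using m A by (rule measurable_sets)
  have "translate_Rn n v ` ?B = A"
  proof (intro equalityI subsetI)
    fix x assume x: "x \<in> A"
    then have xR: "x \<in> Rn n" using A sets.sets_into_space by blast
    have "translate_Rn n v (translate_Rn n (\<lambda>i. - v i) x) = x"
      by (rule Rn_eqI[OF _ xR]) (auto simp: translate_Rn_apply simp del: One_nat_def)
    then show "x \<in> translate_Rn n v ` ?B" using x
      by (intro image_eqI[of _ _ "translate_Rn n (\<lambda>i. - v i) x"]) auto
  qed auto
  moreover have "hausdorff_measure n d (translate_Rn n v ` ?B) = hausdorff_measure n d ?B"
    by (intro hausdorff_measure_isometric_image edist_translate_Rn) auto
  ultimately have "hausdorff_measure n d ?B = hausdorff_measure n d A" by simp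
  moreover have m': "translate_Rn n v \<in> measurable (hausdorff n d) (lborel_Rn n)"
    using m by (simp add: measurable_cong_sets[OF sets_hausdorff refl])
  ultimately show "emeasure (distr (hausdorff n d) (lborel_Rn n) (translate_Rn n v)) A = emeasure (hausdorff n d) A"
    using A B by (simp add: emeasure_distr[OF m' A] emeasure_hausdorff)
qed simp

definition unit_cube :: "nat \<Rightarrow> (nat \<Rightarrow> real) set" where
  "unit_cube n = Pi\<^sub>E {1..n} (\<lambda>_. {0..<1})"

lemma unit_cube_sets [measurable]: "unit_cube n \<in> sets (lborel_Rn n)"
  unfolding unit_cube_def lborel_Rn_def by (intro sets_PiM_I_finite) auto

lemma emeasure_unit_cube: "emeasure (lborel_Rn n) (unit_cube n) = 1"
  unfolding unit_cube_def lborel_Rn_def by (subst lborel_product.emeasure_PiM) auto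

text \<open>Cutting the cube into m^d cells of side 1/m, each of diameter at most d/m, gives the
  cover sum m^d (d/m)^d = d^d for every m. Bounding the diameter by the sum of the coordinate
  differences is crude, but only finiteness matters.\<close>

lemma hausdorff_measure_unit_cube_finite: "hausdorff_measure d d (unit_cube d) < \<infinity>"
proof -
  have "hausdorff_delta d d \<delta> (unit_cube d) \<le> ennreal (real d ^ d)" if \<delta>: "\<delta> > 0" for \<delta>
  proof -
    obtain m :: nat where m: "real d / \<delta> < real m" using reals_Archimedean2 by blast
    have m0: "m > 0" using m \<delta> by (metis divide_nonneg_pos leD not_gr_zero of_nat_0 of_nat_0_le_iff)
    have md: "real d / real m \<le> \<delta>" using m m0 \<delta> by (simp add: field_simps)
    define K where "K = Pi\<^sub>E {1..d} (\<lambda>_. {..<m})"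
    \<comment> \<open>Cells are half open and written after multiplication by \<open>m\<close>, so
      that the floor of \<open>m * x i\<close> names the cell of \<open>x\<close>.\<close>
    define Q :: "(nat \<Rightarrow> nat) \<Rightarrow> (nat \<Rightarrow> real) set"
      where "Q k = {x \<in> Rn d. \<forall>i\<in>{1..d}. real (k i) \<le> m * x i \<and> m * x i < real (k i) + 1}" for k
    have K: "finite K" "card K = m ^ d" by (auto simp: K_def card_PiE intro!: finite_PiE)
    obtain e where e: "bij_betw e {0..<card K} K" using ex_bij_betw_nat_finite[OF K(1)] by blast
    define U where "U j = (if j < card K then Q (e j) else {})" for j
    have diamQ: "diam_Rn d (Q k) \<le> ennreal (real d / real m)" for k
      unfolding diam_Rn_le_iff
    proof (intro ballI ennreal_leI)
      fix x y assume xy: "x \<in> Q k" "y \<in> Q k"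
      have "edist d x y \<le> (\<Sum>i=1..d. \<bar>x i - y i\<bar>)" unfolding edist_def by (rule L2_set_le_sum_abs)
      also have "\<dots> \<le> (\<Sum>i=1..d. 1 / real m)"
      proof (rule sum_mono)
        fix i assume "i \<in> {1..d}"
        then have "\<bar>real m * x i - real m * y i\<bar> \<le> 1" using xy by (force simp: Q_def abs_if)
        then have "real m * \<bar>x i - y i\<bar> \<le> 1" by (simp add: right_diff_distrib[symmetric] abs_mult)
        then show "\<bar>x i - y i\<bar> \<le> 1 / real m" using m0 by (simp add: field_simps)
      qed
      finally show "edist d x y \<le> real d / real m" by simp
    qed
    have "delta_cover d \<delta> (unit_cube d) U"
      unfolding delta_cover_def
    proof (intro conjI allI subsetI)
      fix x assume x: "x \<in> unit_cube d"
      define k where "k = (\<lambda>i\<in>{1..d}. nat \<lfloor>m * x i\<rfloor>)"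
      have xi: "0 \<le> x i" "x i < 1" if "i \<in> {1..d}" for i
        using x that by (auto simp: unit_cube_def PiE_iff)
      have "nat \<lfloor>m * x i\<rfloor> < m" if "i \<in> {1..d}" for i
      proof -
        have "m * x i < m" using xi[OF that] m0 by simp
        then show ?thesis using xi[OF that] by (simp add: nat_less_iff floor_less_iff)
      qed
      then have "k \<in> K" by (auto simp: K_def k_def)
      then obtain j where j: "j < card K" "e j = k"
        using bij_betw_imp_surj_on[OF e] by (metis atLeastLessThan_iff imageE)
      have "x \<in> Q k"
        unfolding Q_def
      proof (intro CollectI conjI ballI)
        show "x \<in> Rn d" using x by (auto simp: unit_cube_def space_lborel_Rn PiE_iff)
        fix i assume i: "i \<in> {1..d}"
        have "real (k i) = of_int \<lfloor>m * x i\<rfloor>" using i xi[OF i] by (simp add: k_def)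
        then show "real (k i) \<le> m * x i" "m * x i < real (k i) + 1" by linarith+
      qed
      then show "x \<in> (\<Union>k. U k)" using j by (auto simp: U_def intro!: exI[of _ j])
    next
      fix j x assume "x \<in> U j" then show "x \<in> Rn d" by (auto simp: U_def Q_def split: if_splits)
    next
      fix j
      have "ennreal (real d / real m) \<le> ennreal \<delta>" using md by (rule ennreal_leI)
      with diamQ show "diam_Rn d (U j) \<le> ennreal \<delta>"
        by (auto simp: U_def diam_Rn_def[of _ "{}"] intro: order_trans)
    qed
    from hausdorff_delta_le[OF this, of d]
    have "hausdorff_delta d d \<delta> (unit_cube d) \<le> (\<Sum>j. diam_pow d d (U j))" .
    also have "\<dots> = (\<Sum>j<card K. diam_pow d d (U j))"
      by (intro suminf_finite) (auto simp: U_def diam_pow_def)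
    also have "\<dots> \<le> (\<Sum>j<card K. ennreal (real d / real m) ^ d)"
    proof (rule sum_mono)
      fix j assume "j \<in> {..<card K}"
      have "diam_Rn d (U j) \<le> ennreal (real d / real m)"
        using diamQ by (auto simp: U_def diam_Rn_def[of _ "{}"])
      then show "diam_pow d d (U j) \<le> ennreal (real d / real m) ^ d"
        by (auto simp: diam_pow_def intro: power_mono)
    qed
    also have "\<dots> = ennreal (real m ^ d * (real d / real m) ^ d)"
      by (simp add: K ennreal_power ennreal_mult ennreal_of_nat_eq_real_of_nat)
    also have "real m ^ d * (real d / real m) ^ d = real d ^ d"
      using m0 by (simp add: power_mult_distrib[symmetric])
    finally show ?thesis .
  qed
  then have "hausdorff_measure d d (unit_cube d) \<le> ennreal (real d ^ d)" by (rule hausdorff_measure_least)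
  also have "\<dots> < \<infinity>" by simp
  finally show ?thesis .
qed

text \<open>Makes Fubini available for the uniqueness argument; countably many integer translates of
  the unit cube fill the space.\<close>

lemma sigma_finite_hausdorff: "sigma_finite_measure (hausdorff d d)"
proof
  let ?A = "(\<lambda>k. translate_Rn d k -` unit_cube d \<inter> Rn d) ` Pi\<^sub>E {1..d} (\<lambda>_. \<int>)"
  show "\<exists>A. countable A \<and> A \<subseteq> sets (hausdorff d d) \<and> \<Union>A = space (hausdorff d d) \<and> (\<forall>a\<in>A. emeasure (hausdorff d d) a \<noteq> \<infinity>)"
  proof (intro exI[of _ ?A] conjI ballI)
    show "countable ?A" by (intro countable_image countable_PiE) (auto intro: countable_int)
    show sub: "?A \<subseteq> sets (hausdorff d d)"
      using measurable_sets[OF measurable_translate_Rn' unit_cube_sets] by auto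
    show "\<Union>?A = space (hausdorff d d)"
    proof (intro equalityI subsetI)
      fix x assume "x \<in> space (hausdorff d d)"
      then have x: "x \<in> Rn d" by simp
      define k where "k = (\<lambda>i\<in>{1..d}. - of_int \<lfloor>x i\<rfloor> :: real)"
      have "translate_Rn d k x \<in> unit_cube d"
        unfolding unit_cube_def
      proof (rule PiE_I)
        fix i assume i: "i \<in> {1..d}"
        have "translate_Rn d k x i = x i - of_int \<lfloor>x i\<rfloor>" using i by (simp add: translate_Rn_def k_def)
        then show "translate_Rn d k x i \<in> {0..<1}" by simp linarith
      qed (auto simp add: translate_Rn_def)
      moreover have "k \<in> Pi\<^sub>E {1..d} (\<lambda>_. \<int>)" by (auto simp: k_def)
      ultimately show "x \<in> \<Union>?A" using x by blast
    qed auto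
    fix a assume "a \<in> ?A"
    then obtain k where a: "a = translate_Rn d k -` unit_cube d \<inter> Rn d" by blast
    have m': "translate_Rn d k \<in> measurable (hausdorff d d) (lborel_Rn d)"
      using measurable_translate_Rn' by (simp add: measurable_cong_sets[OF sets_hausdorff refl])
    have "emeasure (hausdorff d d) a = emeasure (distr (hausdorff d d) (lborel_Rn d) (translate_Rn d k)) (unit_cube d)"
      using a by (simp add: emeasure_distr[OF m' unit_cube_sets])
    also have "\<dots> = emeasure (hausdorff d d) (unit_cube d)" by (simp add: hausdorff_translate)
    also have "\<dots> < \<infinity>" using hausdorff_measure_unit_cube_finite by (simp add: emeasure_hausdorff unit_cube_sets)
    finally show "emeasure (hausdorff d d) a \<noteq> \<infinity>" by simp
  qed
qed

text \<open>
  Uniqueness of translation-invariant measures: evaluate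
  \<open>\<integral>\<integral> 1\<^sub>A(x) 1\<^sub>Q(x + y)\<close> in both orders.
\<close>

theorem hausdorff_measure_eq_lborel:
  assumes A: "A \<in> sets (lborel_Rn d)"
  shows "hausdorff_measure d d A = hausdorff_measure d d (unit_cube d) * emeasure (lborel_Rn d) A"
proof -
  let ?h = "hausdorff d d" and ?V = "lborel_Rn d" and ?Q = "unit_cube d"
  interpret V: sigma_finite_measure ?V by (rule sigma_finite_lborel_Rn)
  interpret h: sigma_finite_measure ?h by (rule sigma_finite_hausdorff)
  interpret pair_sigma_finite ?h ?V ..
  have fst: "fst \<in> measurable (?h \<Otimes>\<^sub>M ?V) ?V" and snd: "snd \<in> measurable (?h \<Otimes>\<^sub>M ?V) ?V"
    using measurable_fst[of ?h ?V] by (auto simp: measurable_cong_sets[OF refl sets_hausdorff])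
  have Ah: "A \<in> sets ?h" "?Q \<in> sets ?h" using A unit_cube_sets by auto
  have m1: "(\<lambda>(x, y). indicator A x * indicator ?Q (translate_Rn d x y) :: ennreal) \<in> borel_measurable (?h \<Otimes>\<^sub>M ?V)"
    unfolding case_prod_beta
    by (intro borel_measurable_times_ennreal measurable_compose[OF fst] measurable_compose[OF measurable_translate_Rn[OF fst snd]]
        borel_measurable_indicator A unit_cube_sets)
  have ng: "(\<lambda>z. scale_Rn d (-1) (snd z)) \<in> measurable (?h \<Otimes>\<^sub>M ?V) ?V"
    by (intro measurable_scale_Rn snd) auto
  have m2: "(\<lambda>(x, y). indicator A (translate_Rn d (scale_Rn d (-1) y) x) * indicator ?Q x :: ennreal) \<in> borel_measurable (?h \<Otimes>\<^sub>M ?V)"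
    unfolding case_prod_beta
    by (intro borel_measurable_times_ennreal measurable_compose[OF fst] measurable_compose[OF measurable_translate_Rn[OF ng fst]]
        borel_measurable_indicator A unit_cube_sets)
  \<comment> \<open>The unit cube has Lebesgue measure 1, so an inner integral over \<open>y\<close>
    may be inserted, and Lebesgue invariance then shifts it by \<open>x\<close>.\<close>
  have "emeasure ?h A = (\<integral>\<^sup>+x. indicator A x * (\<integral>\<^sup>+y. indicator ?Q y \<partial>?V) \<partial>?h)"
    using Ah by (simp add: emeasure_unit_cube unit_cube_sets)
  also have "\<dots> = (\<integral>\<^sup>+x. (\<integral>\<^sup>+y. indicator A x * indicator ?Q (translate_Rn d x y) \<partial>?V) \<partial>?h)"
  proof (rule nn_integral_cong)
    fix x
    have i: "(indicator ?Q :: _ \<Rightarrow> ennreal) \<in> borel_measurable ?V" using unit_cube_sets by simp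
    have "(\<integral>\<^sup>+y. indicator ?Q (translate_Rn d x y) \<partial>?V) = (\<integral>\<^sup>+y. indicator ?Q y \<partial>?V)"
      unfolding translate_Rn_def by (rule nn_integral_translate_Rn[OF i])
    then show "indicator A x * (\<integral>\<^sup>+y. indicator ?Q y \<partial>?V) = (\<integral>\<^sup>+y. indicator A x * indicator ?Q (translate_Rn d x y) \<partial>?V)"
      using measurable_compose[OF measurable_translate_Rn' i, of x]
      by (subst nn_integral_cmult) auto
  qed
  also have "\<dots> = (\<integral>\<^sup>+y. (\<integral>\<^sup>+x. indicator A x * indicator ?Q (translate_Rn d x y) \<partial>?h) \<partial>?V)"
    by (rule Fubini'[OF m1, symmetric])
  \<comment> \<open>Translation invariance of Hausdorff measure, in the form x -> x - y, frees
    \<open>?Q\<close> from \<open>y\<close>.\<close>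
  also have "\<dots> = (\<integral>\<^sup>+y. (\<integral>\<^sup>+x. indicator A (translate_Rn d (scale_Rn d (-1) y) x) * indicator ?Q x \<partial>?h) \<partial>?V)"
  proof (rule nn_integral_cong)
    fix y assume y: "y \<in> Rn d"
    let ?T = "translate_Rn d (scale_Rn d (-1) y)"
    have T: "?T \<in> measurable ?h ?V"
      using measurable_translate_Rn' by (simp add: measurable_cong_sets[OF sets_hausdorff refl])
    have f: "(\<lambda>x. indicator A x * indicator ?Q (translate_Rn d x y) :: ennreal) \<in> borel_measurable ?V"
    proof (intro borel_measurable_times_ennreal borel_measurable_indicator A)
      show "(\<lambda>x. indicator ?Q (translate_Rn d x y) :: ennreal) \<in> borel_measurable ?V"
        by (rule measurable_compose[OF measurable_translate_Rn]) (use y unit_cube_sets in auto)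
    qed
    have "(\<integral>\<^sup>+x. indicator A x * indicator ?Q (translate_Rn d x y) \<partial>?h)
        = (\<integral>\<^sup>+x. indicator A x * indicator ?Q (translate_Rn d x y) \<partial>distr ?h ?V ?T)"
      by (simp add: hausdorff_translate)
    also have "\<dots> = (\<integral>\<^sup>+x. indicator A (?T x) * indicator ?Q (translate_Rn d (?T x) y) \<partial>?h)"
      by (rule nn_integral_distr[OF T]) (use f in simp)
    also have "\<dots> = (\<integral>\<^sup>+x. indicator A (?T x) * indicator ?Q x \<partial>?h)"
    proof (rule nn_integral_cong)
      fix x assume "x \<in> space ?h"
      then have "translate_Rn d (?T x) y = x"
        by (intro Rn_eqI[of _ d]) (auto simp: translate_Rn_apply scale_Rn_apply simp del: One_nat_def)
      then show "indicator A (?T x) * indicator ?Q (translate_Rn d (?T x) y) = (indicator A (?T x) * indicator ?Q x :: ennreal)"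
        by simp
    qed
    finally show "(\<integral>\<^sup>+x. indicator A x * indicator ?Q (translate_Rn d x y) \<partial>?h) = (\<integral>\<^sup>+x. indicator A (?T x) * indicator ?Q x \<partial>?h)" .
  qed
  also have "\<dots> = (\<integral>\<^sup>+x. (\<integral>\<^sup>+y. indicator A (translate_Rn d (scale_Rn d (-1) y) x) * indicator ?Q x \<partial>?V) \<partial>?h)"
    by (rule Fubini'[OF m2])
  \<comment> \<open>Now \<open>A\<close> is evaluated at x - y, and y -> x - y preserves Lebesgue
    measure.\<close>
  also have "\<dots> = (\<integral>\<^sup>+x. emeasure ?V A * indicator ?Q x \<partial>?h)"
  proof (rule nn_integral_cong)
    fix x assume "x \<in> space ?h"
    have i: "(indicator A :: _ \<Rightarrow> ennreal) \<in> borel_measurable ?V" using A by simp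
    have eq: "translate_Rn d (scale_Rn d (-1) y) x = (\<lambda>i\<in>{1..d}. x i + (-1) * y i)" for y
      by (rule Rn_eqI[of _ d]) (auto simp: translate_Rn_apply scale_Rn_apply simp del: One_nat_def)
    have m: "(\<lambda>y. indicator A (\<lambda>i\<in>{1..d}. x i + (-1) * y i) :: ennreal) \<in> borel_measurable ?V"
      by (rule measurable_compose[OF measurable_restrict_Rn i]) measurable
    show "(\<integral>\<^sup>+y. indicator A (translate_Rn d (scale_Rn d (-1) y) x) * indicator ?Q x \<partial>?V) = emeasure ?V A * indicator ?Q x"
      unfolding eq using nn_integral_affine_Rn[OF i, of "-1" x] m A by (subst nn_integral_multc) auto
  qed
  also have "\<dots> = emeasure ?h ?Q * emeasure ?V A"
    using Ah by (subst nn_integral_cmult_indicator) (auto simp: mult.commute)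
  finally show ?thesis using A by (simp add: emeasure_hausdorff unit_cube_sets)
qed

lemma edist_fun_upd_Suc: "edist (Suc d) (u(Suc d := h)) (u'(Suc d := h)) = edist d u u'"
  unfolding edist_def L2_set_def atLeast1AtMost_Suc by (subst sum.insert) auto

text \<open>The cone over a flat set \<open>C\<close> is sliced parallel to its hyperplane, which
  has distance \<open>h\<close> from the origin. The slice \<open>l = s\<close> is a copy of
  \<open>C\<close> scaled by \<open>s\<close>, hence of volume s^d times that of \<open>C\<close>,
  at height h * s; this produces the factor \<open>h\<close> and the weight s^d. The profile \<phi>
  is left free because different radial weights are inserted later.\<close>

lemma hausdorff_measure_flat:
  fixes \<phi> :: "real \<Rightarrow> ennreal"
  assumes \<nu>: "(\<Sum>i=1..Suc d. (\<nu> i)\<^sup>2) = 1" and h: "h > 0"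
    and C: "C \<in> sets (lborel_Rn (Suc d))" "\<And>y. y \<in> C \<Longrightarrow> (\<Sum>i=1..Suc d. \<nu> i * y i) = h"
    and \<phi>: "\<phi> \<in> borel_measurable borel"
  defines "l \<equiv> \<lambda>y. (\<Sum>i=1..Suc d. \<nu> i * y i) / h"
  shows "hausdorff_measure d d (unit_cube d) *
      (\<integral>\<^sup>+y. (if l y > 0 \<and> scale_Rn (Suc d) (1 / l y) y \<in> C then \<phi> (l y) else 0) \<partial>lborel_Rn (Suc d))
    = hausdorff_measure (Suc d) d C * (ennreal h * (\<integral>\<^sup>+s. ennreal (s ^ d) * \<phi> s * indicator {0<..} s \<partial>lborel))"
proof -
  let ?n = "Suc d" and ?V = "lborel_Rn (Suc d)"
  obtain R where R: "R \<in> measurable ?V ?V" "\<And>x. x \<in> Rn ?n \<Longrightarrow> R (R x) = x"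
    "\<And>x y. edist ?n (R x) (R y) = edist ?n x y"
    "\<And>r x. x \<in> Rn ?n \<Longrightarrow> R (scale_Rn ?n r x) = scale_Rn ?n r (R x)"
    "\<And>x. R x ?n = (\<Sum>i=1..?n. \<nu> i * x i)"
    "\<And>f. f \<in> borel_measurable ?V \<Longrightarrow> (\<integral>\<^sup>+x. f (R x) \<partial>?V) = (\<integral>\<^sup>+x. f x \<partial>?V)"
    using ex_rotation[OF \<nu>] by blast
  have Rin: "R x \<in> Rn ?n" if "x \<in> Rn ?n" for x using measurable_space[OF R(1) that] .
  define f where "f z = (if z ?n > 0 \<and> R (scale_Rn ?n (h / z ?n) z) \<in> C then \<phi> (z ?n / h) else 0)" for z
  have zn: "(\<lambda>z. z ?n) \<in> borel_measurable ?V" by measurable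
  have f_meas: "f \<in> borel_measurable ?V"
  proof -
    have "(\<lambda>z. R (scale_Rn ?n (h / z ?n) z)) \<in> measurable ?V ?V"
      by (rule measurable_compose[OF measurable_scale_Rn R(1)]) (use zn in measurable)
    from measurable_sets[OF this C(1)] have "{z \<in> Rn ?n. R (scale_Rn ?n (h / z ?n) z) \<in> C} \<in> sets ?V"
      by (simp add: vimage_def Int_def conj_commute)
    moreover have "{z \<in> Rn ?n. z ?n > 0} \<in> sets ?V" using zn by measurable
    moreover have "(\<lambda>z. \<phi> (z ?n / h)) \<in> borel_measurable ?V"
      by (rule measurable_compose[OF _ \<phi>]) (use zn in measurable)
    ultimately show ?thesis unfolding f_def
      by (intro measurable_If measurable_const sets.sets_Collect_conj) auto
  qed
  \<comment> \<open>\<open>C\<close> rotated to height \<open>h\<close> and stripped of its last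
    coordinate.\<close>
  define B where "B = {u \<in> Rn d. R (u(?n := h)) \<in> C}"
  have upd_meas: "(\<lambda>u. R (u(?n := h))) \<in> measurable (lborel_Rn d) ?V"
    by (rule measurable_compose[OF measurable_fun_upd_Rn R(1)]) auto
  have B: "B \<in> sets (lborel_Rn d)"
    using measurable_sets[OF upd_meas C(1)] by (simp add: B_def vimage_def Int_def conj_commute)
  have HC: "hausdorff_measure ?n d C = hausdorff_measure d d (unit_cube d) * emeasure (lborel_Rn d) B"
  proof -
    have "(\<lambda>u. R (u(?n := h))) ` B = C"
    proof (intro equalityI subsetI)
      fix y assume y: "y \<in> C"
      then have yR: "y \<in> Rn ?n" using C(1) sets.sets_into_space by blast
      define u where "u = (\<lambda>i\<in>{1..d}. R y i)"
      have "u(?n := h) = R y"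
        using C(2)[OF y] R(5)[of y] by (intro Rn_eqI[of _ ?n] fun_upd_in_Rn Rin yR) (auto simp: u_def le_Suc_eq simp flip: One_nat_def)
      then have "R (u(?n := h)) = y" using R(2)[OF yR] by simp
      moreover have "u \<in> B" using \<open>R (u(?n := h)) = y\<close> y unfolding B_def u_def by (auto simp del: One_nat_def)
      ultimately show "y \<in> (\<lambda>u. R (u(?n := h))) ` B" by (metis image_eqI)
    qed (auto simp: B_def)
    moreover have "hausdorff_measure ?n d ((\<lambda>u. R (u(?n := h))) ` B) = hausdorff_measure d d B"
      by (rule hausdorff_measure_isometric_image) (auto simp: B_def R(3) edist_fun_upd_Suc intro!: Rin fun_upd_in_Rn)
    ultimately show ?thesis using hausdorff_measure_eq_lborel[OF B] by simp
  qed
  have inner: "(\<integral>\<^sup>+u. f (u(?n := t)) \<partial>lborel_Rn d) = emeasure (lborel_Rn d) B * (ennreal ((t / h) ^ d) * \<phi> (t / h) * indicator {0<..} (t / h))" for t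
  proof (cases "t > 0")
    case True
    have "f (u(?n := t)) = \<phi> (t / h) * indicator B (scale_Rn d (h / t) u)" if u: "u \<in> Rn d" for u
    proof -
      have "scale_Rn ?n (h / t) (u(?n := t)) = (scale_Rn d (h / t) u)(?n := h)"
      proof (rule Rn_eqI[of _ ?n])
        fix i assume i: "i \<in> {1..?n}"
        show "scale_Rn ?n (h / t) (u(?n := t)) i = ((scale_Rn d (h / t) u)(?n := h)) i"
          using i True by (cases "i = ?n") (simp_all add: scale_Rn_def)
      qed (auto intro: fun_upd_in_Rn)
      then show ?thesis using True by (simp add: f_def B_def indicator_def)
    qed
    then have "(\<integral>\<^sup>+u. f (u(?n := t)) \<partial>lborel_Rn d) = (\<integral>\<^sup>+u. \<phi> (t / h) * indicator B (scale_Rn d (h / t) u) \<partial>lborel_Rn d)"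
      by (intro nn_integral_cong) simp
    also have "\<dots> = \<phi> (t / h) * (\<integral>\<^sup>+u. indicator B (scale_Rn d (h / t) u) \<partial>lborel_Rn d)"
      by (rule nn_integral_cmult) (rule measurable_compose[OF measurable_scale_Rn], use B in auto)
    also have "(\<integral>\<^sup>+u. indicator B (scale_Rn d (h / t) u) \<partial>lborel_Rn d) = ennreal ((t / h) ^ d) * emeasure (lborel_Rn d) B"
    proof -
      have "emeasure (lborel_Rn d) B = ennreal ((h / t) ^ d) * (\<integral>\<^sup>+u. indicator B (scale_Rn d (h / t) u) \<partial>lborel_Rn d)"
        using nn_integral_scale_Rn[of "indicator B" d "h / t"] B True h by simp
      then have "ennreal ((t / h) ^ d) * emeasure (lborel_Rn d) B = (ennreal ((t / h) ^ d) * ennreal ((h / t) ^ d)) * (\<integral>\<^sup>+u. indicator B (scale_Rn d (h / t) u) \<partial>lborel_Rn d)"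
        by (simp add: mult.assoc)
      also have "ennreal ((t / h) ^ d) * ennreal ((h / t) ^ d) = 1"
        using True h by (simp add: ennreal_mult[symmetric] power_mult_distrib[symmetric])
      finally show ?thesis by simp
    qed
    finally show ?thesis using True h by (simp add: ac_simps fun_upd_def)
  next
    case False
    then show ?thesis using h by (simp add: f_def zero_less_divide_iff)
  qed
  have "(\<integral>\<^sup>+y. (if l y > 0 \<and> scale_Rn ?n (1 / l y) y \<in> C then \<phi> (l y) else 0) \<partial>?V) = (\<integral>\<^sup>+y. f (R y) \<partial>?V)"
  proof (rule nn_integral_cong)
    fix y assume y: "y \<in> Rn ?n"
    have ly: "l y = R y ?n / h" by (simp only: l_def R(5))
    have "R (scale_Rn ?n (h / R y ?n) (R y)) = scale_Rn ?n (1 / l y) y"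
      using R(4)[OF Rin[OF y], of "h / R y ?n"] R(2)[OF y] ly by simp
    then show "(if l y > 0 \<and> scale_Rn ?n (1 / l y) y \<in> C then \<phi> (l y) else 0) = f (R y)"
      unfolding f_def using h ly by (simp add: zero_less_divide_iff)
  qed
  also have "\<dots> = (\<integral>\<^sup>+t. (\<integral>\<^sup>+u. f (u(?n := t)) \<partial>lborel_Rn d) \<partial>lborel)"
    unfolding R(6)[OF f_meas] by (rule nn_integral_Rn_Suc_rev[OF f_meas])
  also have "\<dots> = emeasure (lborel_Rn d) B * (\<integral>\<^sup>+t. ennreal ((t / h) ^ d) * \<phi> (t / h) * indicator {0<..} (t / h) \<partial>lborel)"
    unfolding inner using \<phi> by (subst nn_integral_cmult) (auto intro!: measurable_compose[OF _ \<phi>])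
  \<comment> \<open>Substitution t = h * s, from the height to the scaling factor.\<close>
  also have "(\<integral>\<^sup>+t. ennreal ((t / h) ^ d) * \<phi> (t / h) * indicator {0<..} (t / h) \<partial>lborel)
      = ennreal h * (\<integral>\<^sup>+s. ennreal (s ^ d) * \<phi> s * indicator {0<..} s \<partial>lborel)"
  proof -
    have "(\<lambda>t. ennreal ((t / h) ^ d) * \<phi> (t / h) * indicator {0<..} (t / h)) \<in> borel_measurable borel"
      using measurable_compose[OF _ \<phi>, of "\<lambda>t. t / h" borel] by measurable
    from nn_integral_real_affine[OF this, of h 0] h show ?thesis by simp
  qed
  finally show ?thesis unfolding HC by (simp add: mult.assoc)
qed

section \<open>Surface measure near a smooth point\<close>

definition p_sum :: "real \<Rightarrow> nat \<Rightarrow> (nat \<Rightarrow> real) \<Rightarrow> real" where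
  "p_sum p n y = (\<Sum>i=1..n. \<bar>y i\<bar> powr p)"

text \<open>On the sphere this is the Euclidean norm of the gradient of \<^const>\<open>p_norm\<close>.\<close>

definition grad_norm :: "real \<Rightarrow> nat \<Rightarrow> (nat \<Rightarrow> real) \<Rightarrow> real" where
  "grad_norm p n y = sqrt (\<Sum>i=1..n. \<bar>y i\<bar> powr (2 * p - 2))"

lemma p_norm_eq: "p_norm p n y = p_sum p n y powr (1 / p)"
  by (simp add: p_norm_def p_sum_def)

lemma p_sum_nonneg [simp]: "0 \<le> p_sum p n y"
  unfolding p_sum_def by (intro sum_nonneg) auto

lemma p_norm_nonneg [simp]: "0 \<le> p_norm p n y"
  by (simp add: p_norm_eq)

lemma p_norm_powr: "p > 0 \<Longrightarrow> p_norm p n y powr p = p_sum p n y"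
  by (simp add: p_norm_eq powr_powr)

lemma p_sum_scale: "p_sum p n (scale_Rn n r y) = \<bar>r\<bar> powr p * p_sum p n y"
  unfolding p_sum_def sum_distrib_left
  by (intro sum.cong refl) (simp add: scale_Rn_def abs_mult powr_mult)

lemma p_norm_scale: "p > 0 \<Longrightarrow> p_norm p n (scale_Rn n r y) = \<bar>r\<bar> * p_norm p n y"
  by (simp add: p_norm_eq p_sum_scale powr_mult powr_powr)

lemma grad_norm_scale: "grad_norm p n (scale_Rn n r y) = \<bar>r\<bar> powr (p - 1) * grad_norm p n y"
proof -
  have "(\<Sum>i=1..n. \<bar>scale_Rn n r y i\<bar> powr (2 * p - 2)) = \<bar>r\<bar> powr (2 * p - 2) * (\<Sum>i=1..n. \<bar>y i\<bar> powr (2 * p - 2))"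
    unfolding sum_distrib_left by (intro sum.cong refl) (simp add: scale_Rn_def abs_mult powr_mult)
  moreover have "sqrt (\<bar>r\<bar> powr (2 * p - 2)) = \<bar>r\<bar> powr (p - 1)"
    by (simp add: powr_half_sqrt[symmetric] powr_powr diff_divide_distrib)
  ultimately show ?thesis by (simp add: grad_norm_def real_sqrt_mult)
qed

lemma measurable_p_sum [measurable]: "p_sum p n \<in> borel_measurable (lborel_Rn n)"
  unfolding p_sum_def by measurable

lemma measurable_p_norm [measurable]: "p_norm p n \<in> borel_measurable (lborel_Rn n)"
  unfolding p_norm_eq by measurable

lemma measurable_grad_norm [measurable]: "grad_norm p n \<in> borel_measurable (lborel_Rn n)"
  unfolding grad_norm_def by measurable

lemma p_sphere_eq:
  assumes "p > 0"
  shows "p_sphere p n = {x \<in> Rn n. p_sum p n x = 1}"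
proof -
  have "p_norm p n x = 1 \<longleftrightarrow> p_sum p n x = 1" for x
    using p_norm_powr[OF assms, of n x] by (auto simp: p_norm_eq)
  then show ?thesis by (simp add: p_sphere_def)
qed

lemma p_sphere_sets [measurable]: "p_sphere p n \<in> sets (lborel_Rn n)"
  unfolding p_sphere_def by measurable

lemma p_sphere_abs_le_1:
  assumes "p > 0" "x \<in> p_sphere p n" "i \<in> {1..n}"
  shows "\<bar>x i\<bar> \<le> 1"
proof (rule ccontr)
  assume "\<not> \<bar>x i\<bar> \<le> 1"
  then have "1 < \<bar>x i\<bar> powr p" using assms by (simp add: gr_one_powr)
  also have "\<dots> \<le> p_sum p n x" unfolding p_sum_def using assms by (intro member_le_sum) auto
  finally show False using assms by (simp add: p_sphere_eq)
qed

section \<open>Euclidean distortion of a rescaling along rays\<close>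

lemma L2_set_le_card:
  assumes "\<And>i. i \<in> {1..n} \<Longrightarrow> \<bar>z i\<bar> \<le> c"
  shows "L2_set z {1..n} \<le> real n * c"
proof -
  have "L2_set z {1..n} \<le> (\<Sum>i=1..n. \<bar>z i\<bar>)" by (rule L2_set_le_sum_abs)
  also have "\<dots> \<le> (\<Sum>i=1..n. c)" by (intro sum_mono assms)
  finally show ?thesis by simp
qed

lemma L2_set_cmult: "L2_set (\<lambda>i. c * f i) A = \<bar>c\<bar> * L2_set f A"
  by (simp add: L2_set_def power_mult_distrib sum_distrib_left[symmetric] real_sqrt_mult)

lemma L2_set_diff_le: "\<bar>L2_set f A - L2_set g A\<bar> \<le> L2_set (\<lambda>i. f i - g i) A"
proof -
  have "L2_set f A \<le> L2_set (\<lambda>i. f i - g i) A + L2_set g A"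
    using L2_set_triangle_ineq[of "\<lambda>i. f i - g i" g A] by simp
  moreover have "L2_set g A \<le> L2_set (\<lambda>i. f i - g i) A + L2_set f A"
    using L2_set_triangle_ineq[of "\<lambda>i. g i - f i" f A]
    by (simp add: L2_set_def power2_commute)
  ultimately show ?thesis by linarith
qed

text \<open>After subtracting y - z, the difference of the scaled points is (a - 1)(y - z) + (a - b)
  z. This controls a central projection with a slowly varying factor: \<open>a\<close> is close to
  1, and a - b is small compared with the distance.\<close>

lemma edist_scale_diff:
  "\<bar>edist n (scale_Rn n a y) (scale_Rn n b z) - edist n y z\<bar> \<le> \<bar>a - 1\<bar> * edist n y z + \<bar>a - b\<bar> * L2_set z {1..n}"
proof -
  have "edist n (scale_Rn n a y) (scale_Rn n b z) = L2_set (\<lambda>i. a * y i - b * z i) {1..n}"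
    unfolding edist_def by (intro L2_set_cong) (auto simp: scale_Rn_def)
  then have "\<bar>edist n (scale_Rn n a y) (scale_Rn n b z) - edist n y z\<bar>
      \<le> L2_set (\<lambda>i. (a * y i - b * z i) - (y i - z i)) {1..n}"
    using L2_set_diff_le by (simp add: edist_def)
  also have "\<dots> = L2_set (\<lambda>i. (a - 1) * (y i - z i) + (a - b) * z i) {1..n}"
    by (intro L2_set_cong) (auto simp: algebra_simps)
  also have "\<dots> \<le> L2_set (\<lambda>i. (a - 1) * (y i - z i)) {1..n} + L2_set (\<lambda>i. (a - b) * z i) {1..n}"
    by (rule L2_set_triangle_ineq)
  finally show ?thesis by (simp add: L2_set_cmult edist_def)
qed

text \<open>Differentiability at \<open>x\<close> compares only with the point \<open>x\<close>
  itself. The bi-Lipschitz estimate needs the same slope for all pairs near \<open>x\<close>, which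
  follows from continuity of the derivative and the mean value inequality.\<close>

lemma abs_powr_strict_derivative:
  fixes x p \<epsilon> :: real
  assumes "x \<noteq> 0" "p \<ge> 1" "\<epsilon> > 0"
  obtains V where "open V" "x \<in> V"
    and "\<And>s t. s \<in> V \<Longrightarrow> t \<in> V \<Longrightarrow>
           \<bar>(\<bar>s\<bar> powr p - \<bar>t\<bar> powr p) - p * (\<bar>x\<bar> powr (p - 1) * sgn x) * (s - t)\<bar> \<le> \<epsilon> * \<bar>s - t\<bar>"
proof -
  define a where "a = \<bar>x\<bar> powr (p - 1) * sgn x"
  define g' where "g' s = p * (\<bar>s\<bar> powr (p - 1) * sgn x) - p * a" for s
  have "(g' \<longlongrightarrow> g' x) (nhds x)"
    unfolding g'_def using assms(1) by (intro tendsto_intros) (auto intro: tendsto_rabs filterlim_ident)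
  then have "eventually (\<lambda>s. dist (g' s) (g' x) < \<epsilon>) (nhds x)" using assms(3) by (rule tendstoD)
  then have "eventually (\<lambda>s. \<bar>g' s\<bar> < \<epsilon>) (nhds x)" by (simp add: g'_def a_def dist_real_def)
  then obtain r where r: "r > 0" "\<And>s. dist s x < r \<Longrightarrow> \<bar>g' s\<bar> < \<epsilon>"
    unfolding eventually_nhds_metric by blast
  \<comment> \<open>A radius of at most |x| keeps the sign constant, so that |s| = sgn x * s on
    \<open>V\<close>.\<close>
  define V where "V = ball x (min r \<bar>x\<bar>)"
  have sg: "sgn s = sgn x" "s \<noteq> 0" if "s \<in> V" for s
    using that by (auto simp: V_def dist_real_def sgn_if)
  have der: "((\<lambda>s. \<bar>s\<bar> powr p - p * a * s) has_field_derivative g' s) (at s within V)" if s: "s \<in> V" for s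
  proof -
    have "((\<lambda>s. (sgn x * s) powr p - p * a * s) has_field_derivative g' s) (at s within V)"
    proof -
      have pos: "sgn x * s > 0" using sg[OF s] by (auto simp: sgn_if split: if_splits)
      have "\<bar>s\<bar> = sgn x * s" using sg[OF s] by (metis abs_sgn mult.commute)
      then show ?thesis using pos unfolding g'_def
        by (auto intro!: derivative_eq_intros)
    qed
    moreover have "\<bar>u\<bar> = sgn x * u" if "u \<in> V" for u using sg[OF that] by (metis abs_sgn mult.commute)
    ultimately show ?thesis
      using s by (subst has_field_derivative_cong_eventually[of _ "\<lambda>s. (sgn x * s) powr p - p * a * s"])
        (auto simp: eventually_at_filter)
  qed
  show ?thesis
  proof (rule that)
    show "open V" "x \<in> V" using r assms(1) by (auto simp: V_def)
    fix s t assume st: "s \<in> V" "t \<in> V"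
    have "norm ((\<bar>s\<bar> powr p - p * a * s) - (\<bar>t\<bar> powr p - p * a * t)) \<le> \<epsilon> * norm (s - t)"
    proof (rule field_differentiable_bound[OF _ der _ st])
      show "convex V" by (simp add: V_def)
      fix u assume "u \<in> V"
      then show "norm (g' u) \<le> \<epsilon>" using r(2)[of u] by (simp add: V_def dist_commute less_imp_le)
    qed
    then show "\<bar>(\<bar>s\<bar> powr p - \<bar>t\<bar> powr p) - p * (\<bar>x\<bar> powr (p - 1) * sgn x) * (s - t)\<bar> \<le> \<epsilon> * \<bar>s - t\<bar>"
      by (simp add: a_def algebra_simps)
  qed
qed

lemma tendsto_coord: "((\<lambda>y. y i) \<longlongrightarrow> x i) (nhds (x :: nat \<Rightarrow> real))"
proof -
  have "isCont (\<lambda>y::nat \<Rightarrow> real. y i) x"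
    using continuous_on_product_coordinates[of i] continuous_on_eq_continuous_at[OF open_UNIV] by blast
  then show ?thesis
    unfolding continuous_at using tendsto_at_iff_tendsto_nhds[of "\<lambda>y. y i" x] by blast
qed

text \<open>Neighbourhoods are taken in the space of all functions on the naturals. On
  \<open>Rn n\<close> the coordinates outside \<open>{1..n}\<close> equal \<open>undefined\<close>,
  so the inclusion into the full product is measurable.\<close>

lemma open_Int_Rn_sets:
  assumes "open (U :: (nat \<Rightarrow> real) set)"
  shows "U \<inter> Rn n \<in> sets (lborel_Rn n)"
proof -
  have "U \<in> sets (Pi\<^sub>M UNIV (\<lambda>_. borel))"
    using assms by (simp add: sets_PiM_equal_borel)
  moreover have "(\<lambda>x. x) \<in> measurable (lborel_Rn n) (Pi\<^sub>M UNIV (\<lambda>_. borel))"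
  proof (rule measurable_PiM_single')
    fix i
    show "(\<lambda>x. x i) \<in> borel_measurable (lborel_Rn n)"
    proof (cases "i \<in> {1..n}")
      case False
      then have "x i = undefined" if "x \<in> Rn n" for x
        using that by (auto simp: space_lborel_Rn PiE_iff extensional_def)
      then show ?thesis by (subst measurable_cong[of _ _ "\<lambda>_. undefined"]) auto
    qed (rule coord_measurable)
  qed auto
  ultimately show ?thesis using measurable_sets by fastforce
qed


text \<open>For \<open>A\<close> on the sphere: the union of the open rays from the origin through
  the points of \<open>A\<close>.\<close>

definition radial_set :: "real \<Rightarrow> nat \<Rightarrow> (nat \<Rightarrow> real) set \<Rightarrow> (nat \<Rightarrow> real) set" where
  "radial_set p n A = {y \<in> Rn n. p_norm p n y > 0 \<and> scale_Rn n (1 / p_norm p n y) y \<in> A}"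

text \<open>The exponential makes the integral along rays converge; it is the density of Y up to
  normalisation, so that integrals can be read as expectations.\<close>

definition surface_weight :: "real \<Rightarrow> nat \<Rightarrow> (nat \<Rightarrow> real) \<Rightarrow> ennreal" where
  "surface_weight p n y = ennreal (grad_norm p n y * exp (- p_sum p n y))"

definition radial_surface :: "real \<Rightarrow> nat \<Rightarrow> (nat \<Rightarrow> real) set \<Rightarrow> ennreal" where
  "radial_surface p n A = (\<integral>\<^sup>+y. surface_weight p n y * indicator (radial_set p n A) y \<partial>lborel_Rn n)"

text \<open>The surface weight along a ray, up to a constant, as a function of s = l y for the
  linear form \<open>l\<close> of a tangent hyperplane. The parameter \<open>c\<close> stands for
  the ratio of the p-norm to \<open>l\<close>, which is close to 1 near the point of
  tangency.\<close>

definition radial_profile :: "real \<Rightarrow> real \<Rightarrow> real \<Rightarrow> ennreal" where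
  "radial_profile p c s = ennreal (s powr (p - 1) * exp (- ((c * s) powr p)))"

text \<open>For c = 1 this is Gamma (d / p + 1) / p; the weight s^d comes from the slices of a
  cone.\<close>

definition radial_const :: "real \<Rightarrow> nat \<Rightarrow> real \<Rightarrow> ennreal" where
  "radial_const p d c = (\<integral>\<^sup>+s. ennreal (s ^ d) * radial_profile p c s * indicator {0<..} s \<partial>lborel)"

lemma measurable_radial_profile [measurable]: "radial_profile p c \<in> borel_measurable borel"
  unfolding radial_profile_def by measurable

lemma measurable_surface_weight [measurable]: "surface_weight p n \<in> borel_measurable (lborel_Rn n)"
  unfolding surface_weight_def by measurable

text \<open>Substituting s -> c * s carries the profiles for c = 1 \<plusminus> \<eta> to the one
  for c = 1, so that one and the same constant appears at every point of the sphere.\<close>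

lemma radial_const_scale:
  assumes c: "c > 0"
  shows "ennreal (c ^ d * c powr p) * radial_const p d c = radial_const p d 1"
proof -
  let ?f = "\<lambda>s. ennreal (s ^ d) * radial_profile p 1 s * indicator {0<..} s"
  have "?f \<in> borel_measurable borel" by measurable
  from nn_integral_real_affine[OF this, of c 0] c
  have "radial_const p d 1 = ennreal c * (\<integral>\<^sup>+s. ?f (c * s) \<partial>lborel)" by (simp add: radial_const_def)
  also have "(\<integral>\<^sup>+s. ?f (c * s) \<partial>lborel) = (\<integral>\<^sup>+s. ennreal (c ^ d * c powr (p - 1)) *
      (ennreal (s ^ d) * radial_profile p c s * indicator {0<..} s) \<partial>lborel)"
  proof (rule nn_integral_cong)
    fix s :: real
    show "?f (c * s) = ennreal (c ^ d * c powr (p - 1)) * (ennreal (s ^ d) * radial_profile p c s * indicator {0<..} s)"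
    proof (cases "s > 0")
      case True
      then show ?thesis using c
        by (simp add: radial_profile_def powr_mult power_mult_distrib ennreal_mult[symmetric] mult_ac)
    qed (use c in \<open>simp add: zero_less_mult_iff\<close>)
  qed
  also have "\<dots> = ennreal (c ^ d * c powr (p - 1)) * radial_const p d c"
    unfolding radial_const_def by (rule nn_integral_cmult) measurable
  also have "ennreal c * (ennreal (c ^ d * c powr (p - 1)) * radial_const p d c)
      = ennreal (c * (c ^ d * c powr (p - 1))) * radial_const p d c"
    using c by (simp add: ennreal_mult mult.assoc)
  also have "c * (c ^ d * c powr (p - 1)) = c ^ d * c powr p"
    using c by (simp add: powr_diff)
  finally show ?thesis ..
qed

text \<open>
  Let \<open>l\<close> be the derivative of \<^const>\<open>p_norm\<close> at \<open>x\<close>. It is constant to first order along the sphere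
  near \<open>x\<close>, so the central projection \<open>y \<mapsto> y / l y\<close> from the sphere to the tangent hyperplane
  \<open>l = 1\<close> is nearly isometric there, and \<open>hausdorff_measure_flat\<close> applies to the projected set.
\<close>

lemma surface_local:
  fixes d :: nat and p \<alpha> :: real and x :: "nat \<Rightarrow> real"
  defines "n \<equiv> Suc d"
  assumes p: "1 \<le> p" and x: "x \<in> p_sphere p n" "\<And>i. i \<in> {1..n} \<Longrightarrow> x i \<noteq> 0" and \<alpha>: "\<alpha> > 1"
  obtains U where "open U" "x \<in> U"
    and "\<And>A. A \<in> sets (lborel_Rn n) \<Longrightarrow> A \<subseteq> U \<inter> p_sphere p n \<Longrightarrow>
      radial_const p d 1 * hausdorff_measure n d A
        \<le> ennreal \<alpha> * (hausdorff_measure d d (unit_cube d) * radial_surface p n A) \<and>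
      hausdorff_measure d d (unit_cube d) * radial_surface p n A
        \<le> ennreal \<alpha> * (radial_const p d 1 * hausdorff_measure n d A)"
proof -
  let ?V = "lborel_Rn n" and ?S = "p_sphere p n" and ?N = "p_norm p n"
  let ?\<kappa> = "hausdorff_measure d d (unit_cube d)" and ?J = "radial_const p d 1"
  have n0: "real n \<ge> 1" by (simp add: n_def)
  \<comment> \<open>The accumulated errors: one factor 1 \<plusminus> \<eta> from the weight,
    \<open>d\<close> of them from the Lipschitz constant of the projection, and the denominator from
    rescaling the profile by \<open>radial_const_scale\<close>.\<close>
  define up where "up \<eta> = (1 + \<eta>) ^ Suc d / ((1 - \<eta>) ^ d * (1 - \<eta>) powr p)" for \<eta> :: real
  define lo where "lo \<eta> = (1 - \<eta>) ^ Suc d / ((1 + \<eta>) ^ d * (1 + \<eta>) powr p)" for \<eta> :: real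
  have "(up \<longlongrightarrow> (1 + 0) ^ Suc d / ((1 - 0) ^ d * (1 - 0) powr p)) (at_right 0)"
    unfolding up_def by (intro tendsto_intros) auto
  then have ev1: "eventually (\<lambda>\<eta>. up \<eta> < \<alpha>) (at_right 0)" using \<alpha> by (intro order_tendstoD(2)) auto
  have "(lo \<longlongrightarrow> (1 - 0) ^ Suc d / ((1 + 0) ^ d * (1 + 0) powr p)) (at_right 0)"
    unfolding lo_def by (intro tendsto_intros) auto
  then have ev2: "eventually (\<lambda>\<eta>. lo \<eta> > 1 / \<alpha>) (at_right 0)" using \<alpha> by (intro order_tendstoD(1)) auto
  have ev3: "eventually (\<lambda>\<eta>. \<eta> \<in> {0<..<1/2::real}) (at_right 0)" by (rule eventually_at_right_real) simp
  obtain \<eta> where \<eta>: "0 < \<eta>" "\<eta> < 1 / 2" "up \<eta> < \<alpha>" "lo \<eta> > 1 / \<alpha>"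
    using eventually_happens[OF eventually_conj[OF ev1 eventually_conj[OF ev2 ev3]]] by auto

  \<comment> \<open>The gradient of the p-norm at \<open>x\<close>. Euler's relation for homogeneous
    functions gives \<open>l x = 1\<close>; the gradient has length \<open>D\<close>, so the tangent
    hyperplane has distance 1 / D from the origin.\<close>
  define a where "a i = \<bar>x i\<bar> powr (p - 1) * sgn (x i)" for i
  define l where "l y = (\<Sum>i=1..n. a i * y i)" for y
  define D where "D = grad_norm p n x"
  have Fx: "p_sum p n x = 1" using x(1) p by (simp add: p_sphere_eq)
  have lx: "l x = 1"
  proof -
    have "l x = (\<Sum>i=1..n. \<bar>x i\<bar> powr p)"
      unfolding l_def
    proof (intro sum.cong refl)
      fix i assume "i \<in> {1..n}"
      then show "a i * x i = \<bar>x i\<bar> powr p" using x(2)[of i]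
        by (simp add: a_def mult.assoc powr_diff sgn_mult_self_eq abs_sgn[symmetric] mult.commute[of "sgn (x i)"])
    qed
    then show ?thesis using Fx by (simp add: p_sum_def)
  qed
  have a2: "(\<Sum>i=1..n. (a i)\<^sup>2) = D\<^sup>2"
  proof -
    have "(\<Sum>i=1..n. (a i)\<^sup>2) = (\<Sum>i=1..n. \<bar>x i\<bar> powr (2 * p - 2))"
    proof (intro sum.cong refl)
      fix i assume "i \<in> {1..n}"
      have "(\<bar>x i\<bar> powr (p - 1))\<^sup>2 = \<bar>x i\<bar> powr (2 * p - 2)"
        by (simp add: power2_eq_square powr_add[symmetric])
      then show "(a i)\<^sup>2 = \<bar>x i\<bar> powr (2 * p - 2)" using x(2)[OF \<open>i \<in> _\<close>]
        by (simp add: a_def power_mult_distrib sgn_if)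
    qed
    then show ?thesis by (simp add: D_def grad_norm_def sum_nonneg)
  qed
  have D: "D > 0"
  proof -
    have "n \<in> {1..n}" by (simp add: n_def)
    then have "0 < \<bar>x n\<bar> powr (2 * p - 2)" using x(2) by simp
    also have "\<dots> \<le> (\<Sum>i=1..n. \<bar>x i\<bar> powr (2 * p - 2))" using \<open>n \<in> _\<close> by (intro member_le_sum) auto
    finally show ?thesis by (simp add: D_def grad_norm_def)
  qed
  have l_scale: "l (scale_Rn n r y) = r * l y" for r y
    unfolding l_def sum_distrib_left by (intro sum.cong refl) (simp add: scale_Rn_def)
  have l_meas: "l \<in> borel_measurable ?V" unfolding l_def by measurable

  \<comment> \<open>Chosen so that 4 * \<epsilon> * n * n = \<eta> / 2: the 4 comes from taking
    reciprocals of values above 1/2, one \<open>n\<close> from summing over the coordinates, the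
    other from bounding the Euclidean length on the sphere.\<close>
  define \<epsilon> where "\<epsilon> = \<eta> / (8 * (real n)\<^sup>2)"
  have \<epsilon>: "\<epsilon> > 0" using \<eta> n0 by (simp add: \<epsilon>_def)
  have "\<exists>W. open W \<and> x i \<in> W \<and> (\<forall>s\<in>W. \<forall>t\<in>W.
      \<bar>(\<bar>s\<bar> powr p - \<bar>t\<bar> powr p) - p * a i * (s - t)\<bar> \<le> \<epsilon> * \<bar>s - t\<bar>)" if "i \<in> {1..n}" for i
    using abs_powr_strict_derivative[OF x(2)[OF that] p \<epsilon>] unfolding a_def by metis
  then obtain W where W: "\<And>i. i \<in> {1..n} \<Longrightarrow> open (W i)" "\<And>i. i \<in> {1..n} \<Longrightarrow> x i \<in> W i"
    "\<And>i s t. i \<in> {1..n} \<Longrightarrow> s \<in> W i \<Longrightarrow> t \<in> W i \<Longrightarrow>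
      \<bar>(\<bar>s\<bar> powr p - \<bar>t\<bar> powr p) - p * a i * (s - t)\<bar> \<le> \<epsilon> * \<bar>s - t\<bar>"
    by metis
  have l_tendsto: "(l \<longlongrightarrow> 1) (nhds x)"
  proof -
    have "((\<lambda>y. \<Sum>i=1..n. a i * y i) \<longlongrightarrow> (\<Sum>i=1..n. a i * x i)) (nhds x)"
      by (intro tendsto_sum tendsto_mult tendsto_const tendsto_coord)
    then show ?thesis using lx unfolding l_def by simp
  qed
  have g_tendsto: "(grad_norm p n \<longlongrightarrow> D) (nhds x)"
    unfolding grad_norm_def[abs_def] D_def grad_norm_def
    by (intro tendsto_intros tendsto_coord) (use x(2) in auto)
  have r_tendsto: "((\<lambda>y. D * l y powr (p - 1)) \<longlongrightarrow> D * 1 powr (p - 1)) (nhds x)"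
    by (intro tendsto_intros l_tendsto) auto
  \<comment> \<open>Since the p-norm is 1 on the sphere, the bounds on \<open>l y\<close> compare
    \<open>l\<close> with the p-norm. Those on \<open>grad_norm\<close> carry the power of
    \<open>l\<close> that makes them invariant along rays.\<close>
  have "eventually (\<lambda>y. (\<forall>i\<in>{1..n}. y i \<in> W i) \<and> l y > 1 / 2 \<and> \<bar>1 / l y - 1\<bar> < \<eta> / 2 \<and>
      (1 - \<eta>) * l y < 1 \<and> 1 < (1 + \<eta>) * l y \<and>
      (1 - \<eta>) * (D * l y powr (p - 1)) < grad_norm p n y \<and> grad_norm p n y < (1 + \<eta>) * (D * l y powr (p - 1))) (nhds x)"
  proof (intro eventually_conj)
    show "eventually (\<lambda>y. \<forall>i\<in>{1..n}. y i \<in> W i) (nhds x)"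
      using W(1,2) by (intro eventually_ball_finite ballI topological_tendstoD[OF tendsto_coord]) auto
    show "eventually (\<lambda>y. l y > 1 / 2) (nhds x)" using l_tendsto by (rule order_tendstoD) simp
    have "((\<lambda>y. \<bar>1 / l y - 1\<bar>) \<longlongrightarrow> \<bar>1 / 1 - 1\<bar>) (nhds x)" by (intro tendsto_intros l_tendsto) simp
    then show "eventually (\<lambda>y. \<bar>1 / l y - 1\<bar> < \<eta> / 2) (nhds x)" by (rule order_tendstoD(2)) (use \<eta> in simp)
    have "((\<lambda>y. (1 - \<eta>) * l y) \<longlongrightarrow> (1 - \<eta>) * 1) (nhds x)" by (intro tendsto_intros l_tendsto)
    then show "eventually (\<lambda>y. (1 - \<eta>) * l y < 1) (nhds x)" by (rule order_tendstoD(2)) (use \<eta> in simp)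
    have "((\<lambda>y. (1 + \<eta>) * l y) \<longlongrightarrow> (1 + \<eta>) * 1) (nhds x)" by (intro tendsto_intros l_tendsto)
    then show "eventually (\<lambda>y. 1 < (1 + \<eta>) * l y) (nhds x)" by (rule order_tendstoD(1)) (use \<eta> in simp)
    have "((\<lambda>y. grad_norm p n y - (1 - \<eta>) * (D * l y powr (p - 1))) \<longlongrightarrow> D - (1 - \<eta>) * (D * 1 powr (p - 1))) (nhds x)"
      by (intro tendsto_intros g_tendsto l_tendsto) auto
    then have "eventually (\<lambda>y. grad_norm p n y - (1 - \<eta>) * (D * l y powr (p - 1)) > 0) (nhds x)"
      by (rule order_tendstoD(1)) (use \<eta> D in \<open>simp add: algebra_simps\<close>)
    then show "eventually (\<lambda>y. (1 - \<eta>) * (D * l y powr (p - 1)) < grad_norm p n y) (nhds x)" by simp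
    have "((\<lambda>y. grad_norm p n y - (1 + \<eta>) * (D * l y powr (p - 1))) \<longlongrightarrow> D - (1 + \<eta>) * (D * 1 powr (p - 1))) (nhds x)"
      by (intro tendsto_intros g_tendsto l_tendsto) auto
    then have "eventually (\<lambda>y. grad_norm p n y - (1 + \<eta>) * (D * l y powr (p - 1)) < 0) (nhds x)"
      by (rule order_tendstoD(2)) (use \<eta> D in \<open>simp add: algebra_simps\<close>)
    then show "eventually (\<lambda>y. grad_norm p n y < (1 + \<eta>) * (D * l y powr (p - 1))) (nhds x)" by simp
  qed
  then obtain U where U: "open U" "x \<in> U" and
    UW: "\<And>y i. y \<in> U \<Longrightarrow> i \<in> {1..n} \<Longrightarrow> y i \<in> W i" and
    Ul: "\<And>y. y \<in> U \<Longrightarrow> l y > 1 / 2" "\<And>y. y \<in> U \<Longrightarrow> \<bar>1 / l y - 1\<bar> < \<eta> / 2"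
      "\<And>y. y \<in> U \<Longrightarrow> (1 - \<eta>) * l y < 1" "\<And>y. y \<in> U \<Longrightarrow> 1 < (1 + \<eta>) * l y" and
    Ug: "\<And>y. y \<in> U \<Longrightarrow> (1 - \<eta>) * (D * l y powr (p - 1)) < grad_norm p n y"
      "\<And>y. y \<in> U \<Longrightarrow> grad_norm p n y < (1 + \<eta>) * (D * l y powr (p - 1))"
    unfolding eventually_nhds by blast
  show ?thesis
  proof (rule that[OF U])
    fix A assume A: "A \<in> sets ?V" and AU: "A \<subseteq> U \<inter> ?S"
    have AR: "y \<in> Rn n" if "y \<in> A" for y using that A sets.sets_into_space by blast
    have NA: "?N y = 1" if "y \<in> A" for y using that AU by (auto simp: p_sphere_def)
    define \<pi> where "\<pi> y = scale_Rn n (1 / l y) y" for y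
    \<comment> \<open>The projection of \<open>A\<close> to the tangent hyperplane, written as a
      preimage so that it is visibly measurable; \<open>C_eq\<close> identifies it with the
      image.\<close>
    define C where "C = {z \<in> Rn n. l z = 1 \<and> scale_Rn n (1 / ?N z) z \<in> A}"
    have C_sets: "C \<in> sets ?V"
    proof -
      have "(\<lambda>y. scale_Rn n (1 / ?N y) y) \<in> measurable ?V ?V" by (intro measurable_scale_Rn) measurable
      from measurable_sets[OF this A]
      have "{y \<in> Rn n. scale_Rn n (1 / ?N y) y \<in> A} \<in> sets ?V" by (simp add: vimage_def Int_def conj_commute)
      moreover have "{y \<in> Rn n. l y = 1} \<in> sets ?V" using l_meas by measurable
      ultimately show ?thesis unfolding C_def by (intro sets.sets_Collect_conj)
    qed
    have lA: "l y > 1 / 2" if "y \<in> A" for y using that AU Ul by blast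
    have proj_inv: "scale_Rn n (1 / ?N (\<pi> y)) (\<pi> y) = y" if "y \<in> A" for y
      using lA[OF that] NA[OF that] p AR[OF that]
      by (simp add: \<pi>_def p_norm_scale scale_Rn_scale_Rn scale_Rn_one)
    have C_eq: "C = \<pi> ` A"
    proof (intro equalityI subsetI)
      fix z assume z: "z \<in> C"
      define y where "y = scale_Rn n (1 / ?N z) z"
      have y: "y \<in> A" using z by (simp add: C_def y_def)
      have ly: "l y = 1 / ?N z" using z by (simp add: y_def l_scale C_def)
      then have "?N z \<noteq> 0" using lA[OF y] by auto
      then have "\<pi> y = z" using ly z by (simp add: \<pi>_def y_def scale_Rn_scale_Rn scale_Rn_one C_def)
      then show "z \<in> \<pi> ` A" using y by blast
    next
      fix z assume "z \<in> \<pi> ` A"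
      then obtain y where y: "y \<in> A" "z = \<pi> y" by blast
      have "l z = 1" using y lA[OF y(1)] by (simp add: \<pi>_def l_scale)
      then show "z \<in> C" unfolding C_def using y proj_inv[OF y(1)] by (simp add: \<pi>_def)
    qed
    have bilip: "\<bar>edist n (\<pi> y) (\<pi> z) - edist n y z\<bar> \<le> \<eta> * edist n y z" if yz: "y \<in> A" "z \<in> A" for y z
    proof -
      have "\<bar>l y - l z\<bar> \<le> \<epsilon> * (real n * edist n y z)"
      proof -
        have "y \<in> ?S" "z \<in> ?S" using yz AU by auto
        \<comment> \<open>Both points lie on the sphere, so the increments of |y i|^p cancel in
          total, and p * (l y - l z) is minus the sum of the linearisation errors.\<close>
        then have "p_sum p n y - p_sum p n z = 0" using p by (simp add: p_sphere_eq)
        moreover have "p * (l y - l z) = (\<Sum>i=1..n. p * a i * (y i - z i))"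
          unfolding l_def sum_subtractf[symmetric] sum_distrib_left
          by (intro sum.cong refl) (simp add: algebra_simps)
        ultimately have pl: "p * (l y - l z) = - (\<Sum>i=1..n. (\<bar>y i\<bar> powr p - \<bar>z i\<bar> powr p) - p * a i * (y i - z i))"
          unfolding sum_subtractf p_sum_def by linarith
        have "p * \<bar>l y - l z\<bar> = \<bar>p * (l y - l z)\<bar>" using p by (simp add: abs_mult)
        also have "\<dots> = \<bar>\<Sum>i=1..n. (\<bar>y i\<bar> powr p - \<bar>z i\<bar> powr p) - p * a i * (y i - z i)\<bar>"
          unfolding pl abs_minus_cancel ..
        also have "\<dots> \<le> (\<Sum>i=1..n. \<bar>(\<bar>y i\<bar> powr p - \<bar>z i\<bar> powr p) - p * a i * (y i - z i)\<bar>)" by (rule sum_abs)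
        also have "\<dots> \<le> (\<Sum>i=1..n. \<epsilon> * edist n y z)"
        proof (rule sum_mono)
          fix i assume i: "i \<in> {1..n}"
          have "\<bar>(\<bar>y i\<bar> powr p - \<bar>z i\<bar> powr p) - p * a i * (y i - z i)\<bar> \<le> \<epsilon> * \<bar>y i - z i\<bar>"
            using yz AU i by (intro W(3) UW) auto
          also have "\<dots> \<le> \<epsilon> * edist n y z" using abs_coord_le_edist[OF i] \<epsilon> by (intro mult_left_mono) auto
          finally show "\<bar>(\<bar>y i\<bar> powr p - \<bar>z i\<bar> powr p) - p * a i * (y i - z i)\<bar> \<le> \<epsilon> * edist n y z" .
        qed
        finally have "p * \<bar>l y - l z\<bar> \<le> \<epsilon> * (real n * edist n y z)" by (simp add: mult_ac)
        moreover have "\<bar>l y - l z\<bar> \<le> p * \<bar>l y - l z\<bar>" using p by (simp add: mult_le_cancel_right1)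
        ultimately show ?thesis by linarith
      qed
      moreover have "\<bar>1 / l y - 1 / l z\<bar> \<le> 4 * \<bar>l y - l z\<bar>"
      proof -
        have ly: "l y > 1/2" "l z > 1/2" using lA yz by auto
        then have "1 / 2 * (1 / 2) \<le> l y * l z" by (intro mult_mono) auto
        moreover have "\<bar>1 / l y - 1 / l z\<bar> = \<bar>l y - l z\<bar> / (l y * l z)"
          using ly by (simp add: field_simps abs_if)
        moreover have "\<bar>l y - l z\<bar> / (l y * l z) \<le> \<bar>l y - l z\<bar> / (1 / 2 * (1 / 2))"
          using ly calculation(1) by (intro divide_left_mono) auto
        ultimately show ?thesis by simp
      qed
      moreover have "L2_set z {1..n} \<le> real n"
      proof -
        have "\<bar>z i\<bar> \<le> 1" if "i \<in> {1..n}" for i using p_sphere_abs_le_1[of p z n i] that yz AU p by auto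
        then show ?thesis using L2_set_le_card[of n z 1] by simp
      qed
      ultimately have "\<bar>1 / l y - 1 / l z\<bar> * L2_set z {1..n} \<le> (4 * (\<epsilon> * (real n * edist n y z))) * real n"
        by (intro mult_mono) auto
      also have "\<dots> = \<eta> / 2 * edist n y z" using n0 by (simp add: \<epsilon>_def power2_eq_square)
      finally have t2: "\<bar>1 / l y - 1 / l z\<bar> * L2_set z {1..n} \<le> \<eta> / 2 * edist n y z" .
      have "\<bar>1 / l y - 1\<bar> * edist n y z \<le> \<eta> / 2 * edist n y z"
        using Ul(2)[of y] yz AU by (intro mult_right_mono) (auto intro: less_imp_le)
      with t2 edist_scale_diff[of n "1 / l y" y "1 / l z" z] show ?thesis
        unfolding \<pi>_def by (simp add: algebra_simps)
    qed
    have HC_le: "hausdorff_measure n d C \<le> ennreal ((1 + \<eta>) ^ d) * hausdorff_measure n d A"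
    proof -
      have "hausdorff_measure n d (\<pi> ` A) \<le> ennreal (1 + \<eta>) ^ d * hausdorff_measure n d A"
      proof (rule hausdorff_measure_lipschitz_image)
        fix y z assume "y \<in> A" "z \<in> A"
        from bilip[OF this] show "edist n (\<pi> y) (\<pi> z) \<le> (1 + \<eta>) * edist n y z" by (simp add: algebra_simps)
      qed (use \<eta> in \<open>auto simp: \<pi>_def\<close>)
      moreover have "ennreal (1 + \<eta>) ^ d = ennreal ((1 + \<eta>) ^ d)" using \<eta> by (intro ennreal_power) simp
      ultimately show ?thesis by (simp only: C_eq)
    qed
    have HA_le: "ennreal ((1 - \<eta>) ^ d) * hausdorff_measure n d A \<le> hausdorff_measure n d C"
    proof -
      have "hausdorff_measure n d ((\<lambda>z. scale_Rn n (1 / ?N z) z) ` C) \<le> ennreal (1 / (1 - \<eta>)) ^ d * hausdorff_measure n d C"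
      proof (rule hausdorff_measure_lipschitz_image)
        fix y z assume "y \<in> C" "z \<in> C"
        then obtain y' z' where *: "y' \<in> A" "z' \<in> A" "y = \<pi> y'" "z = \<pi> z'" by (auto simp: C_eq)
        have "(1 - \<eta>) * edist n y' z' \<le> edist n y z" using bilip[OF *(1,2)] * by (simp add: algebra_simps)
        then show "edist n (scale_Rn n (1 / ?N y) y) (scale_Rn n (1 / ?N z) z) \<le> 1 / (1 - \<eta>) * edist n y z"
          using \<eta> by (simp add: * proj_inv field_simps)
      qed (use \<eta> in auto)
      also have "(\<lambda>z. scale_Rn n (1 / ?N z) z) ` C = A"
        unfolding C_eq image_image using proj_inv by simp
      finally have "ennreal ((1 - \<eta>) ^ d) * hausdorff_measure n d A
          \<le> ennreal ((1 - \<eta>) ^ d) * (ennreal (1 / (1 - \<eta>)) ^ d * hausdorff_measure n d C)"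
        by (intro mult_left_mono) auto
      also have "\<dots> = ennreal ((1 - \<eta>) ^ d * (1 / (1 - \<eta>)) ^ d) * hausdorff_measure n d C"
        using \<eta> by (simp add: ennreal_power ennreal_mult mult.assoc)
      also have "(1 - \<eta>) ^ d * (1 / (1 - \<eta>)) ^ d = 1" using \<eta> by (simp add: power_mult_distrib[symmetric])
      finally show ?thesis by simp
    qed
    have K_iff: "y \<in> radial_set p n A \<longleftrightarrow> l y > 0 \<and> scale_Rn n (1 / l y) y \<in> C" if y: "y \<in> Rn n" for y
    proof
      assume "y \<in> radial_set p n A"
      then have N: "?N y > 0" and *: "scale_Rn n (1 / ?N y) y \<in> A" by (auto simp: radial_set_def)
      have "l (scale_Rn n (1 / ?N y) y) = l y / ?N y" by (simp add: l_scale)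
      with lA[OF *] have "l y / ?N y > 0" by linarith
      with N have ly: "l y > 0" by (simp add: zero_less_divide_iff)
      have "\<pi> (scale_Rn n (1 / ?N y) y) = scale_Rn n (1 / l y) y"
        using N ly by (simp add: \<pi>_def l_scale scale_Rn_scale_Rn)
      with ly * show "l y > 0 \<and> scale_Rn n (1 / l y) y \<in> C" unfolding C_eq by (metis image_eqI)
    next
      assume *: "l y > 0 \<and> scale_Rn n (1 / l y) y \<in> C"
      then have "scale_Rn n (1 / ?N (scale_Rn n (1 / l y) y)) (scale_Rn n (1 / l y) y) \<in> A" by (simp add: C_def)
      moreover have N: "?N (scale_Rn n (1 / l y) y) = ?N y / l y" using * p by (simp add: p_norm_scale)
      moreover have "?N y > 0"
      proof (rule ccontr)
        assume "\<not> ?N y > 0"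
        then have "?N y = 0" using p_norm_nonneg[of p n y] by linarith
        then have "?N (scale_Rn n (1 / ?N (scale_Rn n (1 / l y) y)) (scale_Rn n (1 / l y) y)) = 0"
          using p by (simp add: p_norm_scale)
        with NA[OF calculation(1)] show False by simp
      qed
      ultimately show "y \<in> radial_set p n A" using * y by (simp add: radial_set_def scale_Rn_scale_Rn)
    qed
    define \<Phi> where "\<Phi> c = (\<integral>\<^sup>+y. (if l y > 0 \<and> scale_Rn n (1 / l y) y \<in> C then radial_profile p c (l y) else 0) \<partial>?V)" for c
    have flat: "?\<kappa> * (ennreal D * \<Phi> c) = hausdorff_measure n d C * radial_const p d c" for c
    proof -
      \<comment> \<open>The hyperplane has unit normal a / D and distance 1 / D from the origin; the
        factor \<open>D\<close> of the weight cancels this distance.\<close>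
      have l': "(\<Sum>i=1..Suc d. (a i / D) * y i) / (1 / D) = l y" for y
        using D by (simp add: l_def n_def sum_divide_distrib[symmetric] divide_simps) 
      have nu: "(\<Sum>i=1..Suc d. (a i / D)\<^sup>2) = 1"
        using a2 D by (simp add: power_divide sum_divide_distrib[symmetric] n_def)
      have "(\<Sum>i=1..Suc d. (a i / D) * y i) = 1 / D" if "y \<in> C" for y
      proof -
        have "s / (1 / D) = 1 \<Longrightarrow> s = 1 / D" for s using D by (simp add: field_simps)
        moreover have "l y = 1" using that by (simp add: C_def)
        ultimately show ?thesis using l'[of y] by metis
      qed
      from hausdorff_measure_flat[OF nu _ C_sets[unfolded n_def] this measurable_radial_profile[of p c], unfolded l', folded n_def]
      have "?\<kappa> * \<Phi> c = hausdorff_measure n d C * (ennreal (1 / D) * radial_const p d c)"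
        using D by (simp add: \<Phi>_def radial_const_def)
      then have "ennreal D * (?\<kappa> * \<Phi> c) = (ennreal D * ennreal (1 / D)) * (hausdorff_measure n d C * radial_const p d c)"
        by (simp add: ac_simps)
      also have "ennreal D * ennreal (1 / D) = 1" using D by (simp add: ennreal_mult[symmetric])
      finally show ?thesis by (simp add: ac_simps)
    qed
    \<comment> \<open>The ratio of the p-norm to \<open>l\<close>, and that of
      \<open>grad_norm\<close> to the matching power of \<open>l\<close>, are constant on rays, so
      the bounds at the point \<open>y0\<close> of \<open>A\<close> hold on the whole cone.\<close>
    have K_bounds: "ennreal ((1 - \<eta>) * D) * radial_profile p (1 + \<eta>) (l y) \<le> surface_weight p n y \<and>
        surface_weight p n y \<le> ennreal ((1 + \<eta>) * D) * radial_profile p (1 - \<eta>) (l y)"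
      if "y \<in> radial_set p n A" for y
    proof -
      have y: "y \<in> Rn n" and N: "?N y > 0" and *: "scale_Rn n (1 / ?N y) y \<in> A" using that by (auto simp: radial_set_def)
      define y0 where "y0 = scale_Rn n (1 / ?N y) y"
      have y0: "y0 \<in> A" "y0 \<in> U" using * AU by (auto simp: y0_def)
      have yy: "y = scale_Rn n (?N y) y0" using N y by (simp add: y0_def scale_Rn_scale_Rn scale_Rn_one)
      have ly: "l y = ?N y * l y0" by (subst yy) (simp add: l_scale)
      have ly0: "l y0 > 0" using lA[OF y0(1)] by simp
      have lpos: "l y > 0" using ly ly0 N by simp
      have N1: "(1 - \<eta>) * l y \<le> ?N y"
        using Ul(3)[OF y0(2)] N by (simp add: ly mult.left_commute)
      have N2: "?N y \<le> (1 + \<eta>) * l y"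
        using Ul(4)[OF y0(2)] N by (simp add: ly mult.left_commute)
      have g: "grad_norm p n y = ?N y powr (p - 1) * grad_norm p n y0"
        using N by (subst yy) (simp add: grad_norm_scale)
      have lp: "l y powr (p - 1) = ?N y powr (p - 1) * l y0 powr (p - 1)"
        using N ly0 by (simp add: ly powr_mult)
      have g1: "(1 - \<eta>) * D * l y powr (p - 1) \<le> grad_norm p n y"
        using mult_left_mono[OF less_imp_le[OF Ug(1)[OF y0(2)]], of "?N y powr (p - 1)"] by (simp add: g lp mult_ac)
      have g2: "grad_norm p n y \<le> (1 + \<eta>) * D * l y powr (p - 1)"
        using mult_left_mono[OF less_imp_le[OF Ug(2)[OF y0(2)]], of "?N y powr (p - 1)"] by (simp add: g lp mult_ac)
      have F: "p_sum p n y = ?N y powr p" using p by (simp add: p_norm_powr)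
      have e1: "exp (- (((1 + \<eta>) * l y) powr p)) \<le> exp (- p_sum p n y)"
        unfolding F using N2 p by (simp add: powr_mono2)
      have e2: "exp (- p_sum p n y) \<le> exp (- (((1 - \<eta>) * l y) powr p))"
        unfolding F using N1 p \<eta> lpos by (simp add: powr_mono2)
      have "(1 - \<eta>) * D * l y powr (p - 1) * exp (- (((1 + \<eta>) * l y) powr p)) \<le> grad_norm p n y * exp (- p_sum p n y)"
        using g1 e1 D \<eta> by (intro mult_mono) (auto simp: grad_norm_def intro!: sum_nonneg)
      moreover have "grad_norm p n y * exp (- p_sum p n y) \<le> (1 + \<eta>) * D * l y powr (p - 1) * exp (- (((1 - \<eta>) * l y) powr p))"
        using g2 e2 D \<eta> by (intro mult_mono) (auto simp: grad_norm_def intro!: sum_nonneg)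
      ultimately show ?thesis unfolding surface_weight_def radial_profile_def using D \<eta>
        by (auto simp: ennreal_mult[symmetric] mult.assoc intro!: ennreal_leI)
    qed
    have prof_meas: "(\<lambda>y. if l y > 0 \<and> scale_Rn n (1 / l y) y \<in> C then radial_profile p c (l y) else 0) \<in> borel_measurable ?V" for c
    proof -
      have "(\<lambda>y. scale_Rn n (1 / l y) y) \<in> measurable ?V ?V" by (intro measurable_scale_Rn) (use l_meas in measurable)
      from measurable_sets[OF this C_sets]
      have "{y \<in> Rn n. scale_Rn n (1 / l y) y \<in> C} \<in> sets ?V" by (simp add: vimage_def Int_def conj_commute)
      moreover have "{y \<in> Rn n. l y > 0} \<in> sets ?V" using l_meas by measurable
      ultimately show ?thesis
        using l_meas by (intro measurable_If sets.sets_Collect_conj measurable_compose[OF l_meas measurable_radial_profile]) auto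
    qed
    have up1: "radial_surface p n A \<le> ennreal ((1 + \<eta>) * D) * \<Phi> (1 - \<eta>)"
      unfolding radial_surface_def \<Phi>_def
      by (subst nn_integral_cmult[symmetric, OF prof_meas], rule nn_integral_mono)
        (use K_bounds K_iff in \<open>auto simp: indicator_def\<close>)
    have lo1: "ennreal ((1 - \<eta>) * D) * \<Phi> (1 + \<eta>) \<le> radial_surface p n A"
      unfolding radial_surface_def \<Phi>_def
      by (subst nn_integral_cmult[symmetric, OF prof_meas], rule nn_integral_mono)
        (use K_bounds K_iff in \<open>auto simp: indicator_def\<close>)
    have Jc: "radial_const p d c = ennreal (1 / (c ^ d * c powr p)) * ?J" if "c > 0" for c
    proof -
      have "ennreal (1 / (c ^ d * c powr p)) * ?J = (ennreal (1 / (c ^ d * c powr p)) * ennreal (c ^ d * c powr p)) * radial_const p d c"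
        unfolding radial_const_scale[OF that, of d p, symmetric] by (simp add: mult.assoc)
      also have "ennreal (1 / (c ^ d * c powr p)) * ennreal (c ^ d * c powr p) = 1"
        using that by (subst ennreal_mult[symmetric]) auto
      finally show ?thesis by simp
    qed
    have U1: "?\<kappa> * radial_surface p n A \<le> ennreal (up \<eta>) * (?J * hausdorff_measure n d A)"
    proof -
      have "?\<kappa> * radial_surface p n A \<le> ?\<kappa> * (ennreal ((1 + \<eta>) * D) * \<Phi> (1 - \<eta>))"
        by (intro mult_left_mono up1) auto
      also have "\<dots> = ennreal (1 + \<eta>) * (?\<kappa> * (ennreal D * \<Phi> (1 - \<eta>)))"
        using \<eta> D ennreal_mult[of "1 + \<eta>" D] by (simp only: ac_simps)
      also have "\<dots> = ennreal (1 + \<eta>) * (hausdorff_measure n d C * (ennreal (1 / ((1 - \<eta>) ^ d * (1 - \<eta>) powr p)) * ?J))"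
        unfolding flat using \<eta> by (subst Jc) auto
      also have "\<dots> \<le> ennreal (1 + \<eta>) * ((ennreal ((1 + \<eta>) ^ d) * hausdorff_measure n d A) * (ennreal (1 / ((1 - \<eta>) ^ d * (1 - \<eta>) powr p)) * ?J))"
        by (intro mult_left_mono mult_right_mono HC_le) auto
      also have "\<dots> = (ennreal (1 + \<eta>) * ennreal ((1 + \<eta>) ^ d) * ennreal (1 / ((1 - \<eta>) ^ d * (1 - \<eta>) powr p))) * (?J * hausdorff_measure n d A)"
        by (simp add: ac_simps)
      also have "ennreal (1 + \<eta>) * ennreal ((1 + \<eta>) ^ d) * ennreal (1 / ((1 - \<eta>) ^ d * (1 - \<eta>) powr p)) = ennreal (up \<eta>)"
        using \<eta> by (simp add: up_def ennreal_mult[symmetric] del: ennreal_plus)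
      finally show ?thesis .
    qed
    have L1: "ennreal (lo \<eta>) * (?J * hausdorff_measure n d A) \<le> ?\<kappa> * radial_surface p n A"
    proof -
      have "ennreal (lo \<eta>) = ennreal (1 - \<eta>) * ennreal ((1 - \<eta>) ^ d) * ennreal (1 / ((1 + \<eta>) ^ d * (1 + \<eta>) powr p))"
        using \<eta> by (simp add: lo_def ennreal_mult[symmetric])
      then have "ennreal (lo \<eta>) * (?J * hausdorff_measure n d A) = ennreal (1 - \<eta>) * ((ennreal ((1 - \<eta>) ^ d) * hausdorff_measure n d A) * (ennreal (1 / ((1 + \<eta>) ^ d * (1 + \<eta>) powr p)) * ?J))"
        by (simp add: ac_simps)
      also have "\<dots> \<le> ennreal (1 - \<eta>) * (hausdorff_measure n d C * (ennreal (1 / ((1 + \<eta>) ^ d * (1 + \<eta>) powr p)) * ?J))"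
        by (intro mult_left_mono mult_right_mono HA_le) auto
      also have "\<dots> = ennreal (1 - \<eta>) * (?\<kappa> * (ennreal D * \<Phi> (1 + \<eta>)))"
        unfolding flat using \<eta> by (subst Jc) auto
      also have "\<dots> = ?\<kappa> * (ennreal ((1 - \<eta>) * D) * \<Phi> (1 + \<eta>))"
        using \<eta> D by (simp add: ennreal_mult ac_simps)
      also have "\<dots> \<le> ?\<kappa> * radial_surface p n A" by (intro mult_left_mono lo1) auto
      finally show ?thesis .
    qed
    have "?J * hausdorff_measure n d A \<le> ennreal \<alpha> * (?\<kappa> * radial_surface p n A)"
    proof -
      have "1 \<le> \<alpha> * lo \<eta>" using \<eta>(4) \<alpha> by (simp add: field_simps)
      then have "ennreal 1 \<le> ennreal (\<alpha> * lo \<eta>)" by (rule ennreal_leI)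
      then have "ennreal 1 * (?J * hausdorff_measure n d A) \<le> ennreal (\<alpha> * lo \<eta>) * (?J * hausdorff_measure n d A)"
        by (rule mult_right_mono) auto
      also have "\<dots> = ennreal \<alpha> * (ennreal (lo \<eta>) * (?J * hausdorff_measure n d A))"
        using \<alpha> by (simp add: ennreal_mult' mult.assoc)
      also have "\<dots> \<le> ennreal \<alpha> * (?\<kappa> * radial_surface p n A)" by (intro mult_left_mono L1) auto
      finally show ?thesis by simp
    qed
    moreover have "?\<kappa> * radial_surface p n A \<le> ennreal \<alpha> * (?J * hausdorff_measure n d A)"
      by (rule order_trans[OF U1]) (use \<eta> in \<open>auto intro!: mult_right_mono ennreal_leI\<close>)
    ultimately show "?J * hausdorff_measure n d A \<le> ennreal \<alpha> * (?\<kappa> * radial_surface p n A) \<and>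
        ?\<kappa> * radial_surface p n A \<le> ennreal \<alpha> * (?J * hausdorff_measure n d A)" ..
  qed
qed

section \<open>Surface measure and radial projection\<close>

lemma coord_hyperplane_null:
  assumes "i \<in> {1..n}"
  shows "{y \<in> Rn n. y i = c} \<in> null_sets (lborel_Rn n)"
proof -
  have "{y \<in> Rn n. y i = c} = Pi\<^sub>E {1..n} (\<lambda>j. if j = i then {c} else UNIV)"
    using assms unfolding space_lborel_Rn by (auto simp: PiE_iff extensional_def split: if_splits)
  moreover have "emeasure (lborel_Rn n) (Pi\<^sub>E {1..n} (\<lambda>j. if j = i then {c} else UNIV)) = 0"
    unfolding lborel_Rn_def using assms
    by (subst lborel_product.emeasure_PiM) (auto intro!: prod_zero bexI[of _ i])
  moreover have "Pi\<^sub>E {1..n} (\<lambda>j. if j = i then {c} else UNIV) \<in> sets (lborel_Rn n)"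
    unfolding lborel_Rn_def by (intro sets_PiM_I_finite) auto
  ultimately show ?thesis by (simp add: null_sets_def)
qed

lemma AE_coord_nonzero: "AE y in lborel_Rn n. \<forall>i\<in>{1..n}. y i \<noteq> 0"
proof (rule AE_finite_allI)
  fix i assume "i \<in> {1..n}"
  then show "AE y in lborel_Rn n. y i \<noteq> 0"
    by (intro AE_I'[OF coord_hyperplane_null[of i n 0]]) auto
qed simp

text \<open>The derivative p * z^(p-1) is at most \<open>p\<close> on the unit interval. The mean
  value theorem evaluates it at interior points only, which avoids 0.\<close>

lemma abs_powr_lipschitz:
  fixes s t p :: real
  assumes p: "1 \<le> p" and st: "\<bar>s\<bar> \<le> 1" "\<bar>t\<bar> \<le> 1"
  shows "\<bar>\<bar>s\<bar> powr p - \<bar>t\<bar> powr p\<bar> \<le> p * \<bar>s - t\<bar>"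
proof -
  have *: "u powr p - v powr p \<le> p * (u - v)" "v powr p \<le> u powr p" if "0 \<le> v" "v \<le> u" "u \<le> 1" for u v :: real
  proof -
    show "v powr p \<le> u powr p" using that p by (intro powr_mono2) auto
    show "u powr p - v powr p \<le> p * (u - v)"
    proof (cases "v = u")
      case False
      then have "v < u" using that by simp
      have der: "((\<lambda>z. z powr p) has_real_derivative p * z powr (p - 1)) (at z)" if "v < z" for z
        using that \<open>0 \<le> v\<close> by (auto intro!: derivative_eq_intros)
      have "continuous_on {v..u} (\<lambda>z. z powr p)"
        using that p by (intro continuous_on_powr' continuous_intros) auto
      moreover have "(\<lambda>z. z powr p) differentiable (at z)" if "v < z" for z
        using der[OF that] by (auto simp: real_differentiable_def)
      ultimately obtain l z where z: "v < z" "z < u" and l: "DERIV (\<lambda>z. z powr p) z :> l"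
        and "u powr p - v powr p = (u - v) * l"
        using MVT[OF \<open>v < u\<close>] by blast
      then have eq: "u powr p - v powr p = (u - v) * (p * z powr (p - 1))"
        using DERIV_unique[OF l der[OF z(1)]] by simp
      have "z powr (p - 1) \<le> 1" using z that p by (intro powr_le1) auto
      then have "p * z powr (p - 1) \<le> p" using p by (simp add: mult_le_cancel_left1)
      then have "(u - v) * (p * z powr (p - 1)) \<le> (u - v) * p" using \<open>v < u\<close> by (intro mult_left_mono) auto
      then show ?thesis using eq by (simp add: mult.commute)
    qed simp
  qed
  show ?thesis
  proof (cases "\<bar>t\<bar> \<le> \<bar>s\<bar>")
    case True
    have "\<bar>\<bar>s\<bar> powr p - \<bar>t\<bar> powr p\<bar> \<le> p * (\<bar>s\<bar> - \<bar>t\<bar>)" using *[OF _ True] st by auto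
    also have "\<dots> \<le> p * \<bar>s - t\<bar>" using p by (intro mult_left_mono) auto
    finally show ?thesis .
  next
    case False
    then have "\<bar>\<bar>s\<bar> powr p - \<bar>t\<bar> powr p\<bar> \<le> p * (\<bar>t\<bar> - \<bar>s\<bar>)" using *[of "\<bar>s\<bar>" "\<bar>t\<bar>"] st by auto
    also have "\<dots> \<le> p * \<bar>s - t\<bar>" using p by (intro mult_left_mono) auto
    finally show ?thesis .
  qed
qed

lemma root_powr_lipschitz:
  fixes u v r :: real
  assumes "1 \<le> u" "1 \<le> v" "0 \<le> r" "r \<le> 1"
  shows "\<bar>u powr r - v powr r\<bar> \<le> \<bar>u - v\<bar>"
proof -
  have "norm (u powr r - v powr r) \<le> 1 * norm (u - v)"
  proof (rule field_differentiable_bound[where S = "{1..}" and f' = "\<lambda>z. r * z powr (r - 1)"])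
    fix z :: real assume z: "z \<in> {1..}"
    then show "((\<lambda>z. z powr r) has_field_derivative r * z powr (r - 1)) (at z within {1..})"
      by (auto intro!: derivative_eq_intros)
    have "z powr (r - 1) \<le> z powr 0" using z assms by (intro powr_mono) auto
    then have "r * z powr (r - 1) \<le> 1 * 1" using z assms by (intro mult_mono) auto
    then show "norm (r * z powr (r - 1)) \<le> 1" using z assms by simp
  qed (use assms in auto)
  then show ?thesis by simp
qed

text \<open>
  The points of the sphere with a vanishing coordinate, where the \<open>p\<close>-norm need not be smooth, lie in
  the radial projections of these null subsets of the faces of the cube.
\<close>

definition cube_edge :: "nat \<Rightarrow> nat \<Rightarrow> nat \<Rightarrow> real \<Rightarrow> (nat \<Rightarrow> real) set" where
  "cube_edge n i j \<sigma> = {y \<in> Rn n. y i = 0 \<and> y j = \<sigma> \<and> (\<forall>k\<in>{1..n}. \<bar>y k\<bar> \<le> 1)}"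

text \<open>This piece of the hyperplane \<open>y j = \<sigma>\<close> spans a cone inside
  \<open>y i = 0\<close>, which is Lebesgue null; by the slicing formula the piece itself is
  null.\<close>

lemma hausdorff_measure_cube_edge:
  assumes ij: "i \<in> {1..Suc d}" "j \<in> {1..Suc d}" "i \<noteq> j" and \<sigma>: "\<sigma>\<^sup>2 = 1"
  shows "hausdorff_measure (Suc d) d (cube_edge (Suc d) i j \<sigma>) = 0"
proof -
  let ?C = "cube_edge (Suc d) i j \<sigma>" and ?V = "lborel_Rn (Suc d)"
  define \<nu> where "\<nu> k = (if k = j then \<sigma> else 0)" for k
  \<comment> \<open>A profile with positive radial integral: on this interval s^d is at least
    1.\<close>
  define \<phi> where "\<phi> = (indicator {1<..<2::real} :: real \<Rightarrow> ennreal)"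
  have C: "?C \<in> sets ?V"
  proof -
    have "{y \<in> space ?V. y i = 0} \<in> sets ?V" "{y \<in> space ?V. y j = \<sigma>} \<in> sets ?V"
      using coord_hyperplane_null ij by blast+
    moreover have "{y \<in> space ?V. \<forall>k\<in>{1..Suc d}. \<bar>y k\<bar> \<le> 1} \<in> sets ?V"
      by (rule sets.sets_Collect_finite_All) measurable
    ultimately show ?thesis unfolding cube_edge_def by (intro sets.sets_Collect_conj)
  qed
  have \<nu>1: "(\<Sum>k=1..Suc d. (\<nu> k)\<^sup>2) = 1"
    using ij(2) \<sigma> by (simp add: \<nu>_def if_distrib[of "\<lambda>x. x\<^sup>2"] cong: if_cong del: sum.cl_ivl_Suc)
  have \<nu>y: "(\<Sum>k=1..Suc d. \<nu> k * y k) = \<sigma> * y j" for y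
    using ij(2) by (simp add: \<nu>_def if_distrib[of "\<lambda>x. x * _"] cong: if_cong del: sum.cl_ivl_Suc)
  have 0: "hausdorff_measure d d (unit_cube d) *
      (\<integral>\<^sup>+y. (if \<sigma> * y j / 1 > 0 \<and> scale_Rn (Suc d) (1 / (\<sigma> * y j / 1)) y \<in> ?C then \<phi> (\<sigma> * y j / 1) else 0) \<partial>?V)
    = hausdorff_measure (Suc d) d ?C * (ennreal 1 * (\<integral>\<^sup>+s. ennreal (s ^ d) * \<phi> s * indicator {0<..} s \<partial>lborel))"
    by (rule hausdorff_measure_flat[OF \<nu>1 _ C, where h = 1, unfolded \<nu>y])
      (use \<sigma> in \<open>auto simp: cube_edge_def \<phi>_def power2_eq_square\<close>)
  have "(\<integral>\<^sup>+y. (if \<sigma> * y j / 1 > 0 \<and> scale_Rn (Suc d) (1 / (\<sigma> * y j / 1)) y \<in> ?C then \<phi> (\<sigma> * y j / 1) else 0) \<partial>?V) = (\<integral>\<^sup>+y. 0 \<partial>?V)"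
  proof (rule nn_integral_cong_AE, rule AE_mp[OF AE_coord_nonzero AE_I2], intro impI)
    fix y :: "nat \<Rightarrow> real" assume "\<forall>i\<in>{1..Suc d}. y i \<noteq> 0"
    then have "y i \<noteq> 0" using ij by blast
    then have "scale_Rn (Suc d) r y \<notin> ?C" if "r > 0" for r
      using that ij scale_Rn_apply[of i "Suc d" r y] by (auto simp: cube_edge_def)
    then show "(if \<sigma> * y j / 1 > 0 \<and> scale_Rn (Suc d) (1 / (\<sigma> * y j / 1)) y \<in> ?C then \<phi> (\<sigma> * y j / 1) else 0) = 0"
      by auto
  qed
  with 0 have "hausdorff_measure (Suc d) d ?C * (\<integral>\<^sup>+s. ennreal (s ^ d) * \<phi> s * indicator {0<..} s \<partial>lborel) = 0"
    by simp
  moreover have "(\<integral>\<^sup>+s. ennreal (s ^ d) * \<phi> s * indicator {0<..} s \<partial>lborel) \<ge> (\<integral>\<^sup>+s. indicator {1<..<2::real} s \<partial>lborel)"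
    by (rule nn_integral_mono) (auto simp: \<phi>_def indicator_def)
  ultimately show ?thesis by auto
qed

text \<open>Null sets stay null under Lipschitz maps, and radial projection to the sphere is
  Lipschitz on the faces of the cube, because there the p-norm is at least 1 and itself
  Lipschitz.\<close>

lemma hausdorff_measure_coord_sphere:
  fixes p :: real and d :: nat
  defines "n \<equiv> Suc d"
  assumes p: "1 \<le> p"
  shows "hausdorff_measure n d {x \<in> p_sphere p n. \<exists>i\<in>{1..n}. x i = 0} = 0"
proof -
  let ?N = "p_norm p n" and ?H = "hausdorff_measure n d"
  define g where "g y = scale_Rn n (1 / ?N y) y" for y
  define K where "K = {(i, j, \<sigma>). i \<in> {1..n} \<and> j \<in> {1..n} \<and> i \<noteq> j \<and> \<sigma> \<in> {-1, 1::real}}"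
  have finK: "finite K"
    by (rule finite_subset[of _ "{1..n} \<times> {1..n} \<times> {-1, 1}"]) (auto simp: K_def)
  have zero: "?H (g ` cube_edge n i j \<sigma>) = 0" if k: "(i, j, \<sigma>) \<in> K" for i j \<sigma>
  proof -
    have ij: "i \<in> {1..n}" "j \<in> {1..n}" "i \<noteq> j" "\<bar>\<sigma>\<bar> = 1" using k by (auto simp: K_def)
    have F1: "1 \<le> p_sum p n y" if "y \<in> cube_edge n i j \<sigma>" for y
    proof -
      have "1 = \<bar>y j\<bar> powr p" using that ij by (simp add: cube_edge_def)
      also have "\<dots> \<le> p_sum p n y" unfolding p_sum_def using ij by (intro member_le_sum) auto
      finally show ?thesis .
    qed
    have N1: "1 \<le> ?N y" if "y \<in> cube_edge n i j \<sigma>" for y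
      using F1[OF that] p by (simp add: p_norm_eq ge_one_powr_ge_zero)
    \<comment> \<open>The identity together with |1/N - 1| \<le> 1 gives the 2; p * n is a Lipschitz
      constant of the p-norm N, and the other \<open>n\<close> bounds the Euclidean length on the
      cube.\<close>
    have "?H (g ` cube_edge n i j \<sigma>) \<le> ennreal (2 + real n * (p * real n)) ^ d * ?H (cube_edge n i j \<sigma>)"
    proof (rule hausdorff_measure_lipschitz_image)
      fix y z assume yz: "y \<in> cube_edge n i j \<sigma>" "z \<in> cube_edge n i j \<sigma>"
      have "\<bar>?N y - ?N z\<bar> \<le> \<bar>p_sum p n y - p_sum p n z\<bar>"
        unfolding p_norm_eq using F1 yz p by (intro root_powr_lipschitz) auto
      also have "\<dots> \<le> (\<Sum>i=1..n. \<bar>\<bar>y i\<bar> powr p - \<bar>z i\<bar> powr p\<bar>)"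
        unfolding p_sum_def sum_subtractf[symmetric] by (rule sum_abs)
      also have "\<dots> \<le> (\<Sum>i=1..n. p * edist n y z)"
      proof (rule sum_mono)
        fix i assume i: "i \<in> {1..n}"
        have "\<bar>\<bar>y i\<bar> powr p - \<bar>z i\<bar> powr p\<bar> \<le> p * \<bar>y i - z i\<bar>"
          using yz i p by (intro abs_powr_lipschitz) (auto simp: cube_edge_def)
        also have "\<dots> \<le> p * edist n y z" using abs_coord_le_edist[OF i] p by (intro mult_left_mono) auto
        finally show "\<bar>\<bar>y i\<bar> powr p - \<bar>z i\<bar> powr p\<bar> \<le> p * edist n y z" .
      qed
      finally have Nd: "\<bar>?N y - ?N z\<bar> \<le> p * real n * edist n y z" by (simp add: mult_ac)
      have ny: "1 \<le> ?N y" "1 \<le> ?N z" using N1 yz by auto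
      have "\<bar>1 / ?N y - 1 / ?N z\<bar> = \<bar>?N y - ?N z\<bar> / (?N y * ?N z)"
        using ny by (simp add: field_simps abs_if)
      also have "\<dots> \<le> \<bar>?N y - ?N z\<bar> / 1"
        using ny mult_mono[of 1 "?N y" 1 "?N z"] by (intro divide_left_mono) auto
      finally have d1: "\<bar>1 / ?N y - 1 / ?N z\<bar> \<le> p * real n * edist n y z" using Nd by simp
      have "L2_set z {1..n} \<le> real n * 1" using yz by (intro L2_set_le_card) (auto simp: cube_edge_def)
      then have "\<bar>1 / ?N y - 1 / ?N z\<bar> * L2_set z {1..n} \<le> (p * real n * edist n y z) * real n"
        using d1 p by (intro mult_mono) auto
      moreover have "\<bar>1 / ?N y - 1\<bar> \<le> 1" using ny by (simp add: abs_if field_simps)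
      then have "\<bar>1 / ?N y - 1\<bar> * edist n y z \<le> 1 * edist n y z" by (intro mult_right_mono) auto
      ultimately have "edist n (g y) (g z) \<le> edist n y z + (edist n y z + (p * real n * edist n y z) * real n)"
        using edist_scale_diff[of n "1 / ?N y" y "1 / ?N z" z] unfolding g_def by linarith
      then show "edist n (g y) (g z) \<le> (2 + real n * (p * real n)) * edist n y z" by (simp add: algebra_simps)
    qed (use p in \<open>auto simp: g_def intro: add_pos_nonneg\<close>)
    then show ?thesis using hausdorff_measure_cube_edge[of i d j \<sigma>] ij by (simp add: n_def power2_eq_1_iff abs_if split: if_splits)
  qed
  have zero_UN: "?H (\<Union>(i, j, \<sigma>)\<in>L. g ` cube_edge n i j \<sigma>) = 0" if "L \<subseteq> K" for L
    using finite_subset[OF that finK] that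
  proof (induction L rule: finite_induct)
    case (insert k L)
    obtain i j \<sigma> where k: "k = (i, j, \<sigma>)" by (cases k)
    have "?H (\<Union>(i, j, \<sigma>)\<in>insert k L. g ` cube_edge n i j \<sigma>) \<le>
        ?H (g ` cube_edge n i j \<sigma>) + ?H (\<Union>(i, j, \<sigma>)\<in>L. g ` cube_edge n i j \<sigma>)"
      using hausdorff_measure_Un_le by (simp add: k)
    then show ?case using zero insert by (simp add: k)
  qed (simp add: hausdorff_measure_empty)
  have "{x \<in> p_sphere p n. \<exists>i\<in>{1..n}. x i = 0} \<subseteq> (\<Union>(i, j, \<sigma>)\<in>K. g ` cube_edge n i j \<sigma>)"
  proof
    fix x assume "x \<in> {x \<in> p_sphere p n. \<exists>i\<in>{1..n}. x i = 0}"
    then obtain i where xs: "x \<in> p_sphere p n" and i: "i \<in> {1..n}" "x i = 0" by blast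
    have xR: "x \<in> Rn n" and Nx: "?N x = 1" using xs by (auto simp: p_sphere_def)
    \<comment> \<open>A coordinate \<open>j\<close> of maximal modulus selects the face met by the
      ray through \<open>x\<close>; it differs from \<open>i\<close> because x i = 0.\<close>
    define m where "m = Max ((\<lambda>k. \<bar>x k\<bar>) ` {1..n})"
    have fin: "finite ((\<lambda>k. \<bar>x k\<bar>) ` {1..n})" and ne: "(\<lambda>k. \<bar>x k\<bar>) ` {1..n} \<noteq> {}" using i by auto
    have m: "\<bar>x k\<bar> \<le> m" if "k \<in> {1..n}" for k unfolding m_def using fin that by (intro Max_ge) auto
    obtain j where j: "j \<in> {1..n}" "\<bar>x j\<bar> = m" using Max_in[OF fin ne] by (auto simp: m_def)
    have "m > 0"
    proof (rule ccontr)
      assume "\<not> m > 0"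
      then have "x k = 0" if "k \<in> {1..n}" for k using m[OF that] by auto
      then have "p_sum p n x = 0" unfolding p_sum_def by (intro sum.neutral) auto
      then show False using Nx p by (simp add: p_norm_eq)
    qed
    define y where "y = scale_Rn n (1 / m) x"
    have yk: "y k = x k / m" if "k \<in> {1..n}" for k using that by (simp add: y_def scale_Rn_def)
    have "\<bar>y k\<bar> \<le> 1" if "k \<in> {1..n}" for k using yk[OF that] m[OF that] \<open>m > 0\<close> by (simp add: abs_div)
    moreover have "y j = sgn (x j)" using yk[OF j(1)] j(2) \<open>m > 0\<close> by (auto simp: sgn_if abs_if split: if_splits)
    moreover have "y i = 0" using yk i by simp
    ultimately have "y \<in> cube_edge n i j (sgn (x j))" by (simp add: cube_edge_def y_def)
    moreover have "?N y = 1 / m" using \<open>m > 0\<close> p Nx by (simp add: y_def p_norm_scale)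
    then have "g y = x" using \<open>m > 0\<close> xR by (simp add: g_def y_def scale_Rn_scale_Rn scale_Rn_one)
    moreover have "(i, j, sgn (x j)) \<in> K" using i j \<open>m > 0\<close> by (auto simp: K_def sgn_if)
    ultimately show "x \<in> (\<Union>(i, j, \<sigma>)\<in>K. g ` cube_edge n i j \<sigma>)" by blast
  qed
  from hausdorff_measure_mono[OF this, of n d] zero_UN[of K] show ?thesis by simp
qed


text \<open>Realises \<open>radial_surface\<close> as a push-forward, which supplies its countable
  additivity.\<close>

definition radial_measure :: "real \<Rightarrow> nat \<Rightarrow> (nat \<Rightarrow> real) measure" where
  "radial_measure p n = distr (density (lborel_Rn n)
     (\<lambda>y. surface_weight p n y * indicator {y \<in> Rn n. p_norm p n y > 0} y))
     (lborel_Rn n) (\<lambda>y. scale_Rn n (1 / p_norm p n y) y)"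

lemma sets_radial_measure [simp]: "sets (radial_measure p n) = sets (lborel_Rn n)"
  by (simp add: radial_measure_def)

lemma emeasure_radial_measure:
  assumes A: "A \<in> sets (lborel_Rn n)"
  shows "emeasure (radial_measure p n) A = radial_surface p n A"
proof -
  let ?V = "lborel_Rn n" and ?g = "\<lambda>y. scale_Rn n (1 / p_norm p n y) y"
  have g: "?g \<in> measurable ?V ?V" by (intro measurable_scale_Rn) measurable
  have pos: "{y \<in> Rn n. p_norm p n y > 0} \<in> sets ?V" by measurable
  have B: "?g -` A \<inter> Rn n \<in> sets ?V" using g A by (rule measurable_sets)
  have w: "(\<lambda>y. surface_weight p n y * indicator {y \<in> Rn n. p_norm p n y > 0} y) \<in> borel_measurable ?V"
    using pos by (intro borel_measurable_times_ennreal borel_measurable_indicator measurable_surface_weight)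
  have "emeasure (radial_measure p n) A = emeasure (density ?V (\<lambda>y. surface_weight p n y * indicator {y \<in> Rn n. p_norm p n y > 0} y)) (?g -` A \<inter> Rn n)"
    unfolding radial_measure_def using A g by (subst emeasure_distr) auto
  also have "\<dots> = (\<integral>\<^sup>+y. surface_weight p n y * indicator {y \<in> Rn n. p_norm p n y > 0} y * indicator (?g -` A \<inter> Rn n) y \<partial>?V)"
    by (rule emeasure_density[OF w B])
  also have "\<dots> = radial_surface p n A"
    unfolding radial_surface_def by (intro nn_integral_cong) (auto simp: radial_set_def indicator_def)
  finally show ?thesis .
qed

lemma ennreal_le_of_le_mult:
  fixes x y :: ennreal
  assumes "\<And>\<alpha>::real. \<alpha> > 1 \<Longrightarrow> x \<le> ennreal \<alpha> * y"
  shows "x \<le> y"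
proof (cases "y = \<infinity>")
  case False
  then obtain r where r: "y = ennreal r" "r \<ge> 0" by (cases y) auto
  show ?thesis
  proof (rule ennreal_le_epsilon)
    fix e :: real assume e: "e > 0"
    \<comment> \<open>The added 1 admits r = 0 and keeps the excess e * r / (r + 1) below
      \<open>e\<close>.\<close>
    define \<alpha> where "\<alpha> = 1 + e / (r + 1)"
    have "x \<le> ennreal \<alpha> * y" using e r by (intro assms) (simp add: \<alpha>_def)
    also have "\<dots> = ennreal (\<alpha> * r)" using e r by (simp add: \<alpha>_def ennreal_mult)
    also have "\<dots> \<le> ennreal (r + e)"
    proof (rule ennreal_leI)
      have "r * e \<le> e * (r + 1)" using r e by (simp add: algebra_simps)
      then have "e / (r + 1) * r \<le> e" using r by (simp add: field_simps)
      then show "\<alpha> * r \<le> r + e" by (simp add: \<alpha>_def algebra_simps)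
    qed
    also have "\<dots> = y + ennreal e" using r e by simp
    finally show "x \<le> y + ennreal e" .
  qed
qed simp

text \<open>Near a point with nonzero coordinates the two sides agree up to a factor \<alpha> > 1;
  the other points are null for both. Summing over countably many disjoint Borel pieces on which
  such an estimate holds, and letting \<alpha> tend to 1, gives equality.\<close>

theorem hausdorff_measure_sphere:
  fixes p :: real and d :: nat
  defines "n \<equiv> Suc d"
  assumes p: "1 \<le> p" and A: "A \<in> sets (lborel_Rn n)" "A \<subseteq> p_sphere p n"
  shows "radial_const p d 1 * hausdorff_measure n d A
    = hausdorff_measure d d (unit_cube d) * radial_surface p n A"
proof -
  let ?V = "lborel_Rn n" and ?J = "radial_const p d 1" and ?\<kappa> = "hausdorff_measure d d (unit_cube d)"
  let ?H = "hausdorff_measure n d" and ?R = "radial_surface p n"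
  define Z where "Z = {x \<in> p_sphere p n. \<exists>i\<in>{1..n}. x i = 0}"
  have Z: "Z \<in> sets ?V"
  proof -
    have "Z = p_sphere p n \<inter> (\<Union>i\<in>{1..n}. {y \<in> Rn n. y i = 0})" by (auto simp: Z_def p_sphere_def)
    then show ?thesis using coord_hyperplane_null[of _ n 0] p_sphere_sets[of p n]
      by (auto simp: null_sets_def intro!: sets.Int sets.finite_UN)
  qed
  have HZ: "?H Z = 0" unfolding Z_def n_def by (rule hausdorff_measure_coord_sphere[OF p])
  have RZ: "?R Z = 0"
  proof -
    have "?R Z = (\<integral>\<^sup>+y. 0 \<partial>?V)"
      unfolding radial_surface_def
    proof (rule nn_integral_cong_AE, rule AE_mp[OF AE_coord_nonzero AE_I2], intro impI)
      fix y :: "nat \<Rightarrow> real" assume "\<forall>i\<in>{1..n}. y i \<noteq> 0"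
      then have "y \<notin> radial_set p n Z" by (auto simp: radial_set_def Z_def scale_Rn_def)
      then show "surface_weight p n y * indicator (radial_set p n Z) y = 0" by simp
    qed
    then show ?thesis by simp
  qed
  define B where "B = A - Z"
  have B: "B \<in> sets ?V" using A Z by (auto simp: B_def)
  have HB: "?H A = ?H B"
  proof (rule antisym)
    have "?H A \<le> ?H (B \<union> Z)" by (rule hausdorff_measure_mono) (auto simp: B_def)
    also have "\<dots> \<le> ?H B + ?H Z" by (rule hausdorff_measure_Un_le)
    finally show "?H A \<le> ?H B" using HZ by simp
  qed (auto simp: B_def intro: hausdorff_measure_mono)
  have RB: "?R A = ?R B"
  proof -
    have "Z \<in> null_sets (radial_measure p n)" using Z RZ by (simp add: null_sets_def emeasure_radial_measure)
    then have "emeasure (radial_measure p n) (A - Z) = emeasure (radial_measure p n) A"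
      using A by (intro emeasure_Diff_null_set) auto
    then show ?thesis using A B by (simp add: emeasure_radial_measure B_def)
  qed
  have both: "?J * ?H B \<le> ennreal \<alpha> * (?\<kappa> * ?R B) \<and> ?\<kappa> * ?R B \<le> ennreal \<alpha> * (?J * ?H B)" if \<alpha>: "\<alpha> > 1" for \<alpha> :: real
  proof -
    define good where "good U \<longleftrightarrow> open U \<and> (\<forall>A. A \<in> sets ?V \<longrightarrow> A \<subseteq> U \<inter> p_sphere p n \<longrightarrow>
        ?J * ?H A \<le> ennreal \<alpha> * (?\<kappa> * ?R A) \<and> ?\<kappa> * ?R A \<le> ennreal \<alpha> * (?J * ?H A))" for U
    \<comment> \<open>Removing the points with a vanishing coordinate destroys compactness, so a
      countable subcover takes the place of a finite one.\<close>
    obtain G where G: "G \<subseteq> Collect good" "countable G" "\<Union>G = \<Union>(Collect good)"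
      using Lindelof[of "Collect good"] by (auto simp: good_def)
    have "good {}" using hausdorff_measure_empty
      by (auto simp: good_def radial_surface_def radial_set_def)
    define Us where "Us = from_nat_into (insert {} G)"
    have Us: "range Us = insert {} G" unfolding Us_def using G(2) by (intro range_from_nat_into) auto
    have goodUs: "good (Us k)" for k using Us G(1) \<open>good {}\<close> by (metis insertE mem_Collect_eq rangeI subsetD)
    have cover: "B \<subseteq> (\<Union>k. Us k)"
    proof
      fix x assume x: "x \<in> B"
      then have "x \<in> p_sphere p n" "\<And>i. i \<in> {1..n} \<Longrightarrow> x i \<noteq> 0" using A by (auto simp: B_def Z_def)
      from surface_local[OF p this[unfolded n_def] \<alpha>, folded n_def]
      obtain U where "x \<in> U" "good U" unfolding good_def by metis
      then have "x \<in> \<Union>G" using G(3) by blast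
      then show "x \<in> (\<Union>k. Us k)" using Us by (metis UN_I UNIV_I Union_iff insertCI rangeE)
    qed
    \<comment> \<open>Overlaps are removed, since additivity over the pieces requires them to be
      disjoint.\<close>
    define W where "W k = disjointed (\<lambda>k. Us k \<inter> Rn n) k \<inter> B" for k
    have "range (\<lambda>k. Us k \<inter> Rn n) \<subseteq> sets ?V"
      using goodUs by (auto simp: good_def intro!: open_Int_Rn_sets)
    then have "disjointed (\<lambda>k. Us k \<inter> Rn n) k \<in> sets ?V" for k
      using sets.range_disjointed_sets by blast
    then have W: "W k \<in> sets ?V" for k using B by (auto simp: W_def)
    have dW: "disjoint_family W"
      using disjoint_family_disjointed[of "\<lambda>k. Us k \<inter> Rn n"] by (auto simp: W_def disjoint_family_on_def)
    have UW: "(\<Union>k. W k) = B"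
      using cover B[THEN sets.sets_into_space] UN_disjointed_eq[of "\<lambda>k. Us k \<inter> Rn n"] by (auto simp: W_def)
    have rW: "range W \<subseteq> sets ?V" using W by blast
    have sumH: "?H B = (\<Sum>k. ?H (W k))"
      using suminf_emeasure[of W "hausdorff n d"] rW W dW B by (auto simp: UW emeasure_hausdorff)
    have sumR: "?R B = (\<Sum>k. ?R (W k))"
      using suminf_emeasure[of W "radial_measure p n"] rW W dW B by (auto simp: UW emeasure_radial_measure)
    have loc: "?J * ?H (W k) \<le> ennreal \<alpha> * (?\<kappa> * ?R (W k)) \<and> ?\<kappa> * ?R (W k) \<le> ennreal \<alpha> * (?J * ?H (W k))" for k
    proof -
      have "W k \<subseteq> Us k \<inter> p_sphere p n" using A disjointed_subset[of "\<lambda>k. Us k \<inter> Rn n" k] by (auto simp: W_def B_def)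
      then show ?thesis using goodUs[of k] W[of k] unfolding good_def by blast
    qed
    have "(\<Sum>k. ?J * ?H (W k)) \<le> (\<Sum>k. ennreal \<alpha> * (?\<kappa> * ?R (W k)))"
      "(\<Sum>k. ?\<kappa> * ?R (W k)) \<le> (\<Sum>k. ennreal \<alpha> * (?J * ?H (W k)))"
      using loc by (intro suminf_le; blast?; simp)+
    then show ?thesis unfolding sumH sumR by simp
  qed
  have "?J * ?H B \<le> ?\<kappa> * ?R B" "?\<kappa> * ?R B \<le> ?J * ?H B"
    using both by (auto intro: ennreal_le_of_le_mult)
  then show ?thesis unfolding HB RB by (rule antisym)
qed

text \<open>Removes unknown constants of proportionality. Finiteness of \<open>a\<close> follows
  from the second equation, so the radial integral only has to be shown nonzero.\<close>

lemma ennreal_ratio_eq: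
  fixes a b x y s t :: ennreal
  assumes "a * x = b * y" "a * s = b * t" "a \<noteq> 0" "s \<noteq> 0" "s \<noteq> \<infinity>" "b \<noteq> \<infinity>" "t \<noteq> 0" "t \<noteq> \<infinity>" "x \<le> s" "y \<le> t"
  shows "x / s = y / t"
proof -
  have a: "a \<noteq> \<infinity>"
  proof
    assume "a = \<infinity>"
    then have "a * s = \<infinity>" using assms(4) by (simp add: ennreal_top_mult)
    moreover have "b * t \<noteq> \<infinity>" using assms by (simp add: ennreal_mult_eq_top_iff)
    ultimately show False using assms(2) by simp
  qed
  have "x \<noteq> \<infinity>" "y \<noteq> \<infinity>" using assms by (auto simp: top_unique)
  obtain a' where a': "a = ennreal a'" "0 \<le> a'" using a by (cases a) auto
  obtain b' where b': "b = ennreal b'" "0 \<le> b'" using assms(6) by (cases b) auto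
  obtain x' where x': "x = ennreal x'" "0 \<le> x'" using \<open>x \<noteq> \<infinity>\<close> by (cases x) auto
  obtain y' where y': "y = ennreal y'" "0 \<le> y'" using \<open>y \<noteq> \<infinity>\<close> by (cases y) auto
  obtain s' where s': "s = ennreal s'" "0 \<le> s'" using assms(5) by (cases s) auto
  obtain t' where t': "t = ennreal t'" "0 \<le> t'" using assms(8) by (cases t) auto
  note r = a'(1) b'(1) x'(1) y'(1) s'(1) t'(1) and nn = a'(2) b'(2) x'(2) y'(2) s'(2) t'(2)
  have ne: "a' \<noteq> 0" "s' \<noteq> 0" "t' \<noteq> 0" using assms r by auto
  have "a' * x' = b' * y'" "a' * s' = b' * t'" using assms(1,2) nn unfolding r by (auto simp: ennreal_mult[symmetric])
  then have "a' * x' * t' = a' * s' * y'" by (simp add: mult_ac)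
  then have "x' * t' = s' * y'" using ne by simp
  then have "x' / s' = y' / t'" using ne by (simp add: field_simps)
  then show ?thesis using r nn ne by (simp add: divide_ennreal)
qed

section \<open>The three distributions on homogeneous events\<close>

definition gauss_weight :: "real \<Rightarrow> nat \<Rightarrow> (nat \<Rightarrow> real) \<Rightarrow> ennreal" where
  "gauss_weight p n y = ennreal (exp (- p_sum p n y))"

definition cone_event :: "nat \<Rightarrow> (nat \<Rightarrow> real) set \<Rightarrow> bool" where
  "cone_event n E \<longleftrightarrow> E \<in> sets (lborel_Rn n) \<and>
     (\<forall>r>0. \<forall>x\<in>Rn n. scale_Rn n r x \<in> E \<longleftrightarrow> x \<in> E)"

lemma measurable_gauss_weight [measurable]: "gauss_weight p n \<in> borel_measurable (lborel_Rn n)"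
  unfolding gauss_weight_def by measurable

lemma p_ball_eq:
  assumes "p > 0"
  shows "p_ball p n = {y \<in> Rn n. p_sum p n y \<le> 1}"
proof -
  have "p_norm p n y \<le> 1 \<longleftrightarrow> p_sum p n y \<le> 1" for y
  proof
    assume "p_norm p n y \<le> 1"
    then have "p_norm p n y powr p \<le> 1" using assms by (intro powr_le1) auto
    then show "p_sum p n y \<le> 1" using assms by (simp add: p_norm_powr)
  next
    assume "p_sum p n y \<le> 1"
    then show "p_norm p n y \<le> 1" unfolding p_norm_eq using assms by (intro powr_le1) auto
  qed
  then show ?thesis by (simp add: p_ball_def)
qed

lemma p_ball_sets [measurable]: "p_ball p n \<in> sets (lborel_Rn n)"
  unfolding p_ball_def by measurable

text \<open>This is Gamma (n / p + 1); it cancels in \<open>ball_ratio\<close>.\<close>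

definition ball_const :: "real \<Rightarrow> nat \<Rightarrow> ennreal" where
  "ball_const p n = (\<integral>\<^sup>+s. ennreal (exp (- s)) * ennreal ((s powr (1 / p)) ^ n) * indicator {0<..} s \<partial>lborel)"

text \<open>Layer-cake formula \<open>exp (-F) = \<integral>\<^sub>F\<^sup>\<infinity> exp (-s) ds\<close> with \<open>F = p_sum p n y\<close>; level sets of \<open>F\<close> scale.\<close>

lemma gauss_weight_cone_event:
  assumes p: "1 \<le> p" and E: "cone_event n E"
  shows "ball_const p n * emeasure (lborel_Rn n) (E \<inter> p_ball p n)
    = (\<integral>\<^sup>+y. gauss_weight p n y * indicator E y \<partial>lborel_Rn n)"
proof -
  let ?V = "lborel_Rn n" and ?F = "p_sum p n"
  have Es: "E \<in> sets ?V" and Ei: "\<And>r x. r > 0 \<Longrightarrow> x \<in> Rn n \<Longrightarrow> scale_Rn n r x \<in> E \<longleftrightarrow> x \<in> E"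
    using E by (auto simp: cone_event_def)
  have sublevel: "{y \<in> Rn n. ?F y \<le> s} \<in> sets ?V" for s by measurable
  interpret V: sigma_finite_measure ?V by (rule sigma_finite_lborel_Rn)
  interpret pair_sigma_finite "lborel :: real measure" ?V ..
  have layer: "gauss_weight p n y = (\<integral>\<^sup>+s. ennreal (exp (- s)) * indicator {?F y..} s \<partial>lborel)" for y
  proof -
    have "((\<lambda>s::real. - exp (- s)) \<longlongrightarrow> - 0) at_top"
      by (intro tendsto_minus filterlim_compose[OF exp_at_bot] filterlim_uminus_at_bot_at_top)
    moreover have "((\<lambda>s. - exp (- s)) has_real_derivative exp (- x)) (at x)" for x :: real
      by (auto intro!: derivative_eq_intros)
    ultimately show ?thesis
      using nn_integral_FTC_atLeast[of "\<lambda>s. exp (- s)" "?F y" "\<lambda>s. - exp (- s)" "- 0"]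
      by (simp add: gauss_weight_def)
  qed
  have lev: "emeasure ?V (E \<inter> {y \<in> Rn n. ?F y \<le> s}) = ennreal ((s powr (1 / p)) ^ n) * emeasure ?V (E \<inter> p_ball p n)"
    if s: "s > 0" for s
  proof -
    let ?r = "s powr (1 / p)"
    have r: "?r > 0" using s by simp
    have L: "E \<inter> {y \<in> Rn n. ?F y \<le> s} \<in> sets ?V" by (intro sets.Int Es sublevel)
    have "emeasure ?V (E \<inter> {y \<in> Rn n. ?F y \<le> s}) = (\<integral>\<^sup>+y. indicator (E \<inter> {y \<in> Rn n. ?F y \<le> s}) y \<partial>?V)"
      using L by simp
    also have "\<dots> = ennreal (?r ^ n) * (\<integral>\<^sup>+y. indicator (E \<inter> {y \<in> Rn n. ?F y \<le> s}) (scale_Rn n ?r y) \<partial>?V)"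
      by (rule nn_integral_scale_Rn) (use L r in auto)
    also have "(\<integral>\<^sup>+y. indicator (E \<inter> {y \<in> Rn n. ?F y \<le> s}) (scale_Rn n ?r y) \<partial>?V) = (\<integral>\<^sup>+y. indicator (E \<inter> p_ball p n) y \<partial>?V)"
    proof (rule nn_integral_cong)
      fix y assume y: "y \<in> Rn n"
      have "?F (scale_Rn n ?r y) = s * ?F y" using s p by (simp add: p_sum_scale powr_powr)
      then have "?F (scale_Rn n ?r y) \<le> s \<longleftrightarrow> ?F y \<le> 1" using s by simp
      then show "indicator (E \<inter> {y \<in> Rn n. ?F y \<le> s}) (scale_Rn n ?r y) = (indicator (E \<inter> p_ball p n) y :: ennreal)"
        using y Ei[OF r y] p by (auto simp: indicator_def p_ball_eq)
    qed
    also have "\<dots> = emeasure ?V (E \<inter> p_ball p n)" using Es p_ball_sets[of p n] by (simp add: sets.Int)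
    finally show ?thesis .
  qed
  have m: "(\<lambda>(s, y). ennreal (exp (- s)) * indicator {?F y..} s * indicator E y) \<in> borel_measurable (lborel \<Otimes>\<^sub>M ?V)"
  proof -
    have "(\<lambda>z. indicator {z. ?F (snd z) \<le> fst z} z :: ennreal) \<in> borel_measurable (lborel \<Otimes>\<^sub>M ?V)"
      by measurable
    then have "(\<lambda>z. ennreal (exp (- fst z)) * indicator {z. ?F (snd z) \<le> fst z} z * indicator E (snd z)) \<in> borel_measurable (lborel \<Otimes>\<^sub>M ?V)"
      using Es by measurable
    then show ?thesis by (simp add: case_prod_beta indicator_def)
  qed
  have "(\<integral>\<^sup>+y. gauss_weight p n y * indicator E y \<partial>?V) = (\<integral>\<^sup>+y. (\<integral>\<^sup>+s. ennreal (exp (- s)) * indicator {?F y..} s * indicator E y \<partial>lborel) \<partial>?V)"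
    unfolding layer by (intro nn_integral_cong nn_integral_multc[symmetric]) measurable
  also have "\<dots> = (\<integral>\<^sup>+s. (\<integral>\<^sup>+y. ennreal (exp (- s)) * indicator {?F y..} s * indicator E y \<partial>?V) \<partial>lborel)"
    using Fubini'[OF m] by simp
  also have "\<dots> = (\<integral>\<^sup>+s. ennreal (exp (- s)) * ennreal ((s powr (1 / p)) ^ n) * indicator {0<..} s * emeasure ?V (E \<inter> p_ball p n) \<partial>lborel)"
  \<comment> \<open>The value s = 0 is left out: the sublevel set may then contain the origin, while
    the indicator on the right vanishes.\<close>
  proof (rule nn_integral_cong_AE, rule AE_mp[OF AE_lborel_singleton[of "0::real"] AE_I2], intro impI)
    fix s :: real assume "s \<noteq> 0"
    have L: "E \<inter> {y \<in> Rn n. ?F y \<le> s} \<in> sets ?V" by (intro sets.Int Es sublevel)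
    have "(\<integral>\<^sup>+y. ennreal (exp (- s)) * indicator {?F y..} s * indicator E y \<partial>?V)
        = (\<integral>\<^sup>+y. ennreal (exp (- s)) * indicator (E \<inter> {y \<in> Rn n. ?F y \<le> s}) y \<partial>?V)"
      by (intro nn_integral_cong) (auto simp: indicator_def)
    also have "\<dots> = ennreal (exp (- s)) * emeasure ?V (E \<inter> {y \<in> Rn n. ?F y \<le> s})"
      using L by (rule nn_integral_cmult_indicator)
    also have "\<dots> = ennreal (exp (- s)) * ennreal ((s powr (1 / p)) ^ n) * indicator {0<..} s * emeasure ?V (E \<inter> p_ball p n)"
    proof (cases "s > 0")
      case False
      then have "\<not> ?F y \<le> s" for y using p_sum_nonneg[of p n y] \<open>s \<noteq> 0\<close> by linarith
      then have "E \<inter> {y \<in> Rn n. ?F y \<le> s} = {}" by auto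
      then show ?thesis using False by simp
    qed (simp add: lev mult.assoc)
    finally show "(\<integral>\<^sup>+y. ennreal (exp (- s)) * indicator {?F y..} s * indicator E y \<partial>?V)
      = ennreal (exp (- s)) * ennreal ((s powr (1 / p)) ^ n) * indicator {0<..} s * emeasure ?V (E \<inter> p_ball p n)" .
  qed
  also have "\<dots> = ball_const p n * emeasure ?V (E \<inter> p_ball p n)"
    unfolding ball_const_def by (rule nn_integral_multc) measurable
  finally show ?thesis ..
qed

lemma cone_event_space: "cone_event n (Rn n)"
  by (simp add: cone_event_def)

lemma ball_ratio:
  assumes p: "1 \<le> p" and E: "cone_event n E"
    and fin: "(\<integral>\<^sup>+y. gauss_weight p n y \<partial>lborel_Rn n) \<noteq> \<infinity>" "(\<integral>\<^sup>+y. gauss_weight p n y \<partial>lborel_Rn n) \<noteq> 0"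
  shows "emeasure (lborel_Rn n) (E \<inter> p_ball p n) / emeasure (lborel_Rn n) (p_ball p n)
    = (\<integral>\<^sup>+y. gauss_weight p n y * indicator E y \<partial>lborel_Rn n) / (\<integral>\<^sup>+y. gauss_weight p n y \<partial>lborel_Rn n)"
proof -
  let ?V = "lborel_Rn n" and ?T = "\<integral>\<^sup>+y. gauss_weight p n y \<partial>lborel_Rn n"
  have Es: "E \<in> sets ?V" using E by (simp add: cone_event_def)
  have "Rn n \<inter> p_ball p n = p_ball p n" by (auto simp: p_ball_def)
  then have total: "ball_const p n * emeasure ?V (p_ball p n) = ?T"
    using gauss_weight_cone_event[OF p cone_event_space, of n] nn_integral_cong[of ?V "\<lambda>y. gauss_weight p n y * indicator (Rn n) y" "gauss_weight p n"]
    by simp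
  have c0: "ball_const p n \<noteq> 0" and b0: "emeasure ?V (p_ball p n) \<noteq> 0" using total fin by auto
  have b1: "emeasure ?V (p_ball p n) \<noteq> \<infinity>" using total fin c0 by (auto simp: ennreal_mult_top)
  show ?thesis
  proof (rule ennreal_ratio_eq[where a = "ball_const p n" and b = 1])
    show "ball_const p n * emeasure ?V (E \<inter> p_ball p n) = 1 * (\<integral>\<^sup>+y. gauss_weight p n y * indicator E y \<partial>?V)"
      using gauss_weight_cone_event[OF p E] by simp
    show "emeasure ?V (E \<inter> p_ball p n) \<le> emeasure ?V (p_ball p n)"
      by (rule emeasure_mono) (use p_ball_sets[of p n] in auto)
    show "(\<integral>\<^sup>+y. gauss_weight p n y * indicator E y \<partial>?V) \<le> ?T"
      by (rule nn_integral_mono) (auto simp: indicator_def)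
  qed (use total fin c0 b0 b1 in auto)
qed

text \<open>
  \<^const>\<open>measure_of\<close> yields the null measure unless \<open>\<mu>\<close> is countably additive, so the total mass 1 alone
  shows that it takes the values of \<open>\<mu>\<close>.
\<close>

lemma emeasure_measure_of_prob:
  assumes "emeasure (measure_of (space N) (sets N) \<mu>) (space N) = 1" and A: "A \<in> sets N"
  shows "emeasure (measure_of (space N) (sets N) \<mu>) A = \<mu> A"
proof -
  have "measure_space (space N) (sigma_sets (space N) (sets N)) \<mu>"
    using assms(1) by (auto simp: emeasure_measure_of_conv split: if_splits)
  then show ?thesis using A by (simp add: emeasure_measure_of_conv sets.sigma_sets_eq)
qed

text \<open>Scaling invariance makes the cone over the part of the sphere in \<open>E\<close> equal
  to the part of the ball in \<open>E\<close>, except possibly at the origin: the cone contains the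
  origin as soon as its base is nonempty, whether or not \<open>E\<close> does.\<close>

lemma emeasure_cone_measure:
  assumes p: "1 \<le> p" and n: "1 \<le> n" and prob: "emeasure (cone_measure p n) (Rn n) = 1" and E: "cone_event n E"
  shows "emeasure (cone_measure p n) E = emeasure (lborel_Rn n) (E \<inter> p_ball p n) / emeasure (lborel_Rn n) (p_ball p n)"
proof -
  let ?V = "lborel_Rn n"
  have Es: "E \<in> sets ?V" and Ei: "\<And>r x. r > 0 \<Longrightarrow> x \<in> Rn n \<Longrightarrow> scale_Rn n r x \<in> E \<longleftrightarrow> x \<in> E"
    using E by (auto simp: cone_event_def)
  define o0 where "o0 = (\<lambda>i\<in>{1..n}. 0 :: real)"
  have o0: "{o0} \<in> null_sets ?V"
  proof (rule null_sets_subset[OF coord_hyperplane_null[of n n 0]])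
    have "{o0} = Pi\<^sub>E {1..n} (\<lambda>_. {0})" by (auto simp: o0_def PiE_iff extensional_def)
    also have "\<dots> \<in> sets ?V" unfolding lborel_Rn_def by (intro sets_PiM_I_finite) auto
    finally show "{o0} \<in> sets ?V" .
    show "{o0} \<subseteq> {y \<in> Rn n. y n = 0}" using n by (auto simp: o0_def simp del: One_nat_def)
  qed (use n in auto)
  let ?C = "cone_over n (E \<inter> p_sphere p n)" and ?B = "E \<inter> p_ball p n"
  have co: "?C = {scale_Rn n r x | r x. x \<in> E \<inter> p_sphere p n \<and> r \<in> {0..1}}"
    by (simp add: cone_over_def scale_Rn_def)
  have sub1: "?C \<subseteq> insert o0 ?B"
  proof
    fix y assume "y \<in> ?C"
    then obtain r x where y: "y = scale_Rn n r x" "x \<in> E" "x \<in> p_sphere p n" "0 \<le> r" "r \<le> 1"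
      unfolding co by auto
    show "y \<in> insert o0 ?B"
    proof (cases "r = 0")
      case True then show ?thesis by (simp add: y o0_def scale_Rn_def)
    next
      case False
      then have "y \<in> E" using y Ei[of r x] by (auto simp: p_sphere_def)
      moreover have "y \<in> p_ball p n" using y p by (auto simp: p_ball_def p_sphere_def p_norm_scale)
      ultimately show ?thesis by simp
    qed
  qed
  have sub2: "?B - {o0} \<subseteq> ?C"
  proof
    fix y assume y: "y \<in> ?B - {o0}"
    let ?r = "p_norm p n y"
    have yR: "y \<in> Rn n" using y by (auto simp: p_ball_def)
    have "\<exists>i\<in>{1..n}. y i \<noteq> 0"
    proof (rule ccontr)
      assume "\<not> ?thesis"
      then have "y = o0" using yR unfolding o0_def by (intro Rn_eqI[of _ n]) (auto simp del: One_nat_def)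
      then show False using y by simp
    qed
    then obtain i where i: "i \<in> {1..n}" "y i \<noteq> 0" by blast
    then have "0 < \<bar>y i\<bar> powr p" by simp
    also have "\<dots> \<le> p_sum p n y" unfolding p_sum_def using i by (intro member_le_sum) auto
    finally have r: "?r > 0" using p by (simp add: p_norm_eq)
    have "scale_Rn n (1 / ?r) y \<in> E" using Ei[of "1 / ?r" y] r yR y by simp
    moreover have "scale_Rn n (1 / ?r) y \<in> p_sphere p n" using r p by (simp add: p_sphere_def p_norm_scale)
    moreover have "y = scale_Rn n ?r (scale_Rn n (1 / ?r) y)" using r yR by (simp add: scale_Rn_scale_Rn scale_Rn_one)
    moreover have "?r \<in> {0..1}" using y by (auto simp: p_ball_def)
    ultimately show "y \<in> ?C" unfolding co by blast
  qed
  have Bs: "?B \<in> sets ?V" using Es p_ball_sets[of p n] by auto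
  have "emeasure ?V ?C = emeasure ?V ?B"
  proof -
    have "emeasure ?V (?B - {o0}) = emeasure ?V ?B" by (rule emeasure_Diff_null_set[OF o0 Bs])
    moreover have "emeasure ?V (?B \<union> {o0}) = emeasure ?V ?B" by (rule emeasure_Un_null_set[OF Bs o0])
    moreover have "?C = ?B - {o0} \<or> ?C = ?B \<union> {o0}" using sub1 sub2 by blast
    ultimately show ?thesis by (elim disjE) (simp_all only:)
  qed
  then show ?thesis
    unfolding cone_measure_def using emeasure_measure_of_prob[OF prob[unfolded cone_measure_def] Es] by simp
qed

text \<open>Divides the proportionality of \<open>hausdorff_measure_sphere\<close> for the part of
  the sphere in \<open>E\<close> by the one for the whole sphere.\<close>

lemma emeasure_surface_measure:
  assumes p: "1 \<le> p" and n: "2 \<le> n" and prob: "emeasure (surface_measure p n) (Rn n) = 1" and E: "cone_event n E"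
    and fin: "(\<integral>\<^sup>+y. surface_weight p n y \<partial>lborel_Rn n) \<noteq> \<infinity>" "(\<integral>\<^sup>+y. surface_weight p n y \<partial>lborel_Rn n) \<noteq> 0"
  shows "emeasure (surface_measure p n) E
    = (\<integral>\<^sup>+y. surface_weight p n y * indicator E y \<partial>lborel_Rn n) / (\<integral>\<^sup>+y. surface_weight p n y \<partial>lborel_Rn n)"
proof -
  let ?V = "lborel_Rn n" and ?S = "p_sphere p n"
  obtain d where d: "n = Suc d" using n by (cases n) auto
  let ?H = "hausdorff_measure n d"
  note val = emeasure_measure_of_prob[OF prob[unfolded surface_measure_def]]
  have dn: "n - 1 = d" using d by simp
  have S_Rn: "Rn n \<inter> ?S = ?S" by (auto simp: p_sphere_def)
  have Es: "E \<in> sets ?V" and Ei: "\<And>r x. r > 0 \<Longrightarrow> x \<in> Rn n \<Longrightarrow> scale_Rn n r x \<in> E \<longleftrightarrow> x \<in> E"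
    using E by (auto simp: cone_event_def)
  \<comment> \<open>In the extended nonnegative reals 0 / 0 and \<infinity> / \<infinity> are 0, so
    total mass 1 rules out an area of 0 or \<infinity>.\<close>
  have "?H ?S / ?H ?S = 1"
    using val[of "Rn n"] prob unfolding dn surface_measure_def by (simp add: S_Rn)
  then have HS: "?H ?S \<noteq> 0" "?H ?S \<noteq> \<infinity>" by (auto simp: divide_ennreal_def)
  have R: "radial_surface p n (F \<inter> ?S) = (\<integral>\<^sup>+y. surface_weight p n y * indicator F y \<partial>?V)" if F: "cone_event n F" for F
  proof -
    have "surface_weight p n y * indicator (radial_set p n (F \<inter> ?S)) y = surface_weight p n y * indicator F y"
      if y: "y \<in> Rn n" for y
    proof (cases "p_norm p n y > 0")
      case True
      have "scale_Rn n (1 / p_norm p n y) y \<in> ?S" using True p by (simp add: p_sphere_def p_norm_scale)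
      moreover have "scale_Rn n (1 / p_norm p n y) y \<in> F \<longleftrightarrow> y \<in> F" using F True y by (simp add: cone_event_def)
      ultimately have "y \<in> radial_set p n (F \<inter> ?S) \<longleftrightarrow> y \<in> F" using True y by (simp add: radial_set_def)
      then show ?thesis by (simp add: indicator_def)
    next
      case False
      then have "p_sum p n y = 0" using p by (simp add: p_norm_eq)
      then have "y i = 0" if "i \<in> {1..n}" for i
        using that unfolding p_sum_def by (subst (asm) sum_nonneg_eq_0_iff) auto
      \<comment> \<open>By the convention \<open>0 powr 0 = 0\<close> this holds for p = 1 as well,
        so the weight vanishes at the origin.\<close>
      then have "grad_norm p n y = 0" unfolding grad_norm_def by (simp add: sum.neutral)
      then show ?thesis by (simp add: surface_weight_def)
    qed
    then show ?thesis unfolding radial_surface_def by (intro nn_integral_cong) auto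
  qed
  have RS: "radial_surface p n ?S = (\<integral>\<^sup>+y. surface_weight p n y \<partial>?V)"
    using R[OF cone_event_space] nn_integral_cong[of ?V "\<lambda>y. surface_weight p n y * indicator (Rn n) y" "surface_weight p n"]
    by (simp add: S_Rn)
  have key: "radial_const p d 1 * ?H A = hausdorff_measure d d (unit_cube d) * radial_surface p n A"
    if "A \<in> sets ?V" "A \<subseteq> ?S" for A
    using hausdorff_measure_sphere[OF p that[unfolded d]] by (simp add: d)
  have J0: "radial_const p d 1 \<noteq> 0"
  proof
    assume J: "radial_const p d 1 = 0"
    have "(\<lambda>s. ennreal (s ^ d) * radial_profile p 1 s * indicator {0<..} s) \<in> borel_measurable lborel" by measurable
    then have "AE s in lborel. ennreal (s ^ d) * radial_profile p 1 s * indicator {0<..} s = 0"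
      using J unfolding radial_const_def by (simp add: nn_integral_0_iff_AE)
    then have "AE s in lborel. s \<notin> {0<..<1::real}"
      by eventually_elim (auto simp: radial_profile_def ennreal_mult[symmetric] ennreal_eq_0_iff indicator_def mult_le_0_iff power_le_zero_eq split: if_splits)
    then have "emeasure lborel {0<..<1::real} = 0"
      by (subst (asm) AE_iff_measurable[of "{0<..<1}"]) auto
    then show False by simp
  qed
  have "?H (E \<inter> ?S) / ?H ?S = radial_surface p n (E \<inter> ?S) / radial_surface p n ?S"
  proof (rule ennreal_ratio_eq)
    show "radial_const p d 1 * ?H (E \<inter> ?S) = hausdorff_measure d d (unit_cube d) * radial_surface p n (E \<inter> ?S)"
      using Es p_sphere_sets[of p n] by (intro key) auto
    show "radial_const p d 1 * ?H ?S = hausdorff_measure d d (unit_cube d) * radial_surface p n ?S"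
      using p_sphere_sets[of p n] by (intro key) auto
    show "?H (E \<inter> ?S) \<le> ?H ?S" by (rule hausdorff_measure_mono) auto
    show "radial_surface p n (E \<inter> ?S) \<le> radial_surface p n ?S"
      unfolding radial_surface_def
      by (intro nn_integral_mono mult_left_mono) (auto simp: indicator_def radial_set_def)
  qed (use J0 HS hausdorff_measure_unit_cube_finite[of d] fin RS in auto)
  then show ?thesis
    using val[OF Es] unfolding dn R[OF E] RS surface_measure_def by simp
qed

section \<open>Logarithmic moments and the Gamma function\<close>

text \<open>\<open>k\<close> counts differentiations in \<open>x\<close> of the integrand of the
  Mellin transform of exp (- |y|^p), extended evenly to the whole line.\<close>

definition log_mellin :: "real \<Rightarrow> nat \<Rightarrow> real \<Rightarrow> real \<Rightarrow> real" where
  "log_mellin p k x y = \<bar>y\<bar> powr (x - 1) * ln \<bar>y\<bar> ^ k * exp (- (\<bar>y\<bar> powr p))"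

lemma measurable_log_mellin [measurable]: "log_mellin p k x \<in> borel_measurable borel"
  unfolding log_mellin_def by measurable

text \<open>Euler's integral under t = y^p. The substitution is made for absolutely integrable
  functions, and the result is carried from Lebesgue to Borel measure.\<close>

lemma has_bochner_integral_half_line:
  fixes p x :: real
  assumes p: "p > 0" and x: "x > 0"
  shows "has_bochner_integral lborel (\<lambda>y. indicator {0<..} y * (y powr (x - 1) * exp (- (y powr p)))) (Gamma (x / p) / p)"
proof -
  let ?f = "\<lambda>t::real. t powr (x / p - 1) / exp t" and ?S = "{0<..} :: real set"
  have xp: "x / p > 0" using p x by simp
  have Gi: "(?f has_integral Gamma (x / p)) ?S"
    by (rule iffD1[OF has_integral_spike_set_eq Gamma_integral_real[OF xp]])
      (auto intro!: negligible_subset[OF negligible_sing[of 0]])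
  have nn: "?f absolutely_integrable_on ?S"
    using Gi by (intro nonnegative_absolutely_integrable_1) (auto simp: integrable_on_def)
  have img: "(\<lambda>y. y powr p) ` ?S = ?S"
  proof (intro equalityI subsetI)
    fix t :: real assume "t \<in> ?S"
    then show "t \<in> (\<lambda>y. y powr p) ` ?S" using p
      by (intro image_eqI[of _ _ "t powr (1 / p)"]) (auto simp: powr_powr)
  qed auto
  have inj: "inj_on (\<lambda>y. y powr p) ?S"
  proof (rule inj_onI)
    fix y z :: real assume *: "y \<in> ?S" "z \<in> ?S" "y powr p = z powr p"
    have "y = (y powr p) powr (1 / p)" using p *(1) by (simp add: powr_powr)
    also have "\<dots> = z" unfolding *(3) using p *(2) by (simp add: powr_powr)
    finally show "y = z" .
  qed
  have cov: "(\<lambda>y. \<bar>p * y powr (p - 1)\<bar> * ?f (y powr p)) absolutely_integrable_on ?S \<and>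
      integral ?S (\<lambda>y. \<bar>p * y powr (p - 1)\<bar> * ?f (y powr p)) = Gamma (x / p)"
  proof (subst has_absolute_integral_change_of_variables_1'[where g = "\<lambda>y. y powr p"])
    fix y :: real assume "y \<in> ?S"
    then show "((\<lambda>y. y powr p) has_field_derivative p * y powr (p - 1)) (at y within ?S)"
      by (auto intro!: derivative_eq_intros)
  qed (use nn Gi inj img in \<open>auto simp: integral_unique\<close>)
  let ?h = "\<lambda>y::real. indicator {0<..} y * (p * (y powr (x - 1) * exp (- (y powr p))))"
  have eq: "indicator ?S y *\<^sub>R (\<bar>p * y powr (p - 1)\<bar> * ?f (y powr p)) = ?h y" for y
  proof (cases "y > 0")
    case True
    have "(y powr p) powr (x / p - 1) = y powr (x - p)" using p by (simp add: powr_powr right_diff_distrib)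
    moreover have "y powr (p - 1) * y powr (x - p) = y powr (x - 1)" by (simp add: powr_add[symmetric])
    ultimately show ?thesis using p True by (simp add: exp_minus field_simps)
  qed simp
  have "integrable lebesgue ?h" using cov unfolding set_integrable_def eq by blast
  moreover have "(LINT y|lebesgue. ?h y) = Gamma (x / p)"
    using set_lebesgue_integral_eq_integral(2)[OF conjunct1[OF cov]] cov unfolding set_lebesgue_integral_def eq by simp
  moreover have m: "?h \<in> borel_measurable lborel" by measurable
  ultimately have "has_bochner_integral lborel ?h (Gamma (x / p))"
    by (simp add: has_bochner_integral_iff integrable_completion integral_completion)
  then have "has_bochner_integral lborel (\<lambda>y. ?h y / p) (Gamma (x / p) / p)"
    by (rule has_bochner_integral_divide_zero)
  then show ?thesis using p by simp
qed

text \<open>The half-line integral and its mirror image, which add up off the null point 0.\<close>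

lemma log_mellin_0:
  assumes p: "p > 0" and x: "x > 0"
  shows "has_bochner_integral lborel (log_mellin p 0 x) (2 / p * Gamma (x / p))"
proof -
  let ?g = "\<lambda>y::real. indicator {0<..} y * (y powr (x - 1) * exp (- (y powr p)))"
  have 1: "has_bochner_integral lborel ?g (Gamma (x / p) / p)" by (rule has_bochner_integral_half_line[OF p x])
  then have 2: "has_bochner_integral lborel (\<lambda>y. ?g (0 + (-1) * y)) (Gamma (x / p) / p)"
    by (subst (asm) lborel_has_bochner_integral_real_affine_iff[of "-1" _ _ 0]) auto
  have "has_bochner_integral lborel (\<lambda>y. ?g y + ?g (0 + (-1) * y)) (Gamma (x / p) / p + Gamma (x / p) / p)"
    by (rule has_bochner_integral_add[OF 1 2])
  moreover have "AE y in lborel. ?g y + ?g (0 + (-1) * y) = log_mellin p 0 x y"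
    by (rule AE_mp[OF AE_lborel_singleton[of "0::real"] AE_I2]) (auto simp: log_mellin_def indicator_def abs_if)
  ultimately have "has_bochner_integral lborel (log_mellin p 0 x) (Gamma (x / p) / p + Gamma (x / p) / p)"
    by (subst has_bochner_integral_cong_AE[symmetric, of "\<lambda>y. ?g y + ?g (0 + (-1) * y)"]) auto
  then show ?thesis by simp
qed

text \<open>From (1 + z / k)^k \<le> exp z with z = \<delta> * |t|, which also yields the constant
  (k / \<delta>)^k.\<close>

lemma abs_power_le_exp:
  fixes \<delta> :: real
  assumes "\<delta> > 0"
  obtains C where "C > 0" "\<And>t. \<bar>t\<bar> ^ k \<le> C * exp (\<delta> * \<bar>t\<bar>)"
proof (cases "k = 0")
  case True
  then show ?thesis using assms by (intro that[of 1]) auto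
next
  case False
  show ?thesis
  proof (rule that)
    show "(real k / \<delta>) ^ k > 0" using False assms by simp
    fix t :: real
    have "(\<delta> * \<bar>t\<bar> / real k) ^ k \<le> (1 + \<delta> * \<bar>t\<bar> / real k) ^ k" using assms by (intro power_mono) auto
    also have "\<dots> \<le> exp (\<delta> * \<bar>t\<bar>)" using False assms
      by (intro exp_ge_one_plus_x_over_n_power_n) (auto intro: order_trans[of _ 0])
    finally have "(real k / \<delta>) ^ k * (\<delta> * \<bar>t\<bar> / real k) ^ k \<le> (real k / \<delta>) ^ k * exp (\<delta> * \<bar>t\<bar>)"
      using assms by (intro mult_left_mono) auto
    moreover have "(real k / \<delta>) ^ k * (\<delta> * \<bar>t\<bar> / real k) ^ k = \<bar>t\<bar> ^ k"
      using False assms by (simp add: power_mult_distrib[symmetric])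
    ultimately show "\<bar>t\<bar> ^ k \<le> (real k / \<delta>) ^ k * exp (\<delta> * \<bar>t\<bar>)" by simp
  qed
qed

lemma exp_abs_ln_le:
  fixes u c :: real
  assumes "u > 0" "c \<ge> 0"
  shows "exp (c * \<bar>ln u\<bar>) \<le> u powr c + u powr (- c)"
  using assms by (cases "ln u \<ge> 0") (auto simp: powr_def abs_if)

text \<open>Powers of the logarithm cost only factors |y| to the power \<plusminus> x / 2, and the
  shifted exponents x + x / 2 and x / 2 are still positive.\<close>

lemma integrable_log_mellin:
  assumes p: "p > 0" and x: "x > 0"
  shows "integrable lborel (log_mellin p k x)"
proof -
  obtain C where C: "C > 0" "\<And>t. \<bar>t\<bar> ^ k \<le> C * exp (x / 2 * \<bar>t\<bar>)"
    using abs_power_le_exp[of "x / 2" k] x by auto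
  let ?b = "\<lambda>y. C * (log_mellin p 0 (x + x / 2) y + log_mellin p 0 (x / 2) y)"
  show ?thesis
  proof (rule Bochner_Integration.integrable_bound)
    show "integrable lborel ?b"
      using log_mellin_0[OF p, of "x + x / 2"] log_mellin_0[OF p, of "x / 2"] x
      by (auto simp: has_bochner_integral_iff)
    show "AE y in lborel. norm (log_mellin p k x y) \<le> norm (?b y)"
    proof (rule AE_mp[OF AE_lborel_singleton[of "0::real"] AE_I2], intro impI)
      fix y :: real assume "y \<noteq> 0"
      define u where "u = \<bar>y\<bar>"
      have u: "u > 0" using \<open>y \<noteq> 0\<close> by (simp add: u_def)
      have "\<bar>ln u\<bar> ^ k \<le> C * (u powr (x / 2) + u powr (- (x / 2)))"
        using C(2)[of "ln u"] exp_abs_ln_le[OF u, of "x / 2"] C(1) x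
        by (meson less_imp_le mult_left_mono order_trans half_gt_zero)
      then have "u powr (x - 1) * exp (- (u powr p)) * \<bar>ln u\<bar> ^ k
          \<le> u powr (x - 1) * exp (- (u powr p)) * (C * (u powr (x / 2) + u powr (- (x / 2))))"
        by (intro mult_left_mono) auto
      also have "\<dots> = C * ((u powr (x - 1) * u powr (x / 2)) * exp (- (u powr p)) + (u powr (x - 1) * u powr (- (x / 2))) * exp (- (u powr p)))"
        by (simp add: algebra_simps)
      also have "\<dots> = ?b y"
        by (simp add: log_mellin_def u_def[symmetric] powr_add[symmetric] add.commute)
      finally show "norm (log_mellin p k x y) \<le> norm (?b y)"
        using abs_of_pos[OF C(1)]
        by (simp add: log_mellin_def u_def[symmetric] abs_mult power_abs mult_ac)
    qed
  qed measurable
qed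

lemma abs_exp_minus_one_le: "\<bar>exp t - 1\<bar> \<le> \<bar>t\<bar> * exp \<bar>t\<bar>" for t :: real
proof (cases "t \<ge> 0")
  case True
  have "1 - t \<le> exp (- t)" using exp_ge_add_one_self[of "- t"] by linarith
  then have "exp t * (1 - t) \<le> exp t * exp (- t)" by (intro mult_left_mono) auto
  then have "exp t - 1 \<le> t * exp t" by (simp add: exp_minus algebra_simps)
  then show ?thesis using True by simp
next
  case False
  have "1 - exp t \<le> - t" using exp_ge_add_one_self[of t] by linarith
  also have "\<dots> \<le> - t * exp (- t)" using False by (simp add: mult_le_cancel_left1)
  finally show ?thesis using False by simp
qed

text \<open>Differentiation under the integral, by dominated convergence along sequences of
  increments. For |h| \<le> \<delta> the difference quotient of exp (h ln u) is at most |ln u|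
  (u^\<delta> + u^(-\<delta>)), so the integrands with one more logarithm at x \<plusminus> \<delta>
  dominate.\<close>

lemma has_field_derivative_log_mellin:
  assumes p: "p > 0" and x: "x > 0"
  shows "((\<lambda>x. LINT y|lborel. log_mellin p k x y) has_real_derivative (LINT y|lborel. log_mellin p (Suc k) x y)) (at x)"
  unfolding DERIV_def tendsto_at_iff_sequentially
proof (intro allI impI)
  fix H :: "nat \<Rightarrow> real" assume H0: "\<forall>i. H i \<in> UNIV - {0}" and H: "H \<longlonglongrightarrow> 0"
  \<comment> \<open>Half of \<open>x\<close> keeps the exponent x - \<delta> positive. The terms
    before \<open>N\<close>, where the increment may be too large, are dropped.\<close>
  define \<delta> where "\<delta> = x / 2"
  have \<delta>: "\<delta> > 0" "x - \<delta> > 0" using x by (auto simp: \<delta>_def)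
  obtain N where N: "\<And>i. i \<ge> N \<Longrightarrow> \<bar>H i\<bar> < \<delta>"
    using LIMSEQ_D[OF H \<delta>(1)] by auto
  let ?K = "\<lambda>k x. LINT y|lborel. log_mellin p k x y"
  define s where "s i y = (log_mellin p k (x + H (i + N)) y - log_mellin p k x y) / H (i + N)" for i y
  let ?w = "\<lambda>y. \<bar>log_mellin p (Suc k) (x + \<delta>) y\<bar> + \<bar>log_mellin p (Suc k) (x - \<delta>) y\<bar>"
  have "(\<lambda>i. LINT y|lborel. s i y) \<longlonglongrightarrow> ?K (Suc k) x"
  proof (rule integral_dominated_convergence[where w = ?w])
    show "integrable lborel ?w"
      using integrable_log_mellin[OF p, of "x + \<delta>" "Suc k"] integrable_log_mellin[OF p, of "x - \<delta>" "Suc k"] \<delta> x by auto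
    have eq: "s i y = log_mellin p k x y * ((exp (H (i + N) * ln \<bar>y\<bar>) - 1) / H (i + N))" if "y \<noteq> 0" for i y
    proof -
      have "\<bar>y\<bar> powr (x + H (i + N) - 1) = \<bar>y\<bar> powr (x - 1) * exp (H (i + N) * ln \<bar>y\<bar>)"
        using that by (simp add: powr_def exp_add[symmetric] algebra_simps)
      then show ?thesis using H0 by (simp add: s_def log_mellin_def field_simps)
    qed
    show "AE y in lborel. (\<lambda>i. s i y) \<longlonglongrightarrow> log_mellin p (Suc k) x y"
    proof (rule AE_mp[OF AE_lborel_singleton[of "0::real"] AE_I2], intro impI)
      fix y :: real assume y: "y \<noteq> 0"
      have "((\<lambda>h. exp (h * ln \<bar>y\<bar>)) has_real_derivative ln \<bar>y\<bar>) (at 0)"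
        by (auto intro!: derivative_eq_intros)
      then have "((\<lambda>h. (exp (h * ln \<bar>y\<bar>) - 1) / h) \<longlongrightarrow> ln \<bar>y\<bar>) (at 0)"
        by (simp add: DERIV_def)
      then have "(\<lambda>i. (exp (H i * ln \<bar>y\<bar>) - 1) / H i) \<longlonglongrightarrow> ln \<bar>y\<bar>"
        using H0 H by (simp add: tendsto_at_iff_sequentially comp_def)
      then have "(\<lambda>i. (exp (H (i + N) * ln \<bar>y\<bar>) - 1) / H (i + N)) \<longlonglongrightarrow> ln \<bar>y\<bar>"
        by (rule LIMSEQ_ignore_initial_segment)
      then have "(\<lambda>i. s i y) \<longlonglongrightarrow> log_mellin p k x y * ln \<bar>y\<bar>"
        unfolding eq[OF y] by (intro tendsto_mult tendsto_const)
      then show "(\<lambda>i. s i y) \<longlonglongrightarrow> log_mellin p (Suc k) x y" by (simp add: log_mellin_def mult_ac)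
    qed
    show "AE y in lborel. norm (s i y) \<le> ?w y" for i
    proof (rule AE_mp[OF AE_lborel_singleton[of "0::real"] AE_I2], intro impI)
      fix y :: real assume y: "y \<noteq> 0"
      define u where "u = \<bar>y\<bar>"
      have u: "u > 0" using y by (simp add: u_def)
      define h where "h = H (i + N)"
      have h: "h \<noteq> 0" "\<bar>h\<bar> \<le> \<delta>" using H0 N[of "i + N"] by (auto simp: h_def)
      have "\<bar>(exp (h * ln u) - 1) / h\<bar> \<le> \<bar>ln u\<bar> * exp (\<bar>h\<bar> * \<bar>ln u\<bar>)"
        using abs_exp_minus_one_le[of "h * ln u"] h by (simp add: abs_mult divide_le_eq mult_ac)
      also have "\<dots> \<le> \<bar>ln u\<bar> * exp (\<delta> * \<bar>ln u\<bar>)" using h by (intro mult_left_mono) (auto intro: mult_right_mono)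
      also have "\<dots> \<le> \<bar>ln u\<bar> * (u powr \<delta> + u powr (- \<delta>))"
        using exp_abs_ln_le[OF u] \<delta> by (intro mult_left_mono) auto
      finally have "\<bar>log_mellin p k x y\<bar> * \<bar>(exp (h * ln u) - 1) / h\<bar> \<le> \<bar>log_mellin p k x y\<bar> * (\<bar>ln u\<bar> * (u powr \<delta> + u powr (- \<delta>)))"
        by (intro mult_left_mono) auto
      also have "\<dots> = ?w y"
      proof -
        define E where "E = exp (- (u powr p))"
        have a: "u powr (x + \<delta> - 1) = u powr (x - 1) * u powr \<delta>" "u powr (x - \<delta> - 1) = u powr (x - 1) * u powr (- \<delta>)"
          by (simp_all add: powr_add[symmetric] algebra_simps)
        have L: "\<bar>log_mellin p k z y\<bar> = u powr (z - 1) * \<bar>ln u\<bar> ^ k * E" for k z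
          by (simp add: log_mellin_def abs_mult power_abs u_def E_def)
        show ?thesis
          unfolding L a power_Suc by (simp only: distrib_left distrib_right mult_ac)
      qed
      finally show "norm (s i y) \<le> ?w y" using eq[OF y, of i] by (simp add: h_def u_def abs_mult)
    qed
  qed (auto simp: s_def)
  moreover have "(LINT y|lborel. s i y) = (?K k (x + H (i + N)) - ?K k x) / H (i + N)" for i
  proof -
    have "x + H (i + N) > 0" using N[of "i + N"] \<delta> by linarith
    then show ?thesis unfolding s_def
      using integrable_log_mellin[OF p] x by (simp add: Bochner_Integration.integral_diff)
  qed
  ultimately have "(\<lambda>i. (?K k (x + H (i + N)) - ?K k x) / H (i + N)) \<longlonglongrightarrow> ?K (Suc k) x" by simp
  then show "((\<lambda>h. (?K k (x + h) - ?K k x) / h) \<circ> H) \<longlonglongrightarrow> ?K (Suc k) x"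
    unfolding comp_def by (rule LIMSEQ_offset)
qed

lemma log_mellin_0_eq: "p > 0 \<Longrightarrow> x > 0 \<Longrightarrow> (LINT y|lborel. log_mellin p 0 x y) = 2 / p * Gamma (x / p)"
  using log_mellin_0 by (simp add: has_bochner_integral_iff)

text \<open>Differentiating the closed form for one logarithm less must agree with differentiating
  under the integral; each differentiation contributes a factor 1 / p.\<close>

lemma log_mellin_1_eq:
  assumes p: "p > 0" and x: "x > 0"
  shows "(LINT y|lborel. log_mellin p 1 x y) = 2 / p\<^sup>2 * (Gamma (x / p) * Digamma (x / p))"
proof -
  have "x / p > 0" using p x by simp
  then have xp: "x / p \<notin> \<int>\<^sub>\<le>\<^sub>0" using nonpos_Ints_nonpos[of "x / p"] by linarith
  have "((\<lambda>x. LINT y|lborel. log_mellin p 0 x y) has_real_derivative 2 / p\<^sup>2 * (Gamma (x / p) * Digamma (x / p))) (at x)"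
  proof (subst has_field_derivative_cong_eventually[where g = "\<lambda>x. 2 / p * Gamma (x / p)"])
    have "eventually (\<lambda>x. x \<in> {0<..}) (at x)" using x by (intro eventually_at_in_open') auto
    then show "eventually (\<lambda>x. (LINT y|lborel. log_mellin p 0 x y) = 2 / p * Gamma (x / p)) (at x)"
      by eventually_elim (use p log_mellin_0_eq in auto)
    show "((\<lambda>x. 2 / p * Gamma (x / p)) has_real_derivative 2 / p\<^sup>2 * (Gamma (x / p) * Digamma (x / p))) (at x)"
      using p xp by (auto intro!: derivative_eq_intros simp: power2_eq_square field_simps)
  qed (use log_mellin_0_eq[OF p x] in simp)
  from DERIV_unique[OF has_field_derivative_log_mellin[OF p x, of 0] this] show ?thesis by simp
qed

lemma log_mellin_2_eq:
  assumes p: "p > 0" and x: "x > 0"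
  shows "(LINT y|lborel. log_mellin p 2 x y) = 2 / p ^ 3 * (Gamma (x / p) * ((Digamma (x / p))\<^sup>2 + Polygamma 1 (x / p)))"
proof -
  have "x / p > 0" using p x by simp
  then have xp: "x / p \<notin> \<int>\<^sub>\<le>\<^sub>0" using nonpos_Ints_nonpos[of "x / p"] by linarith
  have "((\<lambda>x. LINT y|lborel. log_mellin p 1 x y) has_real_derivative
      2 / p ^ 3 * (Gamma (x / p) * ((Digamma (x / p))\<^sup>2 + Polygamma 1 (x / p)))) (at x)"
  proof (subst has_field_derivative_cong_eventually[where g = "\<lambda>x. 2 / p\<^sup>2 * (Gamma (x / p) * Digamma (x / p))"])
    have "eventually (\<lambda>x. x \<in> {0<..}) (at x)" using x by (intro eventually_at_in_open') auto
    then show "eventually (\<lambda>x. (LINT y|lborel. log_mellin p 1 x y) = 2 / p\<^sup>2 * (Gamma (x / p) * Digamma (x / p))) (at x)"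
      by eventually_elim (use p log_mellin_1_eq in auto)
    show "((\<lambda>x. 2 / p\<^sup>2 * (Gamma (x / p) * Digamma (x / p))) has_real_derivative
        2 / p ^ 3 * (Gamma (x / p) * ((Digamma (x / p))\<^sup>2 + Polygamma 1 (x / p)))) (at x)"
      using p xp by (auto intro!: derivative_eq_intros simp: power2_eq_square power3_eq_cube field_simps)
  qed (use log_mellin_1_eq[OF p x] in simp)
  from DERIV_unique[OF has_field_derivative_log_mellin[OF p x, of 1] this] show ?thesis by (simp add: numeral_2_eq_2)
qed

section \<open>Independent identically distributed variables\<close>

locale real_iid =
  fixes Q :: "real measure"
  assumes prob_Q: "prob_space Q" and sets_Q [measurable_cong]: "sets Q = sets borel"
begin

text \<open>One infinite product serves all dimensions at once, because the central limit theorem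
  speaks about a single sequence; the vector in dimension \<open>n\<close> is the restriction to
  \<open>{1..n}\<close>.\<close>

definition \<Omega> :: "(nat \<Rightarrow> real) measure" where
  "\<Omega> = (\<Pi>\<^sub>M i\<in>UNIV. Q)"

lemma prob_space_\<Omega>: "prob_space \<Omega>"
  unfolding \<Omega>_def by (intro prob_space_PiM prob_Q)

sublocale Q: prob_space Q by (rule prob_Q)
sublocale \<Omega>: prob_space \<Omega> by (rule prob_space_\<Omega>)

lemma space_Q [simp]: "space Q = UNIV"
  using sets_eq_imp_space_eq[OF sets_Q] by simp

lemma prob_Q_UNIV [simp]: "Q.prob UNIV = 1"
  using Q.prob_space by simp

lemma coord_\<Omega>: "(\<lambda>\<omega>. \<omega> k) \<in> measurable \<Omega> Q"
  unfolding \<Omega>_def by (rule measurable_component_singleton) simp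

lemma coord_\<Omega>_borel [measurable]: "(\<lambda>\<omega>. \<omega> k) \<in> borel_measurable \<Omega>"
  using coord_\<Omega> by (simp add: measurable_cong_sets[OF refl sets_Q])

lemma distr_coord: "distr \<Omega> Q (\<lambda>\<omega>. \<omega> k) = Q"
  unfolding \<Omega>_def by (rule distr_PiM_component) (auto intro: prob_Q)

lemma distr_fun_coord:
  assumes f: "f \<in> borel_measurable borel"
  shows "distr \<Omega> borel (\<lambda>\<omega>. f (\<omega> k)) = distr Q borel f"
proof -
  have "f \<in> measurable Q borel" using f by (simp add: measurable_cong_sets[OF sets_Q refl])
  then have "distr (distr \<Omega> Q (\<lambda>\<omega>. \<omega> k)) borel f = distr \<Omega> borel (f \<circ> (\<lambda>\<omega>. \<omega> k))"
    by (rule distr_distr[OF _ coord_\<Omega>])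
  then show ?thesis by (simp add: distr_coord comp_def)
qed

lemma integral_coord:
  fixes f :: "real \<Rightarrow> real"
  assumes f: "f \<in> borel_measurable borel"
  shows "(LINT \<omega>|\<Omega>. f (\<omega> k)) = (LINT y|Q. f y)" "integrable \<Omega> (\<lambda>\<omega>. f (\<omega> k)) \<longleftrightarrow> integrable Q f"
proof -
  have f': "f \<in> borel_measurable Q" using f by (simp add: measurable_cong_sets[OF sets_Q refl])
  show "(LINT \<omega>|\<Omega>. f (\<omega> k)) = (LINT y|Q. f y)"
    using integral_distr[OF coord_\<Omega> f', of k] by (simp add: distr_coord)
  show "integrable \<Omega> (\<lambda>\<omega>. f (\<omega> k)) \<longleftrightarrow> integrable Q f"
    using integrable_distr_eq[OF coord_\<Omega> f', of k] by (simp add: distr_coord)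
qed

text \<open>The shift by \<open>Suc\<close> reconciles coordinates numbered from 1 with sequences
  numbered from 0. Dropping a coordinate leaves an infinite product of the same law, which yields
  independence.\<close>

lemma indep_coord: "\<Omega>.indep_vars (\<lambda>_. borel) (\<lambda>i \<omega>. \<omega> (Suc i)) UNIV"
proof (subst \<Omega>.indep_vars_iff_distr_eq_PiM)
  have s: "sets (\<Pi>\<^sub>M i\<in>(UNIV::nat set). borel) = sets (\<Pi>\<^sub>M i\<in>(UNIV::nat set). Q)"
    by (intro sets_PiM_cong) (auto simp: sets_Q)
  have "distr \<Omega> (\<Pi>\<^sub>M i\<in>UNIV. borel) (\<lambda>x. \<lambda>i\<in>UNIV. x (Suc i)) = distr \<Omega> (\<Pi>\<^sub>M i\<in>UNIV. Q) (\<lambda>x. \<lambda>i\<in>UNIV. x (Suc i))"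
    by (rule distr_cong) (auto simp: s)
  also have "\<dots> = \<Omega>"
    unfolding \<Omega>_def by (rule distr_PiM_reindex) (auto intro: prob_Q)
  also have "\<dots> = (\<Pi>\<^sub>M i\<in>UNIV. distr \<Omega> borel (\<lambda>\<omega>. \<omega> (Suc i)))"
  proof -
    have "distr \<Omega> borel (\<lambda>\<omega>. \<omega> (Suc i)) = Q" for i
    proof -
      have "distr \<Omega> borel (\<lambda>\<omega>. \<omega> (Suc i)) = distr \<Omega> Q (\<lambda>\<omega>. \<omega> (Suc i))"
        by (rule distr_cong) (auto simp: sets_Q)
      then show ?thesis by (simp add: distr_coord)
    qed
    then show ?thesis by (simp add: \<Omega>_def)
  qed
  finally show "distr \<Omega> (\<Pi>\<^sub>M i\<in>UNIV. borel) (\<lambda>x. \<lambda>i\<in>UNIV. x (Suc i)) = (\<Pi>\<^sub>M i\<in>UNIV. distr \<Omega> borel (\<lambda>\<omega>. \<omega> (Suc i)))" .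
qed auto

lemma indep_fun_coord:
  assumes "f \<in> borel_measurable borel"
  shows "\<Omega>.indep_vars (\<lambda>_. borel) (\<lambda>i \<omega>. f (\<omega> (Suc i))) UNIV"
  using assms by (intro \<Omega>.indep_vars_compose2[OF indep_coord]) auto

text \<open>Independence kills the mixed terms, so of n^2 products only the n diagonal ones survive.
  The rate 1/n is used for the remainder and for the gradient weight.\<close>

lemma mean_square_average:
  fixes f :: "real \<Rightarrow> real"
  assumes f [measurable]: "f \<in> borel_measurable borel" and sq: "integrable Q (\<lambda>y. (f y)\<^sup>2)" and n: "n \<ge> 1"
  defines "\<mu> \<equiv> LINT y|Q. f y"
  shows "integrable \<Omega> (\<lambda>\<omega>. ((\<Sum>i=1..n. f (\<omega> i)) / n - \<mu>)\<^sup>2)"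
    and "(LINT \<omega>|\<Omega>. ((\<Sum>i=1..n. f (\<omega> i)) / n - \<mu>)\<^sup>2) = Q.variance f / n"
proof -
  define g where "g y = f y - \<mu>" for y
  have g [measurable]: "g \<in> borel_measurable borel" unfolding g_def by measurable
  have fQ: "f \<in> borel_measurable Q" using f by (simp add: measurable_cong_sets[OF sets_Q refl])
  have fi: "integrable Q f" by (rule Q.square_integrable_imp_integrable[OF fQ sq])
  have gi: "integrable Q g" unfolding g_def using fi by simp
  have g0: "(LINT y|Q. g y) = 0" unfolding g_def using fi by (simp add: \<mu>_def)
  have g2: "integrable Q (\<lambda>y. (g y)\<^sup>2)"
    unfolding g_def power2_diff using fi sq by auto
  define X where "X i \<omega> = g (\<omega> (Suc i))" for i :: nat and \<omega> :: "nat \<Rightarrow> real"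
  have indep: "\<Omega>.indep_vars (\<lambda>_. borel) X UNIV" unfolding X_def by (rule indep_fun_coord[OF g])
  have Xi: "integrable \<Omega> (X i)" for i unfolding X_def using gi by (simp add: integral_coord(2)[OF g])
  have X0: "(LINT \<omega>|\<Omega>. X i \<omega>) = 0" for i unfolding X_def using g0 by (simp add: integral_coord(1)[OF g])
  have prod: "integrable \<Omega> (\<lambda>\<omega>. X i \<omega> * X j \<omega>) \<and> (LINT \<omega>|\<Omega>. X i \<omega> * X j \<omega>) = (if i = j then Q.variance f else 0)" for i j
  proof (cases "i = j")
    case True
    have gg: "(\<lambda>y. g y * g y) \<in> borel_measurable borel" by measurable
    show ?thesis using True integral_coord[OF gg] g2
      by (simp add: X_def power2_eq_square g_def \<mu>_def)
  next
    case False
    have "\<Omega>.indep_vars (\<lambda>_. borel) X {i, j}" using indep by (rule \<Omega>.indep_vars_subset) simp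
    from \<Omega>.indep_vars_integrable[OF _ this] \<Omega>.indep_vars_lebesgue_integral[OF _ this] Xi X0 False
    show ?thesis by simp
  qed
  have eq: "((\<Sum>i=1..n. f (\<omega> i)) / n - \<mu>)\<^sup>2 = (\<Sum>i<n. \<Sum>j<n. X i \<omega> * X j \<omega>) / (real n)\<^sup>2" for \<omega>
  proof -
    have "(\<Sum>i<n. X i \<omega>) = (\<Sum>i=1..n. g (\<omega> i))" unfolding X_def One_nat_def by (rule sum.atLeast1_atMost_eq[symmetric])
    also have "\<dots> = (\<Sum>i=1..n. f (\<omega> i)) - n * \<mu>" by (simp add: g_def sum_subtractf)
    finally have "(\<Sum>i=1..n. f (\<omega> i)) / n - \<mu> = (\<Sum>i<n. X i \<omega>) / n" using n by (simp add: field_simps)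
    then show ?thesis by (simp add: power_divide power2_eq_square sum_product)
  qed
  show "integrable \<Omega> (\<lambda>\<omega>. ((\<Sum>i=1..n. f (\<omega> i)) / n - \<mu>)\<^sup>2)"
    unfolding eq by (intro integrable_divide_zero Bochner_Integration.integrable_sum impI conjunct1[OF prod])
  have "(LINT \<omega>|\<Omega>. (\<Sum>i<n. \<Sum>j<n. X i \<omega> * X j \<omega>)) = (\<Sum>i<n. \<Sum>j<n. if i = j then Q.variance f else 0)"
  proof -
    have "(LINT \<omega>|\<Omega>. (\<Sum>i<n. \<Sum>j<n. X i \<omega> * X j \<omega>)) = (\<Sum>i<n. LINT \<omega>|\<Omega>. (\<Sum>j<n. X i \<omega> * X j \<omega>))"
      by (rule Bochner_Integration.integral_sum, rule Bochner_Integration.integrable_sum) (simp add: prod)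
    also have "\<dots> = (\<Sum>i<n. \<Sum>j<n. LINT \<omega>|\<Omega>. X i \<omega> * X j \<omega>)"
      by (intro sum.cong refl Bochner_Integration.integral_sum) (simp add: prod)
    finally show ?thesis by (simp add: prod cong: if_cong)
  qed
  also have "\<dots> = n * Q.variance f" by (simp add: sum.delta)
  finally show "(LINT \<omega>|\<Omega>. ((\<Sum>i=1..n. f (\<omega> i)) / n - \<mu>)\<^sup>2) = Q.variance f / n"
    unfolding eq using n by (simp add: power2_eq_square)
qed

lemma isCont_cdf_std_normal: "isCont (cdf std_normal_distribution) x"
proof -
  interpret real_distribution std_normal_distribution by (rule real_dist_normal_dist)
  have "emeasure std_normal_distribution {x} = 0"
    by (subst emeasure_density) (auto intro!: nn_integral_null_set simp: null_sets_def)
  then show ?thesis by (simp add: isCont_cdf measure_def)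
qed

text \<open>Written with the strict tail, the complement of the distribution function, and with
  \<sigma> moved to the threshold: the form that \<open>slutsky_tail\<close> takes.\<close>

lemma clt_tail:
  fixes f :: "real \<Rightarrow> real"
  assumes f [measurable]: "f \<in> borel_measurable borel" and sq: "integrable Q (\<lambda>y. (f y)\<^sup>2)"
    and mean: "(LINT y|Q. f y) = 0" and var: "(LINT y|Q. (f y)\<^sup>2) = \<sigma>\<^sup>2" and \<sigma>: "\<sigma> > 0"
  shows "(\<lambda>n. \<Omega>.prob {\<omega> \<in> space \<Omega>. (\<Sum>i=1..n. f (\<omega> i)) / sqrt n > c}) \<longlonglongrightarrow> 1 - cdf std_normal_distribution (c / \<sigma>)"
proof -
  define X where "X i \<omega> = f (\<omega> (Suc i))" for i :: nat and \<omega> :: "nat \<Rightarrow> real"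
  have f2: "(\<lambda>y. (f y)\<^sup>2) \<in> borel_measurable borel" by measurable
  have rv [measurable]: "X i \<in> borel_measurable \<Omega>" for i
    unfolding X_def using measurable_compose[OF coord_\<Omega>_borel f] .
  have conv: "weak_conv_m (\<lambda>n. distr \<Omega> borel (\<lambda>\<omega>. (\<Sum>i<n. X i \<omega>) / sqrt (n * \<sigma>\<^sup>2))) std_normal_distribution"
  proof (rule \<Omega>.central_limit_theorem_zero_mean[where \<mu> = "distr Q borel f"])
    show "\<Omega>.indep_vars (\<lambda>i. borel) X UNIV" unfolding X_def by (rule indep_fun_coord[OF f])
    show 0: "\<Omega>.expectation (X n) = 0" for n unfolding X_def using integral_coord(1)[OF f] mean by simp
    show "integrable \<Omega> (\<lambda>\<omega>. (X n \<omega>)\<^sup>2)" for n unfolding X_def using integral_coord(2)[OF f2] sq by simp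
    show "\<Omega>.variance (X n) = \<sigma>\<^sup>2" for n
      unfolding 0 using integral_coord(1)[OF f2, of "Suc n"] var by (simp add: X_def)
    show "distr \<Omega> borel (X n) = distr Q borel f" for n unfolding X_def by (rule distr_fun_coord[OF f])
  qed (rule \<sigma>)
  then have lim: "(\<lambda>n. cdf (distr \<Omega> borel (\<lambda>\<omega>. (\<Sum>i<n. X i \<omega>) / sqrt (n * \<sigma>\<^sup>2))) (c / \<sigma>)) \<longlonglongrightarrow> cdf std_normal_distribution (c / \<sigma>)"
    using isCont_cdf_std_normal by (simp add: weak_conv_m_def weak_conv_def)
  have "\<Omega>.prob {\<omega> \<in> space \<Omega>. (\<Sum>i=1..n. f (\<omega> i)) / sqrt n > c}
      = 1 - cdf (distr \<Omega> borel (\<lambda>\<omega>. (\<Sum>i<n. X i \<omega>) / sqrt (n * \<sigma>\<^sup>2))) (c / \<sigma>)" for n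
  proof -
    let ?Y = "\<lambda>\<omega>. (\<Sum>i<n. X i \<omega>) / sqrt (n * \<sigma>\<^sup>2)"
    have eq: "?Y \<omega> = (\<Sum>i=1..n. f (\<omega> i)) / sqrt n / \<sigma>" for \<omega>
    proof -
      have "(\<Sum>i<n. X i \<omega>) = (\<Sum>i=1..n. f (\<omega> i))" unfolding X_def One_nat_def by (rule sum.atLeast1_atMost_eq[symmetric])
      then show ?thesis using \<sigma> by (simp add: real_sqrt_mult)
    qed
    have "?Y -` {..c / \<sigma>} \<inter> space \<Omega> \<in> sets \<Omega>" by (rule measurable_sets[of _ _ borel]) auto
    then have "\<Omega>.prob (space \<Omega> - (?Y -` {..c / \<sigma>} \<inter> space \<Omega>)) = 1 - \<Omega>.prob (?Y -` {..c / \<sigma>} \<inter> space \<Omega>)"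
      by (rule \<Omega>.prob_compl)
    also have "\<Omega>.prob (?Y -` {..c / \<sigma>} \<inter> space \<Omega>) = cdf (distr \<Omega> borel ?Y) (c / \<sigma>)"
      unfolding cdf_def by (subst measure_distr) auto
    also have "space \<Omega> - (?Y -` {..c / \<sigma>} \<inter> space \<Omega>) = {\<omega> \<in> space \<Omega>. (\<Sum>i=1..n. f (\<omega> i)) / sqrt n > c}"
      unfolding vimage_def eq using \<sigma> by (auto simp: divide_le_cancel not_le simp del: divide_divide_eq_left)
    finally show ?thesis .
  qed
  then show ?thesis using tendsto_diff[OF tendsto_const lim] by simp
qed

lemma restrict_\<Omega>:
  "(\<lambda>\<omega>. restrict \<omega> {1..n}) \<in> measurable \<Omega> (\<Pi>\<^sub>M i\<in>{1..n}. Q)"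
  "distr \<Omega> (\<Pi>\<^sub>M i\<in>{1..n}. Q) (\<lambda>\<omega>. restrict \<omega> {1..n}) = (\<Pi>\<^sub>M i\<in>{1..n}. Q)"
proof -
  show "(\<lambda>\<omega>. restrict \<omega> {1..n}) \<in> measurable \<Omega> (\<Pi>\<^sub>M i\<in>{1..n}. Q)"
    by (intro measurable_restrict coord_\<Omega>)
  show "distr \<Omega> (\<Pi>\<^sub>M i\<in>{1..n}. Q) (\<lambda>\<omega>. restrict \<omega> {1..n}) = (\<Pi>\<^sub>M i\<in>{1..n}. Q)"
    unfolding \<Omega>_def by (rule distr_PiM_reindex[where f = "\<lambda>i. i"]) (auto intro: prob_Q)
qed

end

text \<open>A vanishing perturbation \<open>R\<close> and a convergent threshold \<open>bn\<close>
  shift the level by less than \<delta>, which continuity of the limit tail absorbs; the same shift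
  covers the passage from > to \<ge>.\<close>

lemma (in prob_space) slutsky_tail:
  fixes T R :: "nat \<Rightarrow> 'a \<Rightarrow> real"
  assumes [measurable]: "\<And>n. T n \<in> borel_measurable M" "\<And>n. R n \<in> borel_measurable M"
    and T: "\<And>c. (\<lambda>n. prob {\<omega> \<in> space M. T n \<omega> > c}) \<longlonglongrightarrow> F c"
    and F: "isCont F b" and b: "bn \<longlonglongrightarrow> b"
    and R: "\<And>\<epsilon>. \<epsilon> > 0 \<Longrightarrow> (\<lambda>n. prob {\<omega> \<in> space M. \<bar>R n \<omega>\<bar> > \<epsilon>}) \<longlonglongrightarrow> 0"
  shows "(\<lambda>n. prob {\<omega> \<in> space M. T n \<omega> + R n \<omega> \<ge> bn n}) \<longlonglongrightarrow> F b"
proof (rule LIMSEQ_I)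
  fix r :: real assume r: "r > 0"
  \<comment> \<open>One third each for convergence of the tail of \<open>T\<close>, continuity of
    \<open>F\<close>, and the probability that \<open>R\<close> is large.\<close>
  define \<eta> where "\<eta> = r / 3"
  have \<eta>: "\<eta> > 0" using r by (simp add: \<eta>_def)
  obtain s where s: "s > 0" "\<And>c. \<bar>c - b\<bar> < s \<Longrightarrow> \<bar>F c - F b\<bar> < \<eta>"
    using F \<eta> unfolding continuous_at_eps_delta dist_real_def by blast
  define \<delta> where "\<delta> = s / 2"
  have \<delta>: "\<delta> > 0" using s by (simp add: \<delta>_def)
  have Fm: "\<bar>F (b - \<delta>) - F b\<bar> < \<eta>" "\<bar>F (b + \<delta>) - F b\<bar> < \<eta>" using s by (auto simp: \<delta>_def)
  let ?E = "\<lambda>n. {\<omega> \<in> space M. T n \<omega> + R n \<omega> \<ge> bn n}" and ?R = "\<lambda>n. {\<omega> \<in> space M. \<bar>R n \<omega>\<bar> > \<delta> / 3}"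
  have "eventually (\<lambda>n. prob {\<omega> \<in> space M. T n \<omega> > b - \<delta>} < F (b - \<delta>) + \<eta>) sequentially"
    using T[of "b - \<delta>"] \<eta> by (intro order_tendstoD(2)) auto
  moreover have "eventually (\<lambda>n. prob {\<omega> \<in> space M. T n \<omega> > b + \<delta>} > F (b + \<delta>) - \<eta>) sequentially"
    using T[of "b + \<delta>"] \<eta> by (intro order_tendstoD(1)) auto
  moreover have "eventually (\<lambda>n. prob (?R n) < \<eta>) sequentially"
    using R[of "\<delta> / 3"] \<delta> \<eta> by (intro order_tendstoD(2)) auto
  moreover have "eventually (\<lambda>n. dist (bn n) b < \<delta> / 3) sequentially"
    using b \<delta> by (intro tendstoD) auto
  ultimately have "eventually (\<lambda>n. norm (prob (?E n) - F b) < r) sequentially"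
  proof eventually_elim
    case (elim n)
    have bn: "\<bar>bn n - b\<bar> < \<delta> / 3" using elim(4) by (simp add: dist_real_def)
    have "T n \<omega> > b - \<delta> \<or> \<bar>R n \<omega>\<bar> > \<delta> / 3" if "T n \<omega> + R n \<omega> \<ge> bn n" for \<omega>
      using that bn \<delta> by linarith
    then have "prob (?E n) \<le> prob ({\<omega> \<in> space M. T n \<omega> > b - \<delta>} \<union> ?R n)"
      by (intro finite_measure_mono) auto
    also have "\<dots> \<le> prob {\<omega> \<in> space M. T n \<omega> > b - \<delta>} + prob (?R n)" by (rule measure_Un_le) auto
    finally have up: "prob (?E n) < F b + 3 * \<eta>" using elim(1,3) Fm by linarith
    have "T n \<omega> + R n \<omega> \<ge> bn n \<or> \<bar>R n \<omega>\<bar> > \<delta> / 3" if "T n \<omega> > b + \<delta>" for \<omega>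
      using that bn \<delta> by linarith
    then have "prob {\<omega> \<in> space M. T n \<omega> > b + \<delta>} \<le> prob (?E n \<union> ?R n)"
      by (intro finite_measure_mono) auto
    also have "\<dots> \<le> prob (?E n) + prob (?R n)" by (rule measure_Un_le) auto
    finally have lo: "prob (?E n) > F b - 3 * \<eta>" using elim(2,3) Fm by linarith
    show ?case using up lo by (simp add: \<eta>_def abs_less_iff)
  qed
  then show "\<exists>no. \<forall>n\<ge>no. norm (prob (?E n) - F b) < r" by (simp add: eventually_sequentially)
qed

section \<open>The generalised Gaussian law\<close>

locale pgauss =
  fixes p :: real
  assumes p1: "1 \<le> p"
begin

definition Z :: real where
  "Z = 2 / p * Gamma (1 / p)"

definition law :: "real measure" where
  "law = density lborel (\<lambda>y. ennreal (exp (- (\<bar>y\<bar> powr p)) / Z))"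

lemma p0: "p > 0" using p1 by simp

lemma Z_pos: "Z > 0"
  using p0 by (simp add: Z_def Gamma_real_pos)

text \<open>The moments needed later all have this form, and the density turns them into
  \<open>log_mellin\<close> integrals divided by \<open>Z\<close>.\<close>

lemma law_integral:
  assumes f: "f \<in> borel_measurable borel" and s: "s > -1"
    and eq: "\<And>y. y \<noteq> 0 \<Longrightarrow> f y = \<bar>y\<bar> powr s * ln \<bar>y\<bar> ^ k"
  shows "integrable law f" "(LINT y|law. f y) = (LINT y|lborel. log_mellin p k (1 + s) y) / Z"
proof -
  have ae: "AE y in lborel. (exp (- (\<bar>y\<bar> powr p)) / Z) *\<^sub>R f y = log_mellin p k (1 + s) y / Z"
    by (rule AE_mp[OF AE_lborel_singleton[of "0::real"] AE_I2]) (simp add: eq log_mellin_def mult_ac)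
  have i: "integrable lborel (\<lambda>y. log_mellin p k (1 + s) y / Z)"
    using integrable_log_mellin[OF p0, of "1 + s" k] s by simp
  have m: "(\<lambda>y. (exp (- (\<bar>y\<bar> powr p)) / Z) *\<^sub>R f y) \<in> borel_measurable lborel" using f by measurable
  have nn: "AE y in lborel. 0 \<le> exp (- (\<bar>y\<bar> powr p)) / Z" using Z_pos by simp
  show "integrable law f"
    unfolding law_def using f i ae m nn
    by (subst integrable_density) (auto intro: integrable_cong_AE_imp[OF i])
  have "(LINT y|law. f y) = (LINT y|lborel. (exp (- (\<bar>y\<bar> powr p)) / Z) *\<^sub>R f y)"
    unfolding law_def using f nn by (intro integral_density) auto
  also have "\<dots> = (LINT y|lborel. log_mellin p k (1 + s) y / Z)"
    using ae m by (intro integral_cong_AE) auto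
  finally show "(LINT y|law. f y) = (LINT y|lborel. log_mellin p k (1 + s) y) / Z" by simp
qed

lemma law_prob: "prob_space law"
proof
  have nn: "AE y in lborel. 0 \<le> exp (- (\<bar>y\<bar> powr p)) / Z" using Z_pos by simp
  have ae: "AE y in lborel. exp (- (\<bar>y\<bar> powr p)) / Z = log_mellin p 0 1 y / Z"
    by (rule AE_mp[OF AE_lborel_singleton[of "0::real"] AE_I2]) (simp add: log_mellin_def)
  have i: "integrable lborel (\<lambda>y. log_mellin p 0 1 y / Z)" using integrable_log_mellin[OF p0, of 1 0] by simp
  have ae': "AE y in lborel. log_mellin p 0 1 y / Z = exp (- (\<bar>y\<bar> powr p)) / Z"
    using ae by eventually_elim (rule sym)
  have i': "integrable lborel (\<lambda>y. exp (- (\<bar>y\<bar> powr p)) / Z)"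
    by (rule integrable_cong_AE_imp[OF i _ ae']) measurable
  have "(LINT y|lborel. exp (- (\<bar>y\<bar> powr p)) / Z) = (LINT y|lborel. log_mellin p 0 1 y / Z)"
    using ae by (intro integral_cong_AE) auto
  also have "\<dots> = 1" using log_mellin_0_eq[OF p0, of 1, folded Z_def] Z_pos by simp
  finally have "(\<integral>\<^sup>+y. ennreal (exp (- (\<bar>y\<bar> powr p)) / Z) \<partial>lborel) = 1"
    using nn_integral_eq_integral[OF i' nn] by simp
  then show "emeasure law (space law) = 1"
    unfolding law_def by (subst emeasure_density) auto
qed

sublocale real_iid law
  by (rule real_iid.intro[OF law_prob]) (simp add: law_def)

text \<open>The density is positive everywhere, so the two measures have the same null sets.\<close>

lemma AE_law: "(AE y in lborel. P y) \<longleftrightarrow> (AE y in law. P y)"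
  unfolding law_def using Z_pos by (subst AE_density) auto

abbreviation \<psi> :: real where "\<psi> \<equiv> Digamma (1 / p)"
abbreviation \<psi>' :: real where "\<psi>' \<equiv> Polygamma 1 (1 / p)"

section \<open>Moments of the law and the limit variance\<close>

lemma gamma_shift: "Gamma (1 / p + 1) = Gamma (1 / p) / p" "Gamma (1 / p + 2) = (1 / p + 1) * (Gamma (1 / p) / p)"
proof -
  have "1 / p \<notin> \<int>\<^sub>\<le>\<^sub>0" "1 / p + 1 \<notin> \<int>\<^sub>\<le>\<^sub>0"
    using nonpos_Ints_nonpos[of "1 / p"] nonpos_Ints_nonpos[of "1 / p + 1"] p0 by (auto simp: field_simps)
  then show a: "Gamma (1 / p + 1) = Gamma (1 / p) / p" "Gamma (1 / p + 2) = (1 / p + 1) * (Gamma (1 / p) / p)"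
    using Gamma_plus1[of "1 / p"] Gamma_plus1[of "1 / p + 1"] by (auto simp: add.assoc)
qed

lemma gamma_ne: "Gamma (1 / p) \<noteq> 0"
  using less_imp_neq[OF Gamma_real_pos[of "1 / p"]] p0 by simp

lemma digamma_shift: "Digamma (1 / p + 1) = \<psi> + p"
  using Digamma_plus1[of "1 / p"] p0 by simp

lemma moment_ln: "integrable law (\<lambda>y. ln \<bar>y\<bar>)" "(LINT y|law. ln \<bar>y\<bar>) = \<psi> / p"
proof -
  note * = law_integral[of "\<lambda>y. ln \<bar>y\<bar>" 0 1, simplified]
  show "integrable law (\<lambda>y. ln \<bar>y\<bar>)" by (rule *)
  have "(LINT y|law. ln \<bar>y\<bar>) = (LINT y|lborel. log_mellin p 1 1 y) / Z" using *(2) by simp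
  then show "(LINT y|law. ln \<bar>y\<bar>) = \<psi> / p"
    unfolding log_mellin_1_eq[OF p0 zero_less_one] using gamma_ne p0 by (simp add: Z_def power2_eq_square field_simps)
qed

lemma moment_ln_sq: "integrable law (\<lambda>y. (ln \<bar>y\<bar>)\<^sup>2)" "(LINT y|law. (ln \<bar>y\<bar>)\<^sup>2) = (\<psi>\<^sup>2 + \<psi>') / p\<^sup>2"
proof -
  note * = law_integral[of "\<lambda>y. (ln \<bar>y\<bar>)\<^sup>2" 0 2, simplified]
  show "integrable law (\<lambda>y. (ln \<bar>y\<bar>)\<^sup>2)" by (rule *)
  have "(LINT y|law. (ln \<bar>y\<bar>)\<^sup>2) = (LINT y|lborel. log_mellin p 2 1 y) / Z" using *(2) by simp
  then show "(LINT y|law. (ln \<bar>y\<bar>)\<^sup>2) = (\<psi>\<^sup>2 + \<psi>') / p\<^sup>2"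
    unfolding log_mellin_2_eq[OF p0 zero_less_one] using gamma_ne p0
    by (simp add: Z_def power2_eq_square power3_eq_cube divide_simps)
qed

lemma moment_powr: "integrable law (\<lambda>y. \<bar>y\<bar> powr p)" "(LINT y|law. \<bar>y\<bar> powr p) = 1 / p"
proof -
  have s: "p > -1" "(1 + p) / p = 1 / p + 1" using p0 by (auto simp: field_simps)
  note * = law_integral[of "\<lambda>y. \<bar>y\<bar> powr p" p 0, OF _ s(1)]
  show "integrable law (\<lambda>y. \<bar>y\<bar> powr p)" by (rule *) auto
  have "(LINT y|law. \<bar>y\<bar> powr p) = (LINT y|lborel. log_mellin p 0 (1 + p) y) / Z" by (rule *) auto
  then show "(LINT y|law. \<bar>y\<bar> powr p) = 1 / p"
    using log_mellin_0_eq[OF p0, of "1 + p"] gamma_ne p0 by (simp add: Z_def s gamma_shift)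
qed

lemma moment_powr_sq: "integrable law (\<lambda>y. (\<bar>y\<bar> powr p)\<^sup>2)" "(LINT y|law. (\<bar>y\<bar> powr p)\<^sup>2) = (1 / p + 1) / p"
proof -
  have s: "2 * p > -1" "(1 + 2 * p) / p = 1 / p + 2" using p0 by (auto simp: field_simps)
  have e: "(\<bar>y\<bar> powr p)\<^sup>2 = \<bar>y\<bar> powr (2 * p) * ln \<bar>y\<bar> ^ 0" for y :: real
    by (simp add: power2_eq_square powr_add[symmetric])
  note * = law_integral[of "\<lambda>y. (\<bar>y\<bar> powr p)\<^sup>2" "2 * p" 0, OF _ s(1) e]
  show "integrable law (\<lambda>y. (\<bar>y\<bar> powr p)\<^sup>2)" by (rule *) auto
  have "(LINT y|law. (\<bar>y\<bar> powr p)\<^sup>2) = (LINT y|lborel. log_mellin p 0 (1 + 2 * p) y) / Z" by (rule *) auto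
  then show "(LINT y|law. (\<bar>y\<bar> powr p)\<^sup>2) = (1 / p + 1) / p"
    using log_mellin_0_eq[OF p0, of "1 + 2 * p"] gamma_ne p0 by (simp add: Z_def s gamma_shift)
qed

lemma moment_powr_ln: "integrable law (\<lambda>y. \<bar>y\<bar> powr p * ln \<bar>y\<bar>)" "(LINT y|law. \<bar>y\<bar> powr p * ln \<bar>y\<bar>) = (\<psi> + p) / p\<^sup>2"
proof -
  have s: "p > -1" "(1 + p) / p = 1 / p + 1" using p0 by (auto simp: field_simps)
  note * = law_integral[of "\<lambda>y. \<bar>y\<bar> powr p * ln \<bar>y\<bar>" p 1, OF _ s(1)]
  show "integrable law (\<lambda>y. \<bar>y\<bar> powr p * ln \<bar>y\<bar>)" by (rule *) auto
  have "(LINT y|law. \<bar>y\<bar> powr p * ln \<bar>y\<bar>) = (LINT y|lborel. log_mellin p 1 (1 + p) y) / Z" by (rule *) auto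
  then show "(LINT y|law. \<bar>y\<bar> powr p * ln \<bar>y\<bar>) = (\<psi> + p) / p\<^sup>2"
    using log_mellin_1_eq[OF p0, of "1 + p"] gamma_ne p0
    unfolding Z_def s(2) gamma_shift digamma_shift by (simp add: power2_eq_square)
qed

text \<open>Since |Y|^p has mean 1 / p, u = p * average is close to 1, and ln u / p is close to (u -
  1) / p = average - 1 / p. Hence |y|^p enters with coefficient 1.\<close>

definition \<xi> :: "real \<Rightarrow> real" where
  "\<xi> y = (ln \<bar>y\<bar> - \<psi> / p) - (\<bar>y\<bar> powr p - 1 / p)"

lemma measurable_\<xi> [measurable]: "\<xi> \<in> borel_measurable borel"
  unfolding \<xi>_def by measurable

lemma \<xi>_mean: "(LINT y|law. \<xi> y) = 0"
  unfolding \<xi>_def using moment_ln moment_powr by simp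

text \<open>In terms of variances: ln |Y| contributes \<psi>' / p^2, |Y|^p contributes 1 / p, and
  their covariance is also 1 / p, which leaves \<psi>' / p^2 + 1 / p - 2 / p.\<close>

lemma \<xi>_sq: "integrable law (\<lambda>y. (\<xi> y)\<^sup>2)" "(LINT y|law. (\<xi> y)\<^sup>2) = (\<psi>' - p) / p\<^sup>2"
proof -
  define c where "c = \<psi> / p - 1 / p"
  have e: "(\<xi> y)\<^sup>2 = (ln \<bar>y\<bar>)\<^sup>2 + (\<bar>y\<bar> powr p)\<^sup>2 + c\<^sup>2 - 2 * (\<bar>y\<bar> powr p * ln \<bar>y\<bar>) - 2 * c * ln \<bar>y\<bar> + 2 * c * (\<bar>y\<bar> powr p)" for y
  proof -
    have e1: "\<xi> y = ln \<bar>y\<bar> - \<bar>y\<bar> powr p - c" by (simp add: \<xi>_def c_def)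
    show ?thesis unfolding e1 by (simp add: power2_eq_square algebra_simps)
  qed
  note I = moment_ln(1) moment_ln_sq(1) moment_powr(1) moment_powr_sq(1) moment_powr_ln(1)
  show "integrable law (\<lambda>y. (\<xi> y)\<^sup>2)" unfolding e using I by auto
  have "(LINT y|law. (\<xi> y)\<^sup>2) = (\<psi>\<^sup>2 + \<psi>') / p\<^sup>2 + (1 / p + 1) / p + c\<^sup>2 - 2 * ((\<psi> + p) / p\<^sup>2) - 2 * c * (\<psi> / p) + 2 * c * (1 / p)"
    unfolding e using I by (simp add: moment_ln(2) moment_ln_sq(2) moment_powr(2) moment_powr_sq(2) moment_powr_ln(2))
  also have "\<dots> = (\<psi>' - p) / p\<^sup>2"
    unfolding c_def using p0 by (simp add: power2_eq_square field_simps)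
  finally show "(LINT y|law. (\<xi> y)\<^sup>2) = (\<psi>' - p) / p\<^sup>2" .
qed

lemma interval_not_null:
  assumes "c > (0::real)" "AE y in law. y \<notin> {0<..<c}"
  shows False
proof -
  have "AE y in lborel. y \<notin> {0<..<c}" using assms(2) by (simp only: AE_law)
  then have "emeasure lborel {0<..<c} = 0" by (subst (asm) AE_iff_measurable[of "{0<..<c}"]) auto
  then show False using assms(1) by simp
qed

text \<open>The radicand is p^2 times the second moment of \<xi>, hence positive once \<xi> is
  nonzero with positive probability.\<close>

lemma variance_positive': "\<psi>' - p > 0"
proof -
  have "(LINT y|law. (\<xi> y)\<^sup>2) \<noteq> 0"
  proof
    assume "(LINT y|law. (\<xi> y)\<^sup>2) = 0"
    then have "AE y in law. (\<xi> y)\<^sup>2 = 0" using \<xi>_sq(1) by (subst (asm) integral_nonneg_eq_0_iff_AE) auto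
    \<comment> \<open>Below this bound ln y - \<psi> / p + 1 / p is already negative, and
      subtracting y^p keeps it so.\<close>
    moreover have "\<xi> y \<noteq> 0" if "y \<in> {0<..<exp (\<psi> / p - 1 / p)}" for y
    proof -
      have "ln y < ln (exp (\<psi> / p - 1 / p))" using that by (subst ln_less_cancel_iff) auto
      moreover have "y powr p \<ge> 0" by simp
      moreover have "\<bar>y\<bar> = y" using that by simp
      ultimately have "\<xi> y < 0" unfolding \<xi>_def ln_exp by linarith
      then show ?thesis by simp
    qed
    ultimately have "AE y in law. y \<notin> {0<..<exp (\<psi> / p - 1 / p)}" by (auto elim!: eventually_mono)
    then show False by (rule interval_not_null[rotated]) simp
  qed
  moreover have "(LINT y|law. (\<xi> y)\<^sup>2) \<ge> 0" by simp
  ultimately have "(\<psi>' - p) / p\<^sup>2 > 0" using \<xi>_sq(2) by linarith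
  then show ?thesis using p0 by (simp add: zero_less_divide_iff)
qed

text \<open>Strict Jensen inequality for ln at u = p * |Y|^p, which has mean 1: the integral of u -
  1 - ln u is positive and equals - p * m_exponent p.\<close>

lemma m_exponent_neg: "m_exponent p < 0"
proof -
  define h where "h y = p * \<bar>y\<bar> powr p - 1 - (ln p + p * ln \<bar>y\<bar>)" for y
  have hi: "integrable law h" unfolding h_def using moment_ln(1) moment_powr(1) by auto
  have hE: "(LINT y|law. h y) = - (ln p + \<psi>)"
    unfolding h_def using moment_ln moment_powr p0 by simp
  have h: "h y = (p * \<bar>y\<bar> powr p - 1) - ln (p * \<bar>y\<bar> powr p)" if "y \<noteq> 0" for y
    using that p0 by (simp add: h_def ln_mult ln_powr)
  have ge: "h y \<ge> 0" if "y \<noteq> 0" for y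
    using h[OF that] ln_le_minus_one[of "p * \<bar>y\<bar> powr p"] that p0 by simp
  have ne: "AE y in law. y \<noteq> 0" using AE_lborel_singleton[of "0::real"] by (simp only: AE_law)
  have nn: "AE y in law. h y \<ge> 0" using ne by eventually_elim (rule ge)
  have "(LINT y|law. h y) \<noteq> 0"
  proof
    assume "(LINT y|law. h y) = 0"
    then have "AE y in law. h y = 0" using hi nn by (subst (asm) integral_nonneg_eq_0_iff_AE) auto
    \<comment> \<open>On this interval u < 1, so ln u < u - 1 is strict.\<close>
    moreover have "h y \<noteq> 0" if y: "y \<in> {0<..<(1 / p) powr (1 / p)}" for y
    proof
      assume "h y = 0"
      then have "ln (p * \<bar>y\<bar> powr p) = p * \<bar>y\<bar> powr p - 1" using h[of y] y by simp
      then have "p * \<bar>y\<bar> powr p = 1" using y p0 by (intro ln_eq_minus_one) auto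
      moreover have "y powr p < ((1 / p) powr (1 / p)) powr p" using y p0 by (intro powr_less_mono2) auto
      then have "y powr p < 1 / p" using p0 by (simp add: powr_powr)
      ultimately show False using y p0 by (simp add: field_simps)
    qed
    ultimately have "AE y in law. y \<notin> {0<..<(1 / p) powr (1 / p)}" by (auto elim!: eventually_mono)
    then show False by (rule interval_not_null[rotated]) (use p0 in simp)
  qed
  moreover have "(LINT y|law. h y) \<ge> 0" using nn by (rule integral_nonneg_AE)
  ultimately have "ln p + \<psi> < 0" using hE by linarith
  then show ?thesis using p0 by (simp add: m_exponent_def divide_less_0_iff add.commute)
qed

text \<open>The joint density factorises because \<open>p_sum\<close> is a sum over the coordinates;
  comparison on boxes then suffices.\<close>

lemma prod_law: "(\<Pi>\<^sub>M i\<in>{1..n}. law) = density (lborel_Rn n) (\<lambda>y. gauss_weight p n y / ennreal (Z ^ n))"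
proof -
  interpret L: product_sigma_finite "\<lambda>_::nat. law"
    by standard
  let ?V = "lborel_Rn n" and ?w = "\<lambda>y. ennreal (exp (- (\<bar>y\<bar> powr p)) / Z)"
  have w: "gauss_weight p n y / ennreal (Z ^ n) = (\<Prod>i\<in>{1..n}. ?w (y i))" for y
  proof -
    have "(\<Prod>i\<in>{1..n}. ?w (y i)) = ennreal (\<Prod>i\<in>{1..n}. exp (- (\<bar>y i\<bar> powr p)) / Z)"
      using Z_pos by (intro prod_ennreal) auto
    also have "(\<Prod>i\<in>{1..n}. exp (- (\<bar>y i\<bar> powr p)) / Z) = exp (- p_sum p n y) / Z ^ n"
      by (simp add: prod_dividef exp_sum p_sum_def sum_negf[symmetric])
    finally show ?thesis using Z_pos by (simp add: gauss_weight_def divide_ennreal)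
  qed
  have "density ?V (\<lambda>y. gauss_weight p n y / ennreal (Z ^ n)) = (\<Pi>\<^sub>M i\<in>{1..n}. law)"
  proof (rule L.PiM_eqI)
    fix A :: "nat \<Rightarrow> real set" assume A: "\<And>i. i \<in> {1..n} \<Longrightarrow> A i \<in> sets law"
    then have A': "A i \<in> sets borel" if "i \<in> {1..n}" for i using that by (simp add: law_def)
    have box: "Pi\<^sub>E {1..n} A \<in> sets ?V" using A' unfolding lborel_Rn_def by (intro sets_PiM_I_finite) auto
    have "emeasure (density ?V (\<lambda>y. gauss_weight p n y / ennreal (Z ^ n))) (Pi\<^sub>E {1..n} A)
        = (\<integral>\<^sup>+y. gauss_weight p n y / ennreal (Z ^ n) * indicator (Pi\<^sub>E {1..n} A) y \<partial>?V)"
      by (rule emeasure_density) (use box in auto)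
    also have "\<dots> = (\<integral>\<^sup>+y. (\<Prod>i\<in>{1..n}. ?w (y i) * indicator (A i) (y i)) \<partial>?V)"
    proof (rule nn_integral_cong)
      fix y assume y: "y \<in> space ?V"
      have "indicator (Pi\<^sub>E {1..n} A) y = (\<Prod>i\<in>{1..n}. indicator (A i) (y i) :: ennreal)"
      proof (cases "y \<in> Pi\<^sub>E {1..n} A")
        case True
        then have "indicator (A i) (y i) = (1 :: ennreal)" if "i \<in> {1..n}" for i using that by (auto simp: PiE_iff)
        then show ?thesis using True by (simp add: prod.neutral del: One_nat_def)
      next
        case False
        then obtain i where "i \<in> {1..n}" "y i \<notin> A i" using y by (auto simp: space_lborel_Rn PiE_iff)
        then have "(\<Prod>i\<in>{1..n}. indicator (A i) (y i) :: ennreal) = 0" by (intro prod_zero bexI[of _ i]) auto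
        then show ?thesis using False by simp
      qed
      then show "gauss_weight p n y / ennreal (Z ^ n) * indicator (Pi\<^sub>E {1..n} A) y = (\<Prod>i\<in>{1..n}. ?w (y i) * indicator (A i) (y i))"
        unfolding w by (simp only: prod.distrib)
    qed
    also have "\<dots> = (\<Prod>i\<in>{1..n}. \<integral>\<^sup>+y. ?w y * indicator (A i) y \<partial>lborel)"
      unfolding lborel_Rn_def using A' by (intro lborel_product.product_nn_integral_prod) auto
    also have "\<dots> = (\<Prod>i\<in>{1..n}. emeasure law (A i))"
      using A' by (intro prod.cong refl) (auto simp: law_def emeasure_density)
    finally show "emeasure (density ?V (\<lambda>y. gauss_weight p n y / ennreal (Z ^ n))) (Pi\<^sub>E {1..n} A) = (\<Prod>i\<in>{1..n}. emeasure law (A i))" .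
  qed (auto simp: law_def sets_lborel_Rn intro!: sets_PiM_cong)
  then show ?thesis ..
qed

lemma measurable_prod_law: "measurable (\<Pi>\<^sub>M i\<in>{1..n}. law) N = measurable (lborel_Rn n) N"
  by (rule measurable_cong_sets) (simp_all only: prod_law sets_density)

lemma gauss_integral:
  assumes f: "f \<in> borel_measurable (lborel_Rn n)"
  shows "(\<integral>\<^sup>+y. f y * gauss_weight p n y \<partial>lborel_Rn n) = ennreal (Z ^ n) * (\<integral>\<^sup>+\<omega>. f (restrict \<omega> {1..n}) \<partial>\<Omega>)"
proof -
  let ?V = "lborel_Rn n"
  have f': "f \<in> borel_measurable (\<Pi>\<^sub>M i\<in>{1..n}. law)" using f by (simp only: measurable_prod_law)
  have "(\<integral>\<^sup>+\<omega>. f (restrict \<omega> {1..n}) \<partial>\<Omega>) = (\<integral>\<^sup>+y. f y \<partial>distr \<Omega> (\<Pi>\<^sub>M i\<in>{1..n}. law) (\<lambda>\<omega>. restrict \<omega> {1..n}))"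
    by (rule nn_integral_distr[symmetric, OF restrict_\<Omega>(1)]) (use f' in simp)
  also have "\<dots> = (\<integral>\<^sup>+y. f y \<partial>density ?V (\<lambda>y. gauss_weight p n y / ennreal (Z ^ n)))"
    unfolding restrict_\<Omega>(2) prod_law[symmetric] ..
  also have "\<dots> = (\<integral>\<^sup>+y. gauss_weight p n y / ennreal (Z ^ n) * f y \<partial>?V)"
    using f by (intro nn_integral_density) auto
  finally have "ennreal (Z ^ n) * (\<integral>\<^sup>+\<omega>. f (restrict \<omega> {1..n}) \<partial>\<Omega>) = (\<integral>\<^sup>+y. ennreal (Z ^ n) * (gauss_weight p n y / ennreal (Z ^ n) * f y) \<partial>?V)"
    using f by (simp add: nn_integral_cmult)
  also have "\<dots> = (\<integral>\<^sup>+y. f y * gauss_weight p n y \<partial>?V)"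
  proof (rule nn_integral_cong)
    fix y
    have "ennreal (Z ^ n) * (gauss_weight p n y / ennreal (Z ^ n)) = gauss_weight p n y"
      using Z_pos by (simp add: gauss_weight_def divide_ennreal ennreal_mult[symmetric])
    then show "ennreal (Z ^ n) * (gauss_weight p n y / ennreal (Z ^ n) * f y) = f y * gauss_weight p n y"
      by (metis mult.assoc mult.commute)
  qed
  finally show ?thesis ..
qed

end

section \<open>Central limit theorem for the ratio of means\<close>

definition ratio_event :: "real \<Rightarrow> real \<Rightarrow> nat \<Rightarrow> (nat \<Rightarrow> real) \<Rightarrow> bool" where
  "ratio_event p a n y \<longleftrightarrow> (\<Prod>i=1..n. \<bar>y i\<bar>) powr (1 / real n) \<ge>
     exp (m_exponent p) * (1 + a / sqrt (real n)) * ((1 / real n) * (\<Sum>i=1..n. \<bar>y i\<bar> powr p)) powr (1 / p)"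

lemma ratio_event_cong:
  assumes "\<And>i. i \<in> {1..n} \<Longrightarrow> y i = z i"
  shows "ratio_event p a n y \<longleftrightarrow> ratio_event p a n z"
proof -
  have "(\<Prod>i=1..n. \<bar>y i\<bar>) = (\<Prod>i=1..n. \<bar>z i\<bar>)" "(\<Sum>i=1..n. \<bar>y i\<bar> powr p) = (\<Sum>i=1..n. \<bar>z i\<bar> powr p)"
    using assms by (auto intro!: prod.cong sum.cong)
  then show ?thesis by (simp only: ratio_event_def)
qed

text \<open>The geometric mean and the p-mean are both homogeneous of degree 1.\<close>

lemma cone_event_ratio:
  assumes p: "p > 0" and n: "n \<ge> 1"
  shows "cone_event n {y \<in> Rn n. ratio_event p a n y}"
  unfolding cone_event_def
proof (intro conjI allI impI ballI)
  show "{y \<in> Rn n. ratio_event p a n y} \<in> sets (lborel_Rn n)"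
    unfolding ratio_event_def by measurable
  fix r :: real and x assume r: "r > 0" and x: "x \<in> Rn n"
  have 1: "(\<Prod>i=1..n. \<bar>scale_Rn n r x i\<bar>) powr (1 / real n) = r * (\<Prod>i=1..n. \<bar>x i\<bar>) powr (1 / real n)"
  proof -
    have "(\<Prod>i=1..n. \<bar>scale_Rn n r x i\<bar>) = (\<Prod>i=1..n. r * \<bar>x i\<bar>)"
      using r by (intro prod.cong) (auto simp: scale_Rn_def abs_mult)
    also have "\<dots> = r ^ n * (\<Prod>i=1..n. \<bar>x i\<bar>)" by (simp add: prod.distrib)
    finally have "(\<Prod>i=1..n. \<bar>scale_Rn n r x i\<bar>) powr (1 / real n) = (r ^ n) powr (1 / real n) * (\<Prod>i=1..n. \<bar>x i\<bar>) powr (1 / real n)"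
      using r by (simp add: powr_mult prod_nonneg)
    also have "(r ^ n) powr (1 / real n) = r" using r n by (simp add: powr_realpow[symmetric] powr_powr)
    finally show ?thesis .
  qed
  have 2: "((1 / real n) * (\<Sum>i=1..n. \<bar>scale_Rn n r x i\<bar> powr p)) powr (1 / p) = r * ((1 / real n) * (\<Sum>i=1..n. \<bar>x i\<bar> powr p)) powr (1 / p)"
  proof -
    have "(\<Sum>i=1..n. \<bar>scale_Rn n r x i\<bar> powr p) = r powr p * (\<Sum>i=1..n. \<bar>x i\<bar> powr p)"
      using p_sum_scale[of p n r x] r by (simp add: p_sum_def)
    then have "((1 / real n) * (\<Sum>i=1..n. \<bar>scale_Rn n r x i\<bar> powr p)) powr (1 / p) = (r powr p * ((1 / real n) * (\<Sum>i=1..n. \<bar>x i\<bar> powr p))) powr (1 / p)"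
      by (simp add: mult_ac)
    also have "\<dots> = (r powr p) powr (1 / p) * ((1 / real n) * (\<Sum>i=1..n. \<bar>x i\<bar> powr p)) powr (1 / p)"
      by (rule powr_mult)
    also have "(r powr p) powr (1 / p) = r" using r p by (simp add: powr_powr)
    finally show ?thesis .
  qed
  have "ratio_event p a n (scale_Rn n r x) \<longleftrightarrow> r * (exp (m_exponent p) * (1 + a / sqrt (real n)) * ((1 / real n) * (\<Sum>i=1..n. \<bar>x i\<bar> powr p)) powr (1 / p)) \<le> r * (\<Prod>i=1..n. \<bar>x i\<bar>) powr (1 / real n)"
    unfolding ratio_event_def 1 2 by (simp add: mult_ac)
  also have "\<dots> \<longleftrightarrow> ratio_event p a n x" using r by (simp only: mult_le_cancel_left_pos ratio_event_def)
  finally show "scale_Rn n r x \<in> {y \<in> Rn n. ratio_event p a n y} \<longleftrightarrow> x \<in> {y \<in> Rn n. ratio_event p a n y}"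
    using x by simp
qed

text \<open>This is the derivative of ln (1 + a h) at h = 0, taken along h = 1 / sqrt n.\<close>

lemma sqrt_ln_limit: "(\<lambda>n. sqrt (real n) * ln (1 + a / sqrt (real n))) \<longlonglongrightarrow> a"
proof -
  have "((\<lambda>h. ln (1 + a * h)) has_real_derivative a) (at 0)" by (auto intro!: derivative_eq_intros)
  then have lim: "((\<lambda>h. ln (1 + a * h) / h) \<longlongrightarrow> a) (at 0)" by (simp add: DERIV_def)
  \<comment> \<open>The index starts at 1 so that the increment is never the default value 1 / 0 =
    0.\<close>
  have "filterlim (\<lambda>n. 1 / sqrt (real (Suc n))) (at 0) sequentially"
  proof (rule filterlim_atI)
    have "filterlim (\<lambda>n. sqrt (real (Suc n))) at_top sequentially"
      by (rule filterlim_compose[OF sqrt_at_top])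
        (intro filterlim_compose[OF filterlim_real_sequentially] filterlim_Suc)
    then show "(\<lambda>n. 1 / sqrt (real (Suc n))) \<longlonglongrightarrow> 0"
      by (intro tendsto_divide_0[OF tendsto_const] filterlim_at_top_imp_at_infinity)
  qed auto
  from filterlim_compose[OF lim this]
  have "(\<lambda>n. ln (1 + a * (1 / sqrt (real (Suc n)))) / (1 / sqrt (real (Suc n)))) \<longlonglongrightarrow> a" .
  then have "(\<lambda>n. sqrt (real (Suc n)) * ln (1 + a / sqrt (real (Suc n)))) \<longlonglongrightarrow> a" by (simp add: mult.commute)
  then show ?thesis by (rule LIMSEQ_imp_Suc)
qed

lemma inverse_sqrt_limit: "(\<lambda>n. c / sqrt (real n)) \<longlonglongrightarrow> 0"
  by (intro tendsto_divide_0[OF tendsto_const] filterlim_at_top_imp_at_infinity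
      filterlim_compose[OF sqrt_at_top filterlim_real_sequentially])

context pgauss
begin

definition \<sigma> :: real where "\<sigma> = sqrt (\<psi>' - p) / p"

lemma \<sigma>_pos: "\<sigma> > 0" using variance_positive' p0 by (simp add: \<sigma>_def)

lemma \<sigma>_sq: "(LINT y|law. (\<xi> y)\<^sup>2) = \<sigma>\<^sup>2"
  using \<xi>_sq(2) variance_positive' by (simp add: \<sigma>_def power_divide)

text \<open>The error of linearising \<open>ln\<close> at \<open>1\<close>, the mean of \<open>u\<close>.\<close>

definition remainder :: "nat \<Rightarrow> (nat \<Rightarrow> real) \<Rightarrow> real" where
  "remainder n \<omega> = (let u = p * ((\<Sum>i=1..n. \<bar>\<omega> i\<bar> powr p) / n) in sqrt n * ((u - 1) - ln u) / p)"

lemma measurable_remainder [measurable]: "remainder n \<in> borel_measurable \<Omega>"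
  unfolding remainder_def Let_def by measurable

text \<open>Both sides of the event are positive, so logarithms may be taken. Multiplying by sqrt n
  makes the linear part a normalised sum, and \<open>remainder\<close> is what the linearisation
  leaves over.\<close>

lemma ratio_event_iff:
  assumes n: "n \<ge> 1" and nz: "\<And>i. i \<in> {1..n} \<Longrightarrow> \<omega> i \<noteq> 0" and pos: "1 + a / sqrt (real n) > 0"
  shows "ratio_event p a n \<omega> \<longleftrightarrow>
    (\<Sum>i=1..n. \<xi> (\<omega> i)) / sqrt n + remainder n \<omega> \<ge> sqrt (real n) * ln (1 + a / sqrt (real n))"
proof -
  define L where "L = (\<Sum>i=1..n. ln \<bar>\<omega> i\<bar>)"
  define W where "W = (\<Sum>i=1..n. \<bar>\<omega> i\<bar> powr p)"
  define P where "P = (\<Prod>i=1..n. \<bar>\<omega> i\<bar>)"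
  have s: "sqrt (real n) > 0" "real n = sqrt (real n) * sqrt (real n)" using n by auto
  have W: "W > 0" unfolding W_def using n nz by (intro sum_pos) auto
  have P: "P > 0" unfolding P_def using nz by (intro prod_pos) auto
  have lnP: "ln P = L" unfolding P_def L_def using nz by (subst ln_prod) auto
  have lu: "ln (p * (W / n)) = ln p + ln (1 / n * W)"
  proof -
    have "p * (W / n) = p * (1 / n * W)" by simp
    moreover have "ln (p * (1 / n * W)) = ln p + ln (1 / n * W)" by (rule ln_mult_pos) (use p0 W n in auto)
    ultimately show ?thesis by (simp only:)
  qed
  have sumxi: "(\<Sum>i=1..n. \<xi> (\<omega> i)) = (L - n * (\<psi> / p)) - (W - n * (1 / p))"
    by (simp add: \<xi>_def sum_subtractf L_def W_def)
  have TR: "(\<Sum>i=1..n. \<xi> (\<omega> i)) / sqrt n + remainder n \<omega> = sqrt n * (L / n - \<psi> / p - ln (p * (W / n)) / p)"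
  proof -
    \<comment> \<open>Stated for a variable in place of sqrt n, so that n = r * r is visible to
      field arithmetic.\<close>
    have gen: "((L - r * r * (\<psi> / p)) - (W - r * r * (1 / p))) / r + r * ((p * (W / (r * r)) - 1) - K) / p
        = r * (L / (r * r) - \<psi> / p - K / p)" if "r > 0" for r K
      using that p0 by (simp add: field_simps)
    show ?thesis
      using gen[OF s(1)] unfolding remainder_def Let_def W_def[symmetric] s(2)[symmetric] sumxi .
  qed
  have "ratio_event p a n \<omega> \<longleftrightarrow> exp (m_exponent p) * (1 + a / sqrt (real n)) * (1 / n * W) powr (1 / p) \<le> P powr (1 / n)"
    by (simp only: ratio_event_def W_def P_def)
  also have "\<dots> \<longleftrightarrow> ln (exp (m_exponent p) * (1 + a / sqrt (real n)) * (1 / n * W) powr (1 / p)) \<le> ln (P powr (1 / n))"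
    using pos W P n by (intro ln_le_cancel_iff[symmetric] mult_pos_pos) auto
  also have "ln (exp (m_exponent p) * (1 + a / sqrt (real n)) * (1 / n * W) powr (1 / p))
      = m_exponent p + ln (1 + a / sqrt (real n)) + ln (1 / n * W) / p"
    using pos W n p0 by (simp add: ln_mult_pos ln_powr ln_mult[of "exp (m_exponent p) * (1 + a / sqrt (real n))"] ln_mult[of "exp (m_exponent p)"] del: times_divide_eq_left) simp
  also have "ln (P powr (1 / n)) = L / n" using P by (simp add: ln_powr lnP)
  also have "m_exponent p + ln (1 + a / sqrt (real n)) + ln (1 / n * W) / p \<le> L / n \<longleftrightarrow>
      ln (1 + a / sqrt (real n)) \<le> L / n - \<psi> / p - ln (p * (W / n)) / p"
    unfolding lu m_exponent_def by (simp add: add_divide_distrib) linarith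
  also have "\<dots> \<longleftrightarrow> sqrt (real n) * ln (1 + a / sqrt (real n)) \<le> sqrt n * (L / n - \<psi> / p - ln (p * (W / n)) / p)"
    using s(1) by (simp only: mult_le_cancel_left_pos)
  finally show ?thesis unfolding TR .
qed

lemma AE_\<Omega>_nonzero: "AE \<omega> in \<Omega>. \<forall>i. \<omega> i \<noteq> 0"
proof (subst AE_all_countable, intro allI)
  fix i
  have "AE y in law. y \<noteq> 0" using AE_lborel_singleton[of "0::real"] by (simp only: AE_law)
  then show "AE \<omega> in \<Omega>. \<omega> i \<noteq> 0"
    unfolding \<Omega>_def by (intro AE_PiM_component[where P = "\<lambda>y. y \<noteq> 0"] law_prob) auto
qed

text \<open>u - 1 is of order 1 / sqrt n in mean square and the linearisation error is quadratic in
  it, so the remainder is of order sqrt n / n. Markov's inequality turns this into smallness in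
  probability.\<close>

lemma remainder_small:
  assumes \<epsilon>: "\<epsilon> > 0"
  shows "(\<lambda>n. \<Omega>.prob {\<omega> \<in> space \<Omega>. \<bar>remainder n \<omega>\<bar> > \<epsilon>}) \<longlonglongrightarrow> 0"
proof -
  let ?f = "\<lambda>y::real. \<bar>y\<bar> powr p"
  have f: "?f \<in> borel_measurable borel" by measurable
  define v where "v = Q.variance ?f"
  have v: "v \<ge> 0" unfolding v_def by (rule Q.variance_positive)
  define X where "X n \<omega> = ((\<Sum>i=1..n. \<bar>\<omega> i\<bar> powr p) / n - 1 / p)\<^sup>2" for n :: nat and \<omega> :: "nat \<Rightarrow> real"
  note ms = mean_square_average[OF f moment_powr_sq(1), unfolded moment_powr(2), folded X_def]
  \<comment> \<open>The level of \<open>X\<close> at which the bound 2 * p * sqrt n * X on the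
    remainder reaches \<epsilon>.\<close>
  define t where "t n = \<epsilon> / (2 * p * sqrt (real n))" for n :: nat
  have tl: "t \<longlonglongrightarrow> 0"
    using inverse_sqrt_limit[of "\<epsilon> / (2 * p)"] by (simp add: t_def[abs_def])
  \<comment> \<open>Below this level h = u - 1 satisfies |h| \<le> 1 / 2, where |ln (1 + h) - h|
    \<le> 2 * h^2 holds.\<close>
  have "eventually (\<lambda>n. t n < 1 / (4 * p\<^sup>2)) sequentially"
    using tl p0 by (intro order_tendstoD(2)) auto
  then have bound: "eventually (\<lambda>n. \<Omega>.prob {\<omega> \<in> space \<Omega>. \<bar>remainder n \<omega>\<bar> > \<epsilon>} \<le> (2 * p * v / \<epsilon>) / sqrt n) sequentially"
    using eventually_ge_at_top[of 1]
  proof eventually_elim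
    case (elim n)
    have s: "sqrt (real n) > 0" "real n = sqrt (real n) * sqrt (real n)" using elim(2) by auto
    have t0: "t n > 0" using s \<epsilon> p0 by (simp add: t_def)
    have "X n \<omega> \<ge> t n" if R: "\<bar>remainder n \<omega>\<bar> > \<epsilon>" for \<omega>
    proof (rule ccontr)
      assume "\<not> X n \<omega> \<ge> t n"
      then have Xt: "X n \<omega> < t n" by simp
      define h where "h = p * ((\<Sum>i=1..n. \<bar>\<omega> i\<bar> powr p) / n) - 1"
      have "h = p * ((\<Sum>i=1..n. \<bar>\<omega> i\<bar> powr p) / n - 1 / p)" using p0 by (simp add: h_def right_diff_distrib)
      then have h2: "h\<^sup>2 = p\<^sup>2 * X n \<omega>" by (simp add: X_def power_mult_distrib)
      have "p\<^sup>2 * X n \<omega> < p\<^sup>2 * (1 / (4 * p\<^sup>2))" using Xt elim(1) p0 by (intro mult_strict_left_mono) auto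
      also have "p\<^sup>2 * (1 / (4 * p\<^sup>2)) = (1 / 2)\<^sup>2" using p0 by (simp add: power2_eq_square)
      finally have "h\<^sup>2 \<le> (1 / 2)\<^sup>2" unfolding h2 by (rule less_imp_le)
      then have "\<bar>h\<bar> \<le> \<bar>1 / 2\<bar>" unfolding abs_le_square_iff .
      then have "\<bar>h\<bar> \<le> 1 / 2" by simp
      then have "\<bar>ln (1 + h) - h\<bar> \<le> 2 * h\<^sup>2" by (rule abs_ln_one_plus_x_minus_x_bound)
      then have "sqrt n * \<bar>h - ln (1 + h)\<bar> / p \<le> sqrt n * (2 * h\<^sup>2) / p"
        using p0 s by (intro divide_right_mono mult_left_mono) auto
      moreover have "\<bar>remainder n \<omega>\<bar> = sqrt n * \<bar>h - ln (1 + h)\<bar> / p"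
        using p0 s by (simp add: remainder_def Let_def h_def abs_mult abs_divide)
      ultimately have "\<epsilon> < sqrt n * (2 * h\<^sup>2) / p" using R by linarith
      also have "\<dots> = 2 * p * sqrt n * X n \<omega>" unfolding h2 using p0 by (simp add: power2_eq_square)
      also have "\<dots> < 2 * p * sqrt n * t n" using Xt p0 s by (intro mult_strict_left_mono) auto
      also have "\<dots> = \<epsilon>" using p0 s by (simp add: t_def)
      finally show False by simp
    qed
    then have "\<Omega>.prob {\<omega> \<in> space \<Omega>. \<bar>remainder n \<omega>\<bar> > \<epsilon>} \<le> \<Omega>.prob {\<omega> \<in> space \<Omega>. X n \<omega> \<ge> t n}"
      using borel_measurable_integrable[OF ms(1)[OF elim(2)]] by (intro \<Omega>.finite_measure_mono) auto
    also have "\<dots> \<le> (LINT \<omega>|\<Omega>. X n \<omega>) / t n"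
      by (rule integral_Markov_inequality_measure[OF ms(1)[OF elim(2)], of "{}"]) (auto simp: X_def t0)
    also have "(LINT \<omega>|\<Omega>. X n \<omega>) = v / n" using ms(2)[OF elim(2)] by (simp add: v_def moment_powr(2))
    also have "v / n / t n = (2 * p * v / \<epsilon>) / sqrt n"
    proof -
      have gen: "v / (r * r) / (\<epsilon> / (2 * p * r)) = (2 * p * v / \<epsilon>) / r" if "r > 0" for r
        using that p0 \<epsilon> by (simp add: field_simps)
      show ?thesis using gen[OF s(1)] unfolding t_def s(2)[symmetric] .
    qed
    finally show ?case .
  qed
  show ?thesis
    by (rule tendsto_sandwich[OF always_eventually bound tendsto_const inverse_sqrt_limit]) auto
qed

lemma ratio_prob_limit:
  "(\<lambda>n. \<Omega>.prob {\<omega> \<in> space \<Omega>. ratio_event p a n \<omega>}) \<longlonglongrightarrow> 1 - cdf std_normal_distribution (a / \<sigma>)"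
proof -
  let ?T = "\<lambda>n \<omega>. (\<Sum>i=1..n. \<xi> (\<omega> i)) / sqrt (real n)"
  have T: "?T n \<in> borel_measurable \<Omega>" for n
    by (intro borel_measurable_divide borel_measurable_sum measurable_compose[OF coord_\<Omega>_borel measurable_\<xi>]) auto
  have "isCont (\<lambda>c. 1 - cdf std_normal_distribution (c / \<sigma>)) a"
    using \<sigma>_pos by (intro continuous_intros isCont_o2[OF _ isCont_cdf_std_normal]) auto
  then have lim: "(\<lambda>n. \<Omega>.prob {\<omega> \<in> space \<Omega>. ?T n \<omega> + remainder n \<omega> \<ge> sqrt (real n) * ln (1 + a / sqrt (real n))})
      \<longlonglongrightarrow> 1 - cdf std_normal_distribution (a / \<sigma>)"
    by (intro \<Omega>.slutsky_tail[where F = "\<lambda>c. 1 - cdf std_normal_distribution (c / \<sigma>)"] T measurable_remainder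
        clt_tail measurable_\<xi> \<xi>_sq(1) \<xi>_mean \<sigma>_sq \<sigma>_pos sqrt_ln_limit remainder_small)
  \<comment> \<open>For negative \<open>a\<close> the factor 1 + a / sqrt n may fail to be positive
    at small \<open>n\<close>, and then the logarithm is of no use.\<close>
  have "eventually (\<lambda>n. a / sqrt (real n) > -1) sequentially"
    using inverse_sqrt_limit[of a] by (intro order_tendstoD(1)) auto
  then have "eventually (\<lambda>n. \<Omega>.prob {\<omega> \<in> space \<Omega>. ?T n \<omega> + remainder n \<omega> \<ge> sqrt (real n) * ln (1 + a / sqrt (real n))}
      = \<Omega>.prob {\<omega> \<in> space \<Omega>. ratio_event p a n \<omega>}) sequentially"
    using eventually_ge_at_top[of 1]
  proof eventually_elim
    case (elim n)
    show ?case
    proof (rule \<Omega>.finite_measure_eq_AE)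
      show "AE \<omega> in \<Omega>. (\<omega> \<in> {\<omega> \<in> space \<Omega>. ?T n \<omega> + remainder n \<omega> \<ge> sqrt (real n) * ln (1 + a / sqrt (real n))}) =
          (\<omega> \<in> {\<omega> \<in> space \<Omega>. ratio_event p a n \<omega>})"
        using AE_\<Omega>_nonzero
      proof eventually_elim
        case (elim \<omega>)
        then show ?case using ratio_event_iff[of n \<omega> a] \<open>n \<ge> 1\<close> \<open>a / sqrt (real n) > -1\<close> by auto
      qed
      show "{\<omega> \<in> space \<Omega>. ?T n \<omega> + remainder n \<omega> \<ge> sqrt (real n) * ln (1 + a / sqrt (real n))} \<in> sets \<Omega>"
        using T[of n] by measurable
      show "{\<omega> \<in> space \<Omega>. ratio_event p a n \<omega>} \<in> sets \<Omega>" unfolding ratio_event_def by measurable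
    qed
  qed
  with lim show ?thesis by (rule Lim_transform_eventually)
qed

end

section \<open>The surface weight is asymptotically constant\<close>

context pgauss
begin

definition grad_moment :: "real \<Rightarrow> real" where
  "grad_moment y = \<bar>y\<bar> powr (2 * p - 2)"

lemma measurable_grad_moment [measurable]: "grad_moment \<in> borel_measurable borel"
  unfolding grad_moment_def by measurable

definition \<gamma> :: real where "\<gamma> = sqrt (LINT y|law. grad_moment y)"

lemma grad_moment_integrable: "integrable law grad_moment" "integrable law (\<lambda>y. (grad_moment y)\<^sup>2)"
proof -
  have e: "grad_moment y = \<bar>y\<bar> powr (2 * p - 2) * ln \<bar>y\<bar> ^ 0" for y by (simp add: grad_moment_def)
  show "integrable law grad_moment"
    by (rule law_integral(1)[OF measurable_grad_moment _ e]) (use p1 in simp)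
  have e2: "(grad_moment y)\<^sup>2 = \<bar>y\<bar> powr (4 * p - 4) * ln \<bar>y\<bar> ^ 0" for y
    by (simp add: grad_moment_def power2_eq_square powr_add[symmetric])
  show "integrable law (\<lambda>y. (grad_moment y)\<^sup>2)"
    by (rule law_integral(1)[OF _ _ e2]) (use p1 in auto)
qed

lemma \<gamma>_pos: "\<gamma> > 0" "\<gamma>\<^sup>2 = (LINT y|law. grad_moment y)"
proof -
  have nn: "(LINT y|law. grad_moment y) \<ge> 0" by (rule integral_nonneg_AE) (simp add: grad_moment_def)
  have "(LINT y|law. grad_moment y) \<noteq> 0"
  proof
    assume "(LINT y|law. grad_moment y) = 0"
    then have "AE y in law. grad_moment y = 0"
      using grad_moment_integrable(1) by (subst (asm) integral_nonneg_eq_0_iff_AE) (auto simp: grad_moment_def)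
    then have "AE y in law. y \<notin> {0<..<1}" by eventually_elim (auto simp: grad_moment_def)
    then show False by (rule interval_not_null[rotated]) simp
  qed
  with nn show "\<gamma> > 0" "\<gamma>\<^sup>2 = (LINT y|law. grad_moment y)" by (auto simp: \<gamma>_def)
qed

definition grad_avg :: "nat \<Rightarrow> (nat \<Rightarrow> real) \<Rightarrow> real" where
  "grad_avg n \<omega> = sqrt ((\<Sum>i=1..n. grad_moment (\<omega> i)) / n)"

lemma grad_norm_eq: "n \<ge> 1 \<Longrightarrow> grad_norm p n y = sqrt n * grad_avg n y"
  by (simp add: grad_norm_def grad_avg_def grad_moment_def real_sqrt_divide)

lemma measurable_sum_grad [measurable]: "(\<lambda>\<omega>. \<Sum>i=1..n. grad_moment (\<omega> i)) \<in> borel_measurable \<Omega>"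
  by (intro borel_measurable_sum measurable_compose[OF coord_\<Omega>_borel measurable_grad_moment])

lemma measurable_grad_avg [measurable]: "grad_avg n \<in> borel_measurable \<Omega>"
  unfolding grad_avg_def by measurable

lemma grad_avg_nonneg: "grad_avg n \<omega> \<ge> 0"
  unfolding grad_avg_def by (intro real_sqrt_ge_zero divide_nonneg_nonneg sum_nonneg) (auto simp: grad_moment_def)

text \<open>Dividing by grad_avg + \<gamma> \<ge> \<gamma> bounds the error by |X| / \<gamma>, and
  |X| \<le> (1 / sqrt n + sqrt n * X^2) / 2 trades the first moment for the second. The mean of X^2
  is the variance over \<open>n\<close>, so both terms are of order 1 / sqrt n.\<close>

lemma grad_avg_L1:
  assumes n: "n \<ge> 1"
  defines "\<delta> \<equiv> (1 + Q.variance grad_moment) / (2 * \<gamma> * sqrt (real n))"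
  shows "integrable \<Omega> (grad_avg n)" "(LINT \<omega>|\<Omega>. \<bar>grad_avg n \<omega> - \<gamma>\<bar>) \<le> \<delta>"
proof -
  define X where "X \<omega> = (\<Sum>i=1..n. grad_moment (\<omega> i)) / n - \<gamma>\<^sup>2" for \<omega>
  have s: "sqrt (real n) > 0" "real n = sqrt (real n) * sqrt (real n)" using n by auto
  note ms = mean_square_average[OF measurable_grad_moment grad_moment_integrable(2) n, folded \<gamma>_pos(2), folded X_def]
  have Xm: "X \<in> borel_measurable \<Omega>" unfolding X_def by measurable
  have X2: "\<bar>X \<omega>\<bar> \<le> (1 / sqrt n + sqrt n * (X \<omega>)\<^sup>2) / 2" for \<omega>
  proof -
    define r where "r = sqrt (real n)"
    have "0 \<le> (1 - r * \<bar>X \<omega>\<bar>)\<^sup>2" by simp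
    also have "\<dots> = 1 - 2 * r * \<bar>X \<omega>\<bar> + r * r * (X \<omega>)\<^sup>2" by (simp add: power2_eq_square algebra_simps abs_mult_self_eq)
    finally have "2 * r * \<bar>X \<omega>\<bar> \<le> 1 + r * r * (X \<omega>)\<^sup>2" by simp
    then show ?thesis using s(1) unfolding r_def[symmetric] by (simp add: field_simps)
  qed
  have Bi: "integrable \<Omega> (\<lambda>\<omega>. (1 / sqrt n + sqrt n * (X \<omega>)\<^sup>2) / 2)" using ms(1) by auto
  have diff: "\<bar>grad_avg n \<omega> - \<gamma>\<bar> \<le> (1 / sqrt n + sqrt n * (X \<omega>)\<^sup>2) / 2 / \<gamma>" for \<omega>
  proof -
    have "(grad_avg n \<omega>)\<^sup>2 = (\<Sum>i=1..n. grad_moment (\<omega> i)) / n"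
      unfolding grad_avg_def by (intro real_sqrt_pow2 divide_nonneg_nonneg sum_nonneg) (auto simp: grad_moment_def)
    then have "X \<omega> = (grad_avg n \<omega> - \<gamma>) * (grad_avg n \<omega> + \<gamma>)" by (simp add: X_def power2_eq_square algebra_simps)
    then have "\<bar>X \<omega>\<bar> = \<bar>grad_avg n \<omega> - \<gamma>\<bar> * (grad_avg n \<omega> + \<gamma>)"
      using grad_avg_nonneg[of n \<omega>] \<gamma>_pos(1) by (simp add: abs_mult)
    moreover have "\<bar>grad_avg n \<omega> - \<gamma>\<bar> * \<gamma> \<le> \<bar>grad_avg n \<omega> - \<gamma>\<bar> * (grad_avg n \<omega> + \<gamma>)"
      using grad_avg_nonneg[of n \<omega>] by (intro mult_left_mono) auto
    ultimately have "\<bar>grad_avg n \<omega> - \<gamma>\<bar> * \<gamma> \<le> (1 / sqrt n + sqrt n * (X \<omega>)\<^sup>2) / 2" using X2[of \<omega>] by linarith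
    then show ?thesis using \<gamma>_pos(1) by (simp add: pos_le_divide_eq)
  qed
  have Di: "integrable \<Omega> (\<lambda>\<omega>. grad_avg n \<omega> - \<gamma>)"
  proof (rule Bochner_Integration.integrable_bound)
    show "integrable \<Omega> (\<lambda>\<omega>. (1 / sqrt n + sqrt n * (X \<omega>)\<^sup>2) / 2 / \<gamma>)" by (rule integrable_divide_zero) (rule Bi)
    show "AE \<omega> in \<Omega>. norm (grad_avg n \<omega> - \<gamma>) \<le> norm ((1 / sqrt n + sqrt n * (X \<omega>)\<^sup>2) / 2 / \<gamma>)"
    proof (rule AE_I2)
      fix \<omega>
      have "norm (grad_avg n \<omega> - \<gamma>) \<le> (1 / sqrt n + sqrt n * (X \<omega>)\<^sup>2) / 2 / \<gamma>" using diff[of \<omega>] by simp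
      also have "\<dots> \<le> norm ((1 / sqrt n + sqrt n * (X \<omega>)\<^sup>2) / 2 / \<gamma>)" unfolding real_norm_def by (rule abs_ge_self)
      finally show "norm (grad_avg n \<omega> - \<gamma>) \<le> norm ((1 / sqrt n + sqrt n * (X \<omega>)\<^sup>2) / 2 / \<gamma>)" .
    qed
  qed measurable
  have "integrable \<Omega> (\<lambda>\<omega>. (grad_avg n \<omega> - \<gamma>) + \<gamma>)" using Di by (rule Bochner_Integration.integrable_add) simp
  then show "integrable \<Omega> (grad_avg n)" by simp
  have "(LINT \<omega>|\<Omega>. \<bar>grad_avg n \<omega> - \<gamma>\<bar>) \<le> (LINT \<omega>|\<Omega>. (1 / sqrt n + sqrt n * (X \<omega>)\<^sup>2) / 2 / \<gamma>)"
  proof (rule integral_mono)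
    show "integrable \<Omega> (\<lambda>\<omega>. \<bar>grad_avg n \<omega> - \<gamma>\<bar>)" using Di by (rule integrable_abs)
    show "integrable \<Omega> (\<lambda>\<omega>. (1 / sqrt n + sqrt n * (X \<omega>)\<^sup>2) / 2 / \<gamma>)" by (rule integrable_divide_zero) (rule Bi)
  qed (rule diff)
  also have "\<dots> = (1 / sqrt n + sqrt n * (Q.variance grad_moment / n)) / 2 / \<gamma>"
    using ms by (simp add: \<gamma>_pos(2) \<Omega>.prob_space)
  also have "\<dots> = \<delta>"
  proof -
    have gen: "(1 / r + r * (v / (r * r))) / 2 / \<gamma> = (1 + v) / (2 * \<gamma> * r)" if "r > 0" for r v
      using that \<gamma>_pos(1) by (simp add: field_simps)
    show ?thesis using gen[OF s(1)] unfolding \<delta>_def s(2)[symmetric] .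
  qed
  finally show "(LINT \<omega>|\<Omega>. \<bar>grad_avg n \<omega> - \<gamma>\<bar>) \<le> \<delta>" .
qed

lemma L1_error_limit: "(\<lambda>n. (1 + Q.variance grad_moment) / (2 * \<gamma> * sqrt (real n))) \<longlonglongrightarrow> 0"
  using inverse_sqrt_limit[of "(1 + Q.variance grad_moment) / (2 * \<gamma>)"] by simp

text \<open>The L1 error bounds the effect of replacing \<open>grad_avg\<close> by \<gamma>
  uniformly over all events, so the events may change with \<open>n\<close>.\<close>

lemma grad_avg_event_limit:
  assumes E: "\<And>n. {\<omega> \<in> space \<Omega>. E n \<omega>} \<in> sets \<Omega>"
    and lim: "(\<lambda>n. \<Omega>.prob {\<omega> \<in> space \<Omega>. E n \<omega>}) \<longlonglongrightarrow> L"
  shows "(\<lambda>n. LINT \<omega>|\<Omega>. grad_avg n \<omega> * indicator {\<omega> \<in> space \<Omega>. E n \<omega>} \<omega>) \<longlonglongrightarrow> \<gamma> * L"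
proof -
  let ?A = "\<lambda>n. {\<omega> \<in> space \<Omega>. E n \<omega>}"
  have "(\<lambda>n. (LINT \<omega>|\<Omega>. grad_avg n \<omega> * indicator (?A n) \<omega>) - \<gamma> * \<Omega>.prob (?A n)) \<longlonglongrightarrow> 0"
  proof (rule Lim_null_comparison[OF _ L1_error_limit])
    show "eventually (\<lambda>n. norm ((LINT \<omega>|\<Omega>. grad_avg n \<omega> * indicator (?A n) \<omega>) - \<gamma> * \<Omega>.prob (?A n))
        \<le> (1 + Q.variance grad_moment) / (2 * \<gamma> * sqrt (real n))) sequentially"
      using eventually_ge_at_top[of 1]
    proof eventually_elim
      case (elim n)
      have i1: "integrable \<Omega> (\<lambda>\<omega>. grad_avg n \<omega> * indicator (?A n) \<omega>)"
        using grad_avg_L1(1)[OF elim] E by (rule integrable_real_mult_indicator[rotated])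
      have i2: "integrable \<Omega> (\<lambda>\<omega>. \<gamma> * indicator (?A n) \<omega>)" using E by (simp add: \<Omega>.emeasure_eq_measure)
      have i3: "integrable \<Omega> (\<lambda>\<omega>. \<bar>grad_avg n \<omega> - \<gamma>\<bar>)" using grad_avg_L1(1)[OF elim] by auto
      have eq: "(LINT \<omega>|\<Omega>. grad_avg n \<omega> * indicator (?A n) \<omega>) - \<gamma> * \<Omega>.prob (?A n)
          = (LINT \<omega>|\<Omega>. grad_avg n \<omega> * indicator (?A n) \<omega> - \<gamma> * indicator (?A n) \<omega>)"
        using i1 i2 E by (subst Bochner_Integration.integral_diff) (auto simp: Int_absorb1)
      have "norm ((LINT \<omega>|\<Omega>. grad_avg n \<omega> * indicator (?A n) \<omega>) - \<gamma> * \<Omega>.prob (?A n)) \<le> (LINT \<omega>|\<Omega>. norm (grad_avg n \<omega> * indicator (?A n) \<omega> - \<gamma> * indicator (?A n) \<omega>))"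
        unfolding eq by (rule integral_norm_bound)
      also have "\<dots> \<le> (LINT \<omega>|\<Omega>. \<bar>grad_avg n \<omega> - \<gamma>\<bar>)"
        by (rule integral_mono[OF integrable_norm[OF Bochner_Integration.integrable_diff[OF i1 i2]] i3])
          (auto simp: indicator_def)
      also have "\<dots> \<le> (1 + Q.variance grad_moment) / (2 * \<gamma> * sqrt (real n))" by (rule grad_avg_L1(2)[OF elim])
      finally show ?case .
    qed
  qed
  from tendsto_add[OF this tendsto_mult[OF tendsto_const[of \<gamma>] lim]] show ?thesis by simp
qed

lemma grad_avg_limit: "(\<lambda>n. LINT \<omega>|\<Omega>. grad_avg n \<omega>) \<longlonglongrightarrow> \<gamma>"
proof -
  have "(LINT \<omega>|\<Omega>. grad_avg n \<omega> * indicator {\<omega> \<in> space \<Omega>. True} \<omega>) = (LINT \<omega>|\<Omega>. grad_avg n \<omega>)" for n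
    by (intro Bochner_Integration.integral_cong) auto
  then show ?thesis
    using grad_avg_event_limit[of "\<lambda>_ _. True" 1] by (simp add: \<Omega>.prob_space)
qed

text \<open>The surface mass of the event as a weighted probability, with the common factor Z^n *
  sqrt n of \<open>surface_ratio\<close> cancelled.\<close>

definition surface_prob :: "real \<Rightarrow> nat \<Rightarrow> real" where
  "surface_prob a n = (LINT \<omega>|\<Omega>. grad_avg n \<omega> * indicator {\<omega> \<in> space \<Omega>. ratio_event p a n \<omega>} \<omega>) / (LINT \<omega>|\<Omega>. grad_avg n \<omega>)"

lemma ratio_event_sets: "{\<omega> \<in> space \<Omega>. ratio_event p a n \<omega>} \<in> sets \<Omega>"
  unfolding ratio_event_def by measurable

lemma surface_prob_limit: "surface_prob a \<longlonglongrightarrow> 1 - cdf std_normal_distribution (a / \<sigma>)"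
proof -
  have "(\<lambda>n. (LINT \<omega>|\<Omega>. grad_avg n \<omega> * indicator {\<omega> \<in> space \<Omega>. ratio_event p a n \<omega>} \<omega>) / (LINT \<omega>|\<Omega>. grad_avg n \<omega>))
      \<longlonglongrightarrow> \<gamma> * (1 - cdf std_normal_distribution (a / \<sigma>)) / \<gamma>"
    using \<gamma>_pos(1)
    by (intro tendsto_divide grad_avg_limit grad_avg_event_limit ratio_event_sets ratio_prob_limit) auto
  then show ?thesis using \<gamma>_pos(1) by (simp add: surface_prob_def[abs_def])
qed

lemma ratio_restrict: "ratio_event p a n (restrict \<omega> {1..n}) \<longleftrightarrow> ratio_event p a n \<omega>"
  by (rule ratio_event_cong) simp

lemma gauss_ratio:
  "(\<integral>\<^sup>+y. gauss_weight p n y * indicator {y \<in> Rn n. ratio_event p a n y} y \<partial>lborel_Rn n)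
     = ennreal (Z ^ n) * ennreal (\<Omega>.prob {\<omega> \<in> space \<Omega>. ratio_event p a n \<omega>})"
  "(\<integral>\<^sup>+y. gauss_weight p n y \<partial>lborel_Rn n) = ennreal (Z ^ n)"
proof -
  let ?E = "{y \<in> Rn n. ratio_event p a n y}"
  have E: "?E \<in> sets (lborel_Rn n)" unfolding ratio_event_def by measurable
  have "(\<integral>\<^sup>+y. gauss_weight p n y * indicator ?E y \<partial>lborel_Rn n) = (\<integral>\<^sup>+y. indicator ?E y * gauss_weight p n y \<partial>lborel_Rn n)"
    by (simp add: mult.commute)
  also have "\<dots> = ennreal (Z ^ n) * (\<integral>\<^sup>+\<omega>. indicator ?E (restrict \<omega> {1..n}) \<partial>\<Omega>)"
    by (rule gauss_integral) (use E in simp)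
  also have "(\<integral>\<^sup>+\<omega>. indicator ?E (restrict \<omega> {1..n}) \<partial>\<Omega>) = (\<integral>\<^sup>+\<omega>. indicator {\<omega> \<in> space \<Omega>. ratio_event p a n \<omega>} \<omega> \<partial>\<Omega>)"
    by (intro nn_integral_cong) (simp add: indicator_def ratio_restrict del: One_nat_def)
  also have "\<dots> = ennreal (\<Omega>.prob {\<omega> \<in> space \<Omega>. ratio_event p a n \<omega>})"
    using ratio_event_sets by (simp add: \<Omega>.emeasure_eq_measure)
  finally show "(\<integral>\<^sup>+y. gauss_weight p n y * indicator ?E y \<partial>lborel_Rn n)
     = ennreal (Z ^ n) * ennreal (\<Omega>.prob {\<omega> \<in> space \<Omega>. ratio_event p a n \<omega>})" .
  show "(\<integral>\<^sup>+y. gauss_weight p n y \<partial>lborel_Rn n) = ennreal (Z ^ n)"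
    using gauss_integral[of "\<lambda>_. 1" n] by (simp add: \<Omega>.emeasure_space_1)
qed

lemma surface_ratio:
  assumes n: "n \<ge> 1"
  shows "(\<integral>\<^sup>+y. surface_weight p n y * indicator {y \<in> Rn n. ratio_event p a n y} y \<partial>lborel_Rn n)
     = ennreal (Z ^ n * sqrt n * (LINT \<omega>|\<Omega>. grad_avg n \<omega> * indicator {\<omega> \<in> space \<Omega>. ratio_event p a n \<omega>} \<omega>))"
    "(\<integral>\<^sup>+y. surface_weight p n y \<partial>lborel_Rn n) = ennreal (Z ^ n * sqrt n * (LINT \<omega>|\<Omega>. grad_avg n \<omega>))"
proof -
  have gr: "grad_norm p n (restrict \<omega> {1..n}) = sqrt n * grad_avg n \<omega>" for \<omega>
    unfolding grad_norm_eq[OF n] grad_avg_def by simp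
  have sw: "surface_weight p n y = ennreal (grad_norm p n y) * gauss_weight p n y" for y
  proof -
    have "0 \<le> grad_norm p n y" by (simp add: grad_norm_def sum_nonneg)
    then show ?thesis by (simp add: surface_weight_def gauss_weight_def ennreal_mult)
  qed
  have main: "(\<integral>\<^sup>+y. surface_weight p n y * indicator E y \<partial>lborel_Rn n)
     = ennreal (Z ^ n * sqrt n * (LINT \<omega>|\<Omega>. grad_avg n \<omega> * indicator A \<omega>))"
    if E: "E \<in> sets (lborel_Rn n)" and A: "A \<in> sets \<Omega>" and EA: "\<And>\<omega>. \<omega> \<in> space \<Omega> \<Longrightarrow> restrict \<omega> {1..n} \<in> E \<longleftrightarrow> \<omega> \<in> A" for E A
  proof -
    have i: "integrable \<Omega> (\<lambda>\<omega>. grad_avg n \<omega> * indicator A \<omega>)"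
      using grad_avg_L1(1)[OF n] A by (rule integrable_real_mult_indicator[rotated])
    have "(\<integral>\<^sup>+y. surface_weight p n y * indicator E y \<partial>lborel_Rn n) = (\<integral>\<^sup>+y. (ennreal (grad_norm p n y) * indicator E y) * gauss_weight p n y \<partial>lborel_Rn n)"
      unfolding sw by (simp add: mult_ac)
    also have "\<dots> = ennreal (Z ^ n) * (\<integral>\<^sup>+\<omega>. ennreal (grad_norm p n (restrict \<omega> {1..n})) * indicator E (restrict \<omega> {1..n}) \<partial>\<Omega>)"
      by (rule gauss_integral) (use E in measurable)
    also have "(\<integral>\<^sup>+\<omega>. ennreal (grad_norm p n (restrict \<omega> {1..n})) * indicator E (restrict \<omega> {1..n}) \<partial>\<Omega>)
        = (\<integral>\<^sup>+\<omega>. ennreal (sqrt n) * ennreal (grad_avg n \<omega> * indicator A \<omega>) \<partial>\<Omega>)"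
    proof (rule nn_integral_cong)
      fix \<omega> assume "\<omega> \<in> space \<Omega>"
      then show "ennreal (grad_norm p n (restrict \<omega> {1..n})) * indicator E (restrict \<omega> {1..n}) = ennreal (sqrt n) * ennreal (grad_avg n \<omega> * indicator A \<omega>)"
        unfolding gr indicator_def using EA[of \<omega>] by (simp add: ennreal_mult' del: One_nat_def)
    qed
    also have "\<dots> = ennreal (sqrt n) * (\<integral>\<^sup>+\<omega>. ennreal (grad_avg n \<omega> * indicator A \<omega>) \<partial>\<Omega>)"
      by (rule nn_integral_cmult) (use A in measurable)
    also have "(\<integral>\<^sup>+\<omega>. ennreal (grad_avg n \<omega> * indicator A \<omega>) \<partial>\<Omega>) = ennreal (LINT \<omega>|\<Omega>. grad_avg n \<omega> * indicator A \<omega>)"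
      by (rule nn_integral_eq_integral[OF i]) (simp add: grad_avg_nonneg)
    also have "ennreal (Z ^ n) * (ennreal (sqrt n) * ennreal (LINT \<omega>|\<Omega>. grad_avg n \<omega> * indicator A \<omega>))
        = ennreal (Z ^ n * sqrt n * (LINT \<omega>|\<Omega>. grad_avg n \<omega> * indicator A \<omega>))"
      using Z_pos by (simp add: ennreal_mult' mult.assoc)
    finally show ?thesis .
  qed
  have E: "{y \<in> Rn n. ratio_event p a n y} \<in> sets (lborel_Rn n)" unfolding ratio_event_def by measurable
  show "(\<integral>\<^sup>+y. surface_weight p n y * indicator {y \<in> Rn n. ratio_event p a n y} y \<partial>lborel_Rn n)
     = ennreal (Z ^ n * sqrt n * (LINT \<omega>|\<Omega>. grad_avg n \<omega> * indicator {\<omega> \<in> space \<Omega>. ratio_event p a n \<omega>} \<omega>))"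
    by (rule main[OF E ratio_event_sets]) (simp add: ratio_restrict del: One_nat_def)
  have "(\<integral>\<^sup>+y. surface_weight p n y * indicator (Rn n) y \<partial>lborel_Rn n) = ennreal (Z ^ n * sqrt n * (LINT \<omega>|\<Omega>. grad_avg n \<omega> * indicator (space \<Omega>) \<omega>))"
    by (rule main) (simp_all del: One_nat_def)
  moreover have "(\<integral>\<^sup>+y. surface_weight p n y * indicator (Rn n) y \<partial>lborel_Rn n) = (\<integral>\<^sup>+y. surface_weight p n y \<partial>lborel_Rn n)"
    by (intro nn_integral_cong) auto
  moreover have "(LINT \<omega>|\<Omega>. grad_avg n \<omega> * indicator (space \<Omega>) \<omega>) = (LINT \<omega>|\<Omega>. grad_avg n \<omega>)"
    by (intro Bochner_Integration.integral_cong) auto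
  ultimately show "(\<integral>\<^sup>+y. surface_weight p n y \<partial>lborel_Rn n) = ennreal (Z ^ n * sqrt n * (LINT \<omega>|\<Omega>. grad_avg n \<omega>))" by simp
qed

text \<open>Ball and cone give the first value, surface measure the second, so two sequences cover
  all three distributions. Total mass 1 guarantees that the measures built by
  \<open>measure_of\<close> take their prescribed values.\<close>

lemma measure_ratio_event:
  assumes n: "2 \<le> n" and pos: "(LINT \<omega>|\<Omega>. grad_avg n \<omega>) > 0"
    and D: "D = uniform_p_ball p n \<or> D = cone_measure p n \<or> D = surface_measure p n"
    and prob: "emeasure D (Rn n) = 1"
  shows "measure D {y \<in> Rn n. ratio_event p a n y} = \<Omega>.prob {\<omega> \<in> space \<Omega>. ratio_event p a n \<omega>} \<or>
    measure D {y \<in> Rn n. ratio_event p a n y} = surface_prob a n"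
proof -
  let ?E = "{y \<in> Rn n. ratio_event p a n y}" and ?V = "lborel_Rn n"
  have E: "cone_event n ?E" using n p0 by (intro cone_event_ratio) auto
  then have Es: "?E \<in> sets ?V" by (simp add: cone_event_def)
  have Zn: "Z ^ n > 0" using Z_pos by simp
  have ball: "emeasure ?V (?E \<inter> p_ball p n) / emeasure ?V (p_ball p n) = ennreal (\<Omega>.prob {\<omega> \<in> space \<Omega>. ratio_event p a n \<omega>})"
  proof (subst ball_ratio[OF p1 E])
    show "(\<integral>\<^sup>+y. gauss_weight p n y \<partial>?V) \<noteq> \<infinity>" "(\<integral>\<^sup>+y. gauss_weight p n y \<partial>?V) \<noteq> 0"
      unfolding gauss_ratio using Zn Z_pos by auto
    show "(\<integral>\<^sup>+y. gauss_weight p n y * indicator ?E y \<partial>?V) / (\<integral>\<^sup>+y. gauss_weight p n y \<partial>?V)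
        = ennreal (\<Omega>.prob {\<omega> \<in> space \<Omega>. ratio_event p a n \<omega>})"
      unfolding gauss_ratio using Zn Z_pos by (simp add: ennreal_mult[symmetric] divide_ennreal)
  qed
  from D show ?thesis
  proof (elim disjE)
    assume D: "D = uniform_p_ball p n"
    have "emeasure D ?E = emeasure ?V (p_ball p n \<inter> ?E) / emeasure ?V (p_ball p n)"
      unfolding D uniform_p_ball_def by (rule emeasure_uniform_measure[OF p_ball_sets Es])
    then have "emeasure D ?E = ennreal (\<Omega>.prob {\<omega> \<in> space \<Omega>. ratio_event p a n \<omega>})" using ball by (simp add: Int_commute)
    then show ?thesis by (simp add: measure_def)
  next
    assume D: "D = cone_measure p n"
    have "emeasure D ?E = ennreal (\<Omega>.prob {\<omega> \<in> space \<Omega>. ratio_event p a n \<omega>})"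
      using emeasure_cone_measure[OF p1 _ prob[unfolded D] E] n ball by (simp add: D)
    then show ?thesis by (simp add: measure_def)
  next
    assume D: "D = surface_measure p n"
    have c: "Z ^ n * sqrt n * (LINT \<omega>|\<Omega>. grad_avg n \<omega>) > 0" using Zn pos n by (intro mult_pos_pos) auto
    have nn: "(LINT \<omega>|\<Omega>. grad_avg n \<omega> * indicator {\<omega> \<in> space \<Omega>. ratio_event p a n \<omega>} \<omega>) \<ge> 0"
      by (intro integral_nonneg_AE) (auto simp: grad_avg_nonneg)
    have n1: "n \<ge> 1" using n by simp
    have "emeasure D ?E = (\<integral>\<^sup>+y. surface_weight p n y * indicator ?E y \<partial>?V) / (\<integral>\<^sup>+y. surface_weight p n y \<partial>?V)"
      unfolding D by (rule emeasure_surface_measure[OF p1 n prob[unfolded D] E]) (use c Z_pos n1 pos in \<open>auto simp: surface_ratio(2)[OF n1]\<close>)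
    also have "\<dots> = ennreal (surface_prob a n)"
      unfolding surface_ratio[OF n1] surface_prob_def using c nn Zn n Z_pos
      by (subst divide_ennreal) (auto simp: mult_nonneg_nonneg)
    finally have "emeasure D ?E = ennreal (surface_prob a n)" .
    moreover have "surface_prob a n \<ge> 0" unfolding surface_prob_def using nn pos by simp
    ultimately show ?thesis by (simp add: measure_def)
  qed
qed

end

theorem theorem1p1:
  fixes p :: real
    and M :: "nat \<Rightarrow> 'a measure"
    and X :: "nat \<Rightarrow> 'a \<Rightarrow> nat \<Rightarrow> real"
  assumes "1 \<le> p"
    and "\<And>n. 1 \<le> n \<Longrightarrow> prob_space (M n)"
    and "\<And>n. 1 \<le> n \<Longrightarrow> X n \<in> measurable (M n) (lborel_Rn n)"
    and "\<And>n. 1 \<le> n \<Longrightarrow>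
           distr (M n) (lborel_Rn n) (X n) = uniform_p_ball p n \<or>
           distr (M n) (lborel_Rn n) (X n) = cone_measure p n \<or>
           distr (M n) (lborel_Rn n) (X n) = surface_measure p n"
  shows "m_exponent p < 0 \<and>
    (\<forall>a::real.
      (\<lambda>n. measure (M n) {\<omega> \<in> space (M n).
              (\<Prod>i=1..n. \<bar>X n \<omega> i\<bar>) powr (1 / real n) \<ge>
                exp (m_exponent p) * (1 + a / sqrt (real n)) *
                  ((1 / real n) * (\<Sum>i=1..n. \<bar>X n \<omega> i\<bar> powr p)) powr (1 / p)})
      \<longlonglongrightarrow> 1 - cdf std_normal_distribution (p * a / sqrt (deriv Digamma (1 / p) - p)))"
proof (intro conjI allI)
  interpret pgauss p by (rule pgauss.intro) (rule assms(1))
  show "m_exponent p < 0" by (rule m_exponent_neg)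
  fix a :: real
  have "1 / p \<notin> \<int>\<^sub>\<le>\<^sub>0" using nonpos_Ints_nonpos[of "1 / p"] p0 by auto
  from DERIV_imp_deriv[OF has_field_derivative_Polygamma[OF this, of 0]]
  have "deriv Digamma (1 / p) = Polygamma 1 (1 / p)" by simp
  then have \<sigma>_eq: "p * a / sqrt (deriv Digamma (1 / p) - p) = a / \<sigma>" using p0 by (simp add: \<sigma>_def)
  define m where "m n = measure (M n) {\<omega> \<in> space (M n). ratio_event p a n (X n \<omega>)}" for n
  let ?P = "\<lambda>n. \<Omega>.prob {\<omega> \<in> space \<Omega>. ratio_event p a n \<omega>}"
  let ?L = "1 - cdf std_normal_distribution (a / \<sigma>)"
  have m_eq: "m n = ?P n \<or> m n = surface_prob a n" if n: "2 \<le> n" and pos: "(LINT \<omega>|\<Omega>. grad_avg n \<omega>) > 0" for n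
  proof -
    have n1: "1 \<le> n" using n by simp
    interpret M: prob_space "M n" by (rule assms(2)[OF n1])
    let ?D = "distr (M n) (lborel_Rn n) (X n)"
    have E: "{y \<in> Rn n. ratio_event p a n y} \<in> sets (lborel_Rn n)" unfolding ratio_event_def by measurable
    have "X n -` {y \<in> Rn n. ratio_event p a n y} \<inter> space (M n) = {\<omega> \<in> space (M n). ratio_event p a n (X n \<omega>)}"
      using measurable_space[OF assms(3)[OF n1]] by auto
    then have "m n = measure ?D {y \<in> Rn n. ratio_event p a n y}"
      unfolding m_def using measure_distr[OF assms(3)[OF n1] E] by simp
    moreover have "emeasure ?D (Rn n) = 1"
      using prob_space.emeasure_space_1[OF M.prob_space_distr[OF assms(3)[OF n1]]] by simp
    ultimately show ?thesis using measure_ratio_event[OF n pos assms(4)[OF n1]] by simp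
  qed
  have "eventually (\<lambda>n. (LINT \<omega>|\<Omega>. grad_avg n \<omega>) > 0) sequentially"
    using grad_avg_limit \<gamma>_pos(1) by (rule order_tendstoD(1))
  \<comment> \<open>The kind of distribution may change with \<open>n\<close>; adding the two error
    terms covers every choice.\<close>
  then have "eventually (\<lambda>n. norm (m n - ?L) \<le> \<bar>?P n - ?L\<bar> + \<bar>surface_prob a n - ?L\<bar>) sequentially"
    using eventually_ge_at_top[of 2]
  proof eventually_elim
    case (elim n)
    then show ?case using m_eq[of n] by auto
  qed
  moreover have "(\<lambda>n. \<bar>?P n - ?L\<bar> + \<bar>surface_prob a n - ?L\<bar>) \<longlonglongrightarrow> 0"
    using tendsto_add[OF tendsto_rabs_zero[OF LIM_zero[OF ratio_prob_limit]] tendsto_rabs_zero[OF LIM_zero[OF surface_prob_limit]]]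
    by simp
  ultimately have "(\<lambda>n. m n - ?L) \<longlonglongrightarrow> 0" by (rule Lim_null_comparison)
  then have "m \<longlonglongrightarrow> ?L" by (rule LIM_zero_cancel)
  then show "(\<lambda>n. measure (M n) {\<omega> \<in> space (M n).
              (\<Prod>i=1..n. \<bar>X n \<omega> i\<bar>) powr (1 / real n) \<ge>
                exp (m_exponent p) * (1 + a / sqrt (real n)) *
                  ((1 / real n) * (\<Sum>i=1..n. \<bar>X n \<omega> i\<bar> powr p)) powr (1 / p)})
      \<longlonglongrightarrow> 1 - cdf std_normal_distribution (p * a / sqrt (deriv Digamma (1 / p) - p))"
    unfolding \<sigma>_eq m_def[abs_def] ratio_event_def .
qed

end
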